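(* Let $\Omega\subset\mathbb R^2$ be a bounded connected open set with $C^\infty$ boundary such that $|\Omega|=1$ and $$J(\Omega)=\inf_{\substack{\Omega'\subset\mathbb R^2\text{ open},\\ |\Omega'|=1}}J(\Omega').$$ Then $\Omega$ is a disc.
   Context: $(-\Delta)^{1/2}$ is the fractional Laplacian on $\mathbb R^2$, $\widehat{(-\Delta)^{1/2}v}(\xi)=|\xi|\hat v(\xi)$, continuous from $H^{1/2}(\mathbb R^2)$ to $H^{-1/2}(\mathbb R^2)$. $|\Omega|$ denotes Lebesgue measure and $\Omega^c=\mathbb R^2\setminus\Omega$. The energy is $$J(\Omega):=\inf_{\substack{v\in H^{1/2}(\mathbb R^2),\\ v|_{\Omega^c}=0}}\left(\frac12\left\langle(-\Delta)^{1/2}v,v\right\rangle_{H^{-1/2},H^{1/2}}-\int_{\mathbb R^2}v\right).$$ *)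

theory Defs
  imports "HOL-Analysis.Analysis"
begin

definition square_integrable :: "('a::euclidean_space \<Rightarrow> complex) \<Rightarrow> bool" where
  "square_integrable f \<longleftrightarrow>
     f \<in> borel_measurable lborel \<and> integrable lborel (\<lambda>x. (norm (f x))\<^sup>2)"

definition fourier_trunc :: "real \<Rightarrow> ('a::euclidean_space \<Rightarrow> complex) \<Rightarrow> 'a \<Rightarrow> complex" where
  "fourier_trunc R f \<xi> = (LINT x:cball 0 R|lborel. cis (- (x \<bullet> \<xi>)) * f x)"

(* The Plancherel transform: the limit in L^2 of the Fourier integrals (kernel e^{-i x.\<xi>},
   no prefactor) of the truncations of f. *)
definition has_fourier :: "('a::euclidean_space \<Rightarrow> complex) \<Rightarrow> ('a \<Rightarrow> complex) \<Rightarrow> bool" where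
  "has_fourier f g \<longleftrightarrow> square_integrable f \<and> square_integrable g \<and>
     ((\<lambda>R. \<integral>\<^sup>+ \<xi>. ennreal ((norm (g \<xi> - fourier_trunc R f \<xi>))\<^sup>2) \<partial>lborel) \<longlongrightarrow> 0) at_top"

(* Determined only almost everywhere; it is used only under integrals and in conditions that are
   invariant under changes on null sets. *)
definition fourier :: "('a::euclidean_space \<Rightarrow> real) \<Rightarrow> 'a \<Rightarrow> complex" where
  "fourier v = (SOME g. has_fourier (\<lambda>x. complex_of_real (v x)) g)"

(* H^s for s \<ge> 0, real-valued. By Plancherel's theorem the first conjunct just says that v is
   in L^2. *)
definition sobolev :: "real \<Rightarrow> ('a::euclidean_space \<Rightarrow> real) set" where
  "sobolev s = {v.
     has_fourier (\<lambda>x. complex_of_real (v x)) (fourier v) \<and>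
     square_integrable (\<lambda>\<xi>. complex_of_real ((1 + (norm \<xi>)\<^sup>2) powr (s / 2)) * fourier v \<xi>)}"

(* H^{-s} is taken as the dual of H^s, so that its elements are functionals and the duality
   pairing <u, w> is the application u w. The element of H^{-s} with Fourier transform g is
   given by Parseval's formula. For real-valued distributions (g(-\<xi>) = cnj (g \<xi>)) the integral
   is real, and Re is then only a coercion. *)
definition functional_of_fourier ::
    "('a::euclidean_space \<Rightarrow> complex) \<Rightarrow> ('a \<Rightarrow> real) \<Rightarrow> real" where
  "functional_of_fourier g w =
     Re (LINT \<xi>|lborel. g \<xi> * cnj (fourier w \<xi>)) / (2 * pi) ^ DIM('a)"

definition half_laplacian :: "('a::euclidean_space \<Rightarrow> real) \<Rightarrow> ('a \<Rightarrow> real) \<Rightarrow> real" where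
  "half_laplacian v = functional_of_fourier (\<lambda>\<xi>. complex_of_real (norm \<xi>) * fourier v \<xi>)"

lemma integrable_half_laplacian_pairing:
  fixes v w :: "'a::euclidean_space \<Rightarrow> real"
  assumes "v \<in> sobolev (1/2)" "w \<in> sobolev (1/2)"
  shows "integrable lborel
    (\<lambda>\<xi>. (complex_of_real (norm \<xi>) * fourier v \<xi>) * cnj (fourier w \<xi>))"
proof -
  define m where "m = (\<lambda>\<xi>::'a. (1 + (norm \<xi>)\<^sup>2) powr (1/2/2))"
  have sq: "(m \<xi>)\<^sup>2 \<ge> norm \<xi>" for \<xi>
  proof -
    have "(m \<xi>)\<^sup>2 = (1 + (norm \<xi>)\<^sup>2) powr (1/2)"
      by (simp add: m_def power2_eq_square flip: powr_add)
    also have "\<dots> = sqrt (1 + (norm \<xi>)\<^sup>2)"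
      by (simp add: powr_half_sqrt add_nonneg_nonneg)
    also have "\<dots> \<ge> norm \<xi>"
      by (rule real_le_rsqrt) simp
    finally show ?thesis .
  qed
  have I: "fourier u \<in> borel_measurable borel"
          "integrable lborel (\<lambda>\<xi>. (m \<xi>)\<^sup>2 * (norm (fourier u \<xi>))\<^sup>2)"
    if "u \<in> sobolev (1/2)" for u :: "'a \<Rightarrow> real"
    using that
    by (auto simp: sobolev_def has_fourier_def square_integrable_def m_def norm_mult
        power_mult_distrib)
  note [measurable] = I(1)[OF assms(1)] I(1)[OF assms(2)]
  show ?thesis
  proof (rule Bochner_Integration.integrable_bound[OF
        Bochner_Integration.integrable_add[OF I(2)[OF assms(1)] I(2)[OF assms(2)]]])
    show "(\<lambda>\<xi>. complex_of_real (norm \<xi>) * fourier v \<xi> * cnj (fourier w \<xi>))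
        \<in> borel_measurable lborel"
      using borel_measurable_continuous_on[OF continuous_on_cnj[OF continuous_on_id] I(1)[OF assms(2)]]
      by simp
    show "AE \<xi> in lborel. norm (complex_of_real (norm \<xi>) * fourier v \<xi> * cnj (fourier w \<xi>))
      \<le> norm ((m \<xi>)\<^sup>2 * (norm (fourier v \<xi>))\<^sup>2 + (m \<xi>)\<^sup>2 * (norm (fourier w \<xi>))\<^sup>2)"
    proof (rule AE_I2)
      fix \<xi> :: 'a
      let ?a = "norm (fourier v \<xi>)" and ?b = "norm (fourier w \<xi>)"
      have ab: "?a * ?b \<le> ?a\<^sup>2 + ?b\<^sup>2"
        using sum_squares_bound[of ?a ?b] mult_nonneg_nonneg[OF norm_ge_zero norm_ge_zero, of "fourier v \<xi>" "fourier w \<xi>"]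
        by linarith
      have "norm \<xi> * (?a * ?b) \<le> (m \<xi>)\<^sup>2 * (?a\<^sup>2 + ?b\<^sup>2)"
        by (rule mult_mono[OF sq ab]) auto
      then show "norm (complex_of_real (norm \<xi>) * fourier v \<xi> * cnj (fourier w \<xi>))
        \<le> norm ((m \<xi>)\<^sup>2 * ?a\<^sup>2 + (m \<xi>)\<^sup>2 * ?b\<^sup>2)"
        by (simp add: norm_mult mult.assoc distrib_left)
    qed
  qed
qed

lemma half_laplacian_pairing_self:
  fixes v :: "'a::euclidean_space \<Rightarrow> real"
  shows "half_laplacian v v =
    (LINT \<xi>|lborel. norm \<xi> * (norm (fourier v \<xi>))\<^sup>2) / (2 * pi) ^ DIM('a)"
proof -
  have "(\<lambda>\<xi>. (complex_of_real (norm \<xi>) * fourier v \<xi>) * cnj (fourier v \<xi>)) =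
        (\<lambda>\<xi>. complex_of_real (norm \<xi> * (norm (fourier v \<xi>))\<^sup>2))"
    by (simp add: fun_eq_iff mult.assoc complex_norm_square del: of_real_power)
  then show ?thesis
    by (simp only: half_laplacian_def functional_of_fourier_def integral_complex_of_real
        Re_complex_of_real)
qed

(* Elements of the Sobolev space are functions modulo null sets, so v = 0 off \<Omega> is meant almost
   everywhere. If \<Omega> has finite measure, such v are integrable, so the linear term is meaningful;
   the energy is only considered for such \<Omega>. *)
definition energy :: "(real^2) set \<Rightarrow> ereal" where
  "energy \<Omega> = (INF v \<in> {v \<in> sobolev (1/2). AE x in lborel. x \<notin> \<Omega> \<longrightarrow> v x = 0}.
     ereal (1/2 * half_laplacian v v - (LINT x|lborel. v x)))"

(* Near each boundary point, \<Omega> is the region strictly on one side of the graph of a smooth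
   function, in some orthonormal coordinate system (e1, e2). *)
definition smooth_boundary :: "(real^2) set \<Rightarrow> bool" where
  "smooth_boundary \<Omega> \<longleftrightarrow> (\<forall>p \<in> frontier \<Omega>. \<exists>r > 0. \<exists>e1 e2. \<exists>\<gamma> :: real \<Rightarrow> real.
     norm e1 = 1 \<and> norm e2 = 1 \<and> e1 \<bullet> e2 = 0 \<and>
     (\<forall>k t. (deriv ^^ k) \<gamma> differentiable (at t)) \<and>
     \<Omega> \<inter> ball p r = {x \<in> ball p r. \<gamma> (x \<bullet> e1) < x \<bullet> e2})"

end

(* The proof uses polarization (two-point rearrangement) instead of moving planes.
   For v in L^2 with bounded support, Plancherel's theorem and the identity
   |xi| = const * integral over tau of (1 - exp(-|xi|^2 / tau^2)) write <(-Delta)^(1/2) v, v> as a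
   superposition of the heat deficits |v|_2^2 - <v, exp(t Delta) v>.  Each of them decreases when v
   is polarized in a half-plane, strictly unless v dominates its reflection almost everywhere on
   that half-plane or is dominated by it.  The infimum defining J(Omega) is attained by some u >= 0,
   whose polarization is admissible for the polarized set, which is again open of measure 1; so
   minimality of Omega forces this dichotomy for every half-plane.  Comparing barycentres,
   {u > 0} is symmetric in all lines through its barycentre, and every point of {u > 0} may be moved
   towards the barycentre; Fubini then makes {u > 0} a ball up to a null set.  A ball of measure
   less than 1 could be dilated with a gain of energy, so the ball fills Omega up to a null set, and
   the regularity of the boundary removes the null set. *)

theory Submission
  imports Defs "HOL-Probability.Characteristic_Functions" "HOL-Probability.Sinc_Integral"
begin

subsection \<open>Gaussians and the heat kernel\<close>

text \<open>The quadratic form of the half Laplacian has a singular kernel: only squared differences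
  are integrable against it, and their square cannot be expanded term by term. A heat kernel at
  fixed time is bounded and integrable, so for functions in L^1 and L^2 every expansion and every
  reflection of a double integral is legitimate; the singularity reappears only in a final
  integration over time of nonnegative quantities, done in \<open>ennreal\<close>. Equality there
  forces equality of the deficits for almost every time, and a single positive time already gives
  the dichotomy, because each heat kernel is strictly decreasing in the distance. Which alternative
  of the dichotomy holds is decided by the sign of a first moment of {u > 0}. Two hyperplanes with
  the same normal, one of them through the barycentre, then compose to a translation, and this is
  how points are moved inwards. That the minimal energy is negative enters twice: it keeps {u > 0}
  from being null, and it makes dilation profitable.\<close>

definition heat_kernel :: "real \<Rightarrow> 'a::euclidean_space \<Rightarrow> real" where
  "heat_kernel t z = exp (- (norm z)\<^sup>2 / (4 * t)) / sqrt (4 * pi * t) ^ DIM('a)"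

lemma heat_kernel_nonneg [simp]: "t \<ge> 0 \<Longrightarrow> heat_kernel t z \<ge> 0"
  by (simp add: heat_kernel_def)

lemma heat_kernel_commute: "heat_kernel t (x - y) = heat_kernel t (y - x)"
  by (simp add: heat_kernel_def norm_minus_commute)

lemma borel_measurable_heat_kernel [measurable]: "heat_kernel t \<in> borel_measurable borel"
  unfolding heat_kernel_def by measurable

text \<open>This is the characteristic function of the standard normal law, rescaled by c = sqrt (2
  t) so that the exponent (c s)^2 / 2 becomes t s^2.\<close>

lemma has_bochner_integral_cis_gaussian_real:
  fixes t y :: real
  assumes "t > 0"
  shows "has_bochner_integral lborel (\<lambda>s. cis (s * y) * complex_of_real (exp (- t * s\<^sup>2)))
     (complex_of_real (sqrt (pi / t) * exp (- y\<^sup>2 / (4 * t))))"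
proof -
  define c where "c = sqrt (2 * t)"
  have c: "c > 0" "c\<^sup>2 = 2 * t" using assms by (auto simp: c_def)
  define f where "f = (\<lambda>x. std_normal_density x *\<^sub>R iexp ((y / c) * x))"
  have int: "integrable lborel f"
  proof -
    have "integrable lborel (\<lambda>x. std_normal_density x)"
      using integrable_std_normal_moment[of 0] by simp
    then show ?thesis unfolding f_def
      by (rule Bochner_Integration.integrable_bound) (auto simp: )
  qed
  have "(LINT x|lborel. f x) = char std_normal_distribution (y / c)"
    unfolding f_def char_def by (subst integral_density) auto
  also have "\<dots> = complex_of_real (exp (- (y / c)\<^sup>2 / 2))"
    by (simp add: char_std_normal_distribution)
  finally have I: "(LINT x|lborel. f x) = complex_of_real (exp (- (y / c)\<^sup>2 / 2))" .
  have J: "has_bochner_integral lborel (\<lambda>s. f (0 + c * s)) (complex_of_real (exp (- (y / c)\<^sup>2 / 2)) / c)"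
    using lborel_integral_real_affine[of c f 0] lborel_integrable_real_affine[OF int, of c 0] c I
    by (auto simp: has_bochner_integral_iff field_simps scaleR_conv_of_real)
  have eq: "f (0 + c * s) = cis (s * y) * complex_of_real (exp (- t * s\<^sup>2)) * complex_of_real (1 / sqrt (2 * pi))" for s
    using c by (auto simp: f_def std_normal_density_def cis_conv_exp scaleR_conv_of_real power_mult_distrib mult_ac)
  have K: "has_bochner_integral lborel (\<lambda>s. f (0 + c * s) * complex_of_real (sqrt (2 * pi)))
     (complex_of_real (exp (- (y / c)\<^sup>2 / 2)) / c * complex_of_real (sqrt (2 * pi)))"
    by (rule has_bochner_integral_mult_left) (use J in auto)
  have "(\<lambda>s. f (0 + c * s) * complex_of_real (sqrt (2 * pi))) = (\<lambda>s. cis (s * y) * complex_of_real (exp (- t * s\<^sup>2)))"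
    unfolding eq by (auto simp: fun_eq_iff)
  moreover have "complex_of_real (exp (- (y / c)\<^sup>2 / 2)) / c * complex_of_real (sqrt (2 * pi)) = 
     complex_of_real (exp (- (y / c)\<^sup>2 / 2) / c * sqrt (2 * pi))" by simp
  moreover have "exp (- (y / c)\<^sup>2 / 2) / c * sqrt (2 * pi) = sqrt (pi / t) * exp (- y\<^sup>2 / (4 * t))"
  proof -
    have "sqrt (2 * pi) / c = sqrt (pi / t)" using assms unfolding c_def real_sqrt_divide[symmetric] by simp
    moreover have "- (y / c)\<^sup>2 / 2 = - y\<^sup>2 / (4 * t)" using c by (simp add: power_divide)
    ultimately show ?thesis by (metis mult.commute times_divide_eq_left)
  qed
  ultimately show ?thesis using K by metis
qed

text \<open>Lebesgue measure is the image of a product of one-dimensional ones under the coordinate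
  map, so a product of functions of single coordinates integrates factor by factor. It reduces
  Gaussians to dimension one.\<close>

lemma has_bochner_integral_lborel_prod:
  fixes f :: "'a::euclidean_space \<Rightarrow> real \<Rightarrow> complex"
  assumes "\<And>b. b \<in> Basis \<Longrightarrow> has_bochner_integral lborel (f b) (c b)"
  shows "has_bochner_integral lborel (\<lambda>x. \<Prod>b\<in>Basis. f b (x \<bullet> b)) (\<Prod>b\<in>Basis. c b)"
proof -
  interpret product_sigma_finite "\<lambda>_::'a. lborel :: real measure" by standard
  let ?T = "\<lambda>g. \<Sum>b\<in>Basis. g b *\<^sub>R b :: 'a"
  have [measurable]: "f b \<in> borel_measurable borel" if "b \<in> Basis" for b
    using assms[OF that] by (auto simp: has_bochner_integral_iff dest: borel_measurable_integrable)
  have T: "?T \<in> measurable (\<Pi>\<^sub>M b\<in>Basis. lborel) borel" by simp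
  have M: "(\<lambda>x. \<Prod>b\<in>Basis. f b (x \<bullet> b)) \<in> borel_measurable borel"
    by measurable
  have *: "(\<Prod>b\<in>Basis. f b (?T g \<bullet> b)) = (\<Prod>b\<in>Basis. f b (g b))" for g
    by (rule prod.cong) auto
  have I: "integrable lborel (f b)" "integral\<^sup>L lborel (f b) = c b" if "b \<in> Basis" for b
    using assms[OF that] by (auto simp: has_bochner_integral_iff)
  show ?thesis
    unfolding has_bochner_integral_iff
  proof
    show "integrable lborel (\<lambda>x. \<Prod>b\<in>Basis. f b (x \<bullet> b))"
      by (subst lborel_eq, subst integrable_distr_eq[OF T M], subst *)
        (rule product_integrable_prod, auto simp: I)
    show "(LINT x|lborel. (\<Prod>b\<in>Basis. f b (x \<bullet> b))) = prod c Basis"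
      by (subst lborel_eq, subst integral_distr[OF T M], subst *, subst product_integral_prod)
        (auto simp: I)
  qed
qed

lemma cis_sum: "finite A \<Longrightarrow> cis (sum f A) = (\<Prod>a\<in>A. cis (f a))"
  by (induction A rule: finite_induct) (auto simp: cis_mult[symmetric])

lemma norm_sq_eq_sum_Basis: "(norm (x::'a::euclidean_space))\<^sup>2 = (\<Sum>b\<in>Basis. (x \<bullet> b)\<^sup>2)"
  by (metis (no_types, lifting) euclidean_inner power2_eq_square power2_norm_eq_inner sum.cong)

text \<open>Fourier inversion for the Gaussian: the weight exp(-t |\<xi>|^2) on frequencies
  corresponds to the heat kernel in space, with the factor (2 pi)^d that belongs to a transform
  without prefactor. It comes from sqrt (pi / t) = 2 pi / sqrt (4 pi t) in each coordinate.\<close>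

lemma has_bochner_integral_cis_gaussian:
  fixes z :: "'a::euclidean_space"
  assumes "t > 0"
  shows "has_bochner_integral lborel
    (\<lambda>\<xi>::'a. cis (\<xi> \<bullet> z) * complex_of_real (exp (- t * (norm \<xi>)\<^sup>2)))
    (complex_of_real ((2 * pi) ^ DIM('a) * heat_kernel t z))"
proof -
  have "has_bochner_integral lborel
     (\<lambda>\<xi>::'a. \<Prod>b\<in>Basis. cis ((\<xi> \<bullet> b) * (z \<bullet> b)) * complex_of_real (exp (- t * (\<xi> \<bullet> b)\<^sup>2)))
     (\<Prod>b\<in>Basis. complex_of_real (sqrt (pi / t) * exp (- (z \<bullet> b)\<^sup>2 / (4 * t))))"
    by (rule has_bochner_integral_lborel_prod)
      (rule has_bochner_integral_cis_gaussian_real[OF assms])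
  also have "(\<lambda>\<xi>::'a. \<Prod>b\<in>Basis. cis ((\<xi> \<bullet> b) * (z \<bullet> b)) * complex_of_real (exp (- t * (\<xi> \<bullet> b)\<^sup>2))) =
    (\<lambda>\<xi>::'a. cis (\<xi> \<bullet> z) * complex_of_real (exp (- t * (norm \<xi>)\<^sup>2)))"
    by (subst euclidean_inner[of _ z], subst norm_sq_eq_sum_Basis)
      (simp add: prod.distrib cis_sum sum_distrib_left exp_sum flip: of_real_prod sum_negf)
  also have "(\<Prod>b\<in>Basis. complex_of_real (sqrt (pi / t) * exp (- (z \<bullet> b)\<^sup>2 / (4 * t)))) =
    complex_of_real ((2 * pi) ^ DIM('a) * heat_kernel t z)"
  proof -
    have "(\<Prod>b\<in>Basis. sqrt (pi / t) * exp (- (z \<bullet> b)\<^sup>2 / (4 * t))) =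
      sqrt (pi / t) ^ DIM('a) * exp (- (norm z)\<^sup>2 / (4 * t))"
      by (subst norm_sq_eq_sum_Basis)
        (simp add: prod.distrib exp_sum sum_divide_distrib flip: sum_negf)
    moreover have "sqrt (pi / t) = 2 * pi / sqrt (4 * pi * t)"
      using assms by (simp add: real_sqrt_divide real_sqrt_mult field_simps)
    ultimately have "(\<Prod>b\<in>Basis. sqrt (pi / t) * exp (- (z \<bullet> b)\<^sup>2 / (4 * t))) = (2 * pi) ^ DIM('a) * heat_kernel t z"
      by (simp add: heat_kernel_def power_divide)
    then show ?thesis
      by (subst of_real_prod[symmetric]) (simp only:)
  qed
  finally show ?thesis .
qed

lemma heat_kernel_eq_scaled:
  assumes "t > 0"
  shows "heat_kernel t (sqrt t *\<^sub>R z) = heat_kernel 1 (z::'a::euclidean_space) / sqrt t ^ DIM('a)"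
  using assms by (simp add: heat_kernel_def real_sqrt_mult power_mult_distrib)

text \<open>The Gaussian identity is used at z = 0 with 1 / (4 t) in place of t: its weight is then
  the unnormalised heat kernel, and the two normalising square roots multiply to 2 pi.\<close>

lemma integral_heat_kernel:
  assumes "t > 0"
  shows "has_bochner_integral lborel (heat_kernel t :: 'a::euclidean_space \<Rightarrow> real) 1"
proof -
  have "has_bochner_integral lborel
    (\<lambda>\<xi>::'a. Re (cis (\<xi> \<bullet> 0) * complex_of_real (exp (- (1 / (4 * t)) * (norm \<xi>)\<^sup>2))))
    (Re (complex_of_real ((2 * pi) ^ DIM('a) * heat_kernel (1 / (4 * t)) (0::'a))))"
    using assms by (intro has_bochner_integral_Re has_bochner_integral_cis_gaussian) auto
  then have "has_bochner_integral lborel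
    (\<lambda>\<xi>::'a. exp (- (norm \<xi>)\<^sup>2 / (4 * t))) ((2 * pi) ^ DIM('a) * heat_kernel (1 / (4 * t)) (0::'a))"
    by simp
  then have "has_bochner_integral lborel
    (\<lambda>\<xi>::'a. exp (- (norm \<xi>)\<^sup>2 / (4 * t)) / sqrt (4 * pi * t) ^ DIM('a))
       ((2 * pi) ^ DIM('a) * heat_kernel (1 / (4 * t)) (0::'a) / sqrt (4 * pi * t) ^ DIM('a))"
    by (rule has_bochner_integral_divide_zero)
  moreover have "(2 * pi) ^ DIM('a) * heat_kernel (1 / (4 * t)) (0::'a) / sqrt (4 * pi * t) ^ DIM('a) = 1"
  proof -
    have "2 * pi / (sqrt (4 * pi * (1 / (4 * t))) * sqrt (4 * pi * t)) = 1"
      using assms by (simp add: real_sqrt_mult real_sqrt_divide)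
    then have "(2 * pi / (sqrt (4 * pi * (1 / (4 * t))) * sqrt (4 * pi * t))) ^ DIM('a) = 1"
      by (simp only: power_one)
    then show ?thesis
      by (simp add: heat_kernel_def power_divide power_mult_distrib del: real_sqrt_mult)
  qed
  ultimately show ?thesis by (simp add: heat_kernel_def[abs_def])
qed

lemma has_bochner_integral_nonneg:
  fixes f :: "'a \<Rightarrow> real"
  assumes "has_bochner_integral M f I" "\<And>x. 0 \<le> f x"
  shows "0 \<le> I"
  using assms by (auto simp: has_bochner_integral_iff intro!: integral_nonneg)

lemma has_bochner_integral_mono:
  fixes f g :: "'a \<Rightarrow> real"
  assumes "has_bochner_integral M f I" "has_bochner_integral M g J" "\<And>x. f x \<le> g x"
  shows "I \<le> J"
  using assms by (auto simp: has_bochner_integral_iff intro!: integral_mono)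

lemma integrable_tensor:
  fixes f :: "'a \<Rightarrow> 'c::{banach, second_countable_topology, real_normed_field}" and g :: "'b \<Rightarrow> 'c"
  assumes M: "sigma_finite_measure M" "sigma_finite_measure N"
    and f: "integrable M f" and g: "integrable N g"
  shows "integrable (M \<Otimes>\<^sub>M N) (\<lambda>p. f (fst p) * g (snd p))"
proof -
  interpret M: sigma_finite_measure M by fact
  interpret N: sigma_finite_measure N by fact
  interpret pair_sigma_finite M N ..
  have [measurable]: "f \<in> borel_measurable M" "g \<in> borel_measurable N" using f g by auto
  show ?thesis
    by (rule Fubini_integrable) (use f g in \<open>auto simp: norm_mult\<close>)
qed

lemma has_bochner_integral_lborel_affine:
  fixes f :: "'a::euclidean_space \<Rightarrow> 'b::{banach, second_countable_topology}"
  assumes "c \<noteq> 0" and f: "has_bochner_integral lborel f I"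
  shows "has_bochner_integral lborel (\<lambda>x. f (a + c *\<^sub>R x)) ((1 / \<bar>c\<bar> ^ DIM('a)) *\<^sub>R I)"
proof -
  have [measurable]: "f \<in> borel_measurable borel"
    using f by (auto simp: has_bochner_integral_iff dest: borel_measurable_integrable)
  have "has_bochner_integral (density (distr lborel borel (\<lambda>x. a + c *\<^sub>R x)) (\<lambda>_. ennreal (\<bar>c\<bar> ^ DIM('a)))) f I"
    using f lborel_affine[OF assms(1), of a] by simp
  then have "integrable lborel (\<lambda>x. \<bar>c\<bar> ^ DIM('a) *\<^sub>R f (a + c *\<^sub>R x))"
    "(LINT x|lborel. \<bar>c\<bar> ^ DIM('a) *\<^sub>R f (a + c *\<^sub>R x)) = I"
    by (auto simp: has_bochner_integral_iff integrable_density integral_density integrable_distr_eq integral_distr)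
  moreover from this(1) have "integrable lborel (\<lambda>x. (1 / \<bar>c\<bar> ^ DIM('a)) *\<^sub>R \<bar>c\<bar> ^ DIM('a) *\<^sub>R f (a + c *\<^sub>R x))"
    by (rule integrable_scaleR_right)
  ultimately show ?thesis using assms(1) by (auto simp: has_bochner_integral_iff)
qed

lemma nn_integral_lborel_affine:
  fixes f :: "'a::euclidean_space \<Rightarrow> ennreal"
  assumes "c \<noteq> 0" and [measurable]: "f \<in> borel_measurable borel"
  shows "(\<integral>\<^sup>+x. f x \<partial>lborel) = ennreal (\<bar>c\<bar> ^ DIM('a)) * (\<integral>\<^sup>+x. f (a + c *\<^sub>R x) \<partial>lborel)"
  by (subst lborel_affine[OF assms(1), of a])
     (simp add: nn_integral_density nn_integral_distr nn_integral_cmult)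

lemma has_bochner_integral_heat_kernel_diff:
  assumes "t > 0"
  shows "has_bochner_integral lborel (\<lambda>y. heat_kernel t (x - y :: 'a::euclidean_space)) 1"
  using has_bochner_integral_lborel_affine[of "-1", OF _ integral_heat_kernel[OF assms], of x]
  by simp

lemma heat_kernel_le: "t > 0 \<Longrightarrow> heat_kernel t (z::'a::euclidean_space) \<le> heat_kernel t (0::'a)"
  by (auto simp: heat_kernel_def divide_simps)

text \<open>A representative defined at every point, in contrast to \<open>fourier\<close>, which is
  chosen among almost everywhere equal functions. The two are compared in
  \<open>fourier_bounded_support\<close>.\<close>

definition fourier_integral :: "('a::euclidean_space \<Rightarrow> real) \<Rightarrow> 'a \<Rightarrow> complex" where
  "fourier_integral v \<xi> = (LINT x|lborel. cis (- (x \<bullet> \<xi>)) * complex_of_real (v x))"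

text \<open>The pairing <v, exp(t Delta) v>, written as one integral over pairs of points so that
  reflections can act on each variable separately.\<close>

definition heat_form :: "real \<Rightarrow> ('a::euclidean_space \<Rightarrow> real) \<Rightarrow> real" where
  "heat_form t v = (LINT p|(lborel \<Otimes>\<^sub>M lborel). v (fst p) * v (snd p) * heat_kernel t (fst p - snd p))"

lemma borel_measurable_cis [measurable]: "cis \<in> borel_measurable borel"
  unfolding cis_conv_exp by measurable

lemma integrable_fourier_integral:
  assumes "integrable lborel v"
  shows "integrable lborel (\<lambda>x. cis (- (x \<bullet> \<xi>)) * complex_of_real (v x))"
proof (rule Bochner_Integration.integrable_bound[OF assms])
  have [measurable]: "v \<in> borel_measurable borel" using assms by auto
  show "(\<lambda>x. cis (- (x \<bullet> \<xi>)) * complex_of_real (v x)) \<in> borel_measurable lborel" by measurable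
qed (auto simp: norm_mult)

lemma borel_measurable_fourier_integral [measurable]:
  assumes [measurable]: "v \<in> borel_measurable borel"
  shows "fourier_integral v \<in> borel_measurable borel"
  unfolding fourier_integral_def by measurable

lemma norm_fourier_integral_le:
  assumes "integrable lborel v"
  shows "norm (fourier_integral v \<xi>) \<le> (LINT x|lborel. \<bar>v x\<bar>)"
proof -
  have "norm (fourier_integral v \<xi>) \<le> (LINT x|lborel. norm (cis (- (x \<bullet> \<xi>)) * complex_of_real (v x)))"
    unfolding fourier_integral_def by (rule integral_norm_bound)
  then show ?thesis by (simp add: norm_mult)
qed

lemma integrable_heat_form:
  fixes v :: "'a::euclidean_space \<Rightarrow> real"
  assumes t: "t > 0" and v: "integrable lborel v"
  shows "integrable (lborel \<Otimes>\<^sub>M lborel) (\<lambda>p. v (fst p) * v (snd p) * heat_kernel t (fst p - snd p))"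
proof -
  have [measurable]: "v \<in> borel_measurable borel" using v by auto
  have "integrable (lborel \<Otimes>\<^sub>M lborel) (\<lambda>p. v (fst p) * v (snd p) * heat_kernel t (0::'a))"
    by (intro integrable_mult_left integrable_tensor v) (auto intro: lborel.sigma_finite_measure_axioms)
  then show ?thesis
  proof (rule Bochner_Integration.integrable_bound)
    show "AE p in lborel \<Otimes>\<^sub>M lborel. norm (v (fst p) * v (snd p) * heat_kernel t (fst p - snd p))
          \<le> norm (v (fst p) * v (snd p) * heat_kernel t (0::'a))"
      using t heat_kernel_le[OF t] by (intro AE_I2) (auto simp: abs_mult intro!: mult_left_mono)
  qed measurable
qed

text \<open>Fubini for the triple integral over (\<xi>, x, y) obtained by writing |fourier_integral
  v|^2 as a double integral. The Gaussian weight makes it absolutely convergent; integrating over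
  (x, y) first gives the left side, integrating over \<xi> first produces the heat kernel.\<close>

lemma gaussian_fourier_integral:
  fixes v :: "'a::euclidean_space \<Rightarrow> real"
  assumes t: "t > 0" and v: "integrable lborel v"
  shows "has_bochner_integral lborel (\<lambda>\<xi>. exp (- t * (norm \<xi>)\<^sup>2) * (norm (fourier_integral v \<xi>))\<^sup>2)
    ((2 * pi) ^ DIM('a) * heat_form t v)"
proof -
  let ?P = "lborel \<Otimes>\<^sub>M lborel :: ('a \<times> 'a) measure"
  have sf: "sigma_finite_measure ?P" by (rule lborel_pair.sigma_finite_measure_axioms)
  interpret P: sigma_finite_measure ?P by fact
  interpret L3: pair_sigma_finite "lborel :: 'a measure" ?P ..
  note sfl = lborel.sigma_finite_measure_axioms
  have [measurable]: "v \<in> borel_measurable borel" using v by auto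
  define F where "F = (\<lambda>\<xi> (p::'a\<times>'a). complex_of_real (exp (- t * (norm \<xi>)\<^sup>2)) *
     ((cis (- (fst p \<bullet> \<xi>)) * complex_of_real (v (fst p))) * cnj (cis (- (snd p \<bullet> \<xi>)) * complex_of_real (v (snd p)))))"
  have g: "integrable lborel (\<lambda>\<xi>::'a. exp (- t * (norm \<xi>)\<^sup>2))"
  proof -
    from has_bochner_integral_cis_gaussian[OF t, of "0::'a", THEN has_bochner_integral_Re]
    show ?thesis by (auto simp: has_bochner_integral_iff)
  qed
  have Feq: "F \<xi> p = cis (\<xi> \<bullet> (snd p - fst p)) * complex_of_real (exp (- t * (norm \<xi>)\<^sup>2)) *
     complex_of_real (v (fst p) * v (snd p))" for \<xi> p
    unfolding F_def by (simp add: cis_cnj cis_mult mult_ac inner_diff_right inner_commute)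
  have Fm: "(\<lambda>q. F (fst q) (snd q)) \<in> borel_measurable (lborel \<Otimes>\<^sub>M ?P)"
    unfolding Feq by measurable
  have int3: "integrable (lborel \<Otimes>\<^sub>M ?P) (\<lambda>q. F (fst q) (snd q))"
  proof -
    have "integrable (lborel \<Otimes>\<^sub>M ?P) (\<lambda>q::'a\<times>'a\<times>'a. exp (- t * (norm (fst q))\<^sup>2) * (v (fst (snd q)) * v (snd (snd q))))"
      by (rule integrable_tensor[OF sfl sf g]) (rule integrable_tensor[OF sfl sfl v v])
    then show ?thesis
      by (rule Bochner_Integration.integrable_bound[OF _ Fm]) (auto simp: Feq norm_mult abs_mult)
  qed
  have inner1: "(LINT p|?P. F \<xi> p) = complex_of_real (exp (- t * (norm \<xi>)\<^sup>2) * (norm (fourier_integral v \<xi>))\<^sup>2)" for \<xi>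
  proof -
    let ?f = "\<lambda>x. cis (- (x \<bullet> \<xi>)) * complex_of_real (v x)"
    have If: "integrable lborel ?f" by (rule integrable_fourier_integral[OF v])
    have Ic: "integrable lborel (\<lambda>x. cnj (?f x))" using If by (rule integrable_cnj)
    have "(LINT p|?P. ?f (fst p) * cnj (?f (snd p))) = (LINT x|lborel. LINT y|lborel. ?f x * cnj (?f y))"
      using lborel_pair.integral_fst'[OF integrable_tensor[OF sfl sfl If Ic]] by simp
    also have "\<dots> = fourier_integral v \<xi> * cnj (fourier_integral v \<xi>)"
      using Bochner_Integration.integral_cnj[of lborel ?f]
      by (simp only: integral_mult_right_zero integral_mult_left_zero fourier_integral_def)
    finally have "(LINT p|?P. ?f (fst p) * cnj (?f (snd p))) = complex_of_real ((norm (fourier_integral v \<xi>))\<^sup>2)"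
      by (simp only: complex_norm_square)
    then show ?thesis unfolding F_def by (simp only: integral_mult_right_zero of_real_mult)
  qed
  have inner2: "(LINT \<xi>|lborel. F \<xi> p) =
     complex_of_real ((2 * pi) ^ DIM('a) * (v (fst p) * v (snd p) * heat_kernel t (fst p - snd p)))" for p
    using has_bochner_integral_cis_gaussian[OF t, of "snd p - fst p"]
    unfolding Feq integral_mult_left_zero
    by (simp add: has_bochner_integral_iff heat_kernel_commute[of t "fst p"])
  have "integrable lborel (\<lambda>\<xi>. LINT p|?P. F \<xi> p)"
    using L3.integrable_fst'[OF int3] by simp
  then have 1: "integrable lborel (\<lambda>\<xi>. exp (- t * (norm \<xi>)\<^sup>2) * (norm (fourier_integral v \<xi>))\<^sup>2)"
    unfolding inner1 by (simp only: complex_of_real_integrable_eq)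
  have "(LINT \<xi>|lborel. (LINT p|?P. F \<xi> p)) = (LINT p|?P. (LINT \<xi>|lborel. F \<xi> p))"
    using L3.Fubini_integral[of F] int3 by (simp add: case_prod_beta')
  then have "(LINT \<xi>|lborel. exp (- t * (norm \<xi>)\<^sup>2) * (norm (fourier_integral v \<xi>))\<^sup>2) =
     (LINT p|?P. (2 * pi) ^ DIM('a) * (v (fst p) * v (snd p) * heat_kernel t (fst p - snd p)))"
    unfolding inner1 inner2 by (simp only: integral_complex_of_real of_real_eq_iff)
  also have "\<dots> = (2 * pi) ^ DIM('a) * heat_form t v"
    unfolding heat_form_def by simp
  finally show ?thesis using 1 by (simp add: has_bochner_integral_iff)
qed

text \<open>Since v may change sign, positivity is invisible in space; it is read off the Fourier
  side.\<close>

lemma heat_form_nonneg: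
  fixes v :: "'a::euclidean_space \<Rightarrow> real"
  assumes "t > 0" "integrable lborel v"
  shows "heat_form t v \<ge> 0"
proof -
  have "0 \<le> (2 * pi) ^ DIM('a) * heat_form t v"
    using gaussian_fourier_integral[OF assms] by (rule has_bochner_integral_nonneg) auto
  then show ?thesis
    using mult_left_le_imp_le[of "(2 * pi) ^ DIM('a)" 0 "heat_form t v"] by simp
qed

text \<open>The kernel has mass one in either variable. These are the two diagonal terms when a
  squared difference is expanded under the kernel.\<close>

lemma has_bochner_integral_heat_kernel_weight:
  fixes f :: "'a::euclidean_space \<Rightarrow> real"
  assumes t: "t > 0" and f: "integrable lborel f"
  shows "has_bochner_integral (lborel \<Otimes>\<^sub>M lborel) (\<lambda>p. f (fst p) * heat_kernel t (fst p - snd p)) (LINT x|lborel. f x)"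
    and "has_bochner_integral (lborel \<Otimes>\<^sub>M lborel) (\<lambda>p. f (snd p) * heat_kernel t (fst p - snd p)) (LINT x|lborel. f x)"
proof -
  have [measurable]: "f \<in> borel_measurable borel" using f by auto
  have K: "integrable lborel (\<lambda>y. heat_kernel t (x - y))" "(LINT y|lborel. heat_kernel t (x - y)) = 1" for x :: 'a
    using has_bochner_integral_heat_kernel_diff[OF t, of x] by (auto simp: has_bochner_integral_iff)
  have A: "integrable (lborel \<Otimes>\<^sub>M lborel) (\<lambda>p. f (fst p) * heat_kernel t (fst p - snd p))"
    by (rule lborel_pair.Fubini_integrable) (use t f K in \<open>auto simp: abs_mult\<close>)
  have B: "integral\<^sup>L (lborel \<Otimes>\<^sub>M lborel) (\<lambda>p. f (fst p) * heat_kernel t (fst p - snd p)) = (LINT x|lborel. f x)"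
    by (subst lborel_pair.integral_fst'[OF A, symmetric]) (simp add: K)
  show 1: "has_bochner_integral (lborel \<Otimes>\<^sub>M lborel) (\<lambda>p. f (fst p) * heat_kernel t (fst p - snd p)) (LINT x|lborel. f x)"
    using A B by (simp add: has_bochner_integral_iff)
  have eq: "(\<lambda>(x,y). f (fst (y,x)) * heat_kernel t (fst (y,x) - snd (y,x))) = (\<lambda>p. f (snd p) * heat_kernel t (fst p - snd p))"
    by (auto simp: fun_eq_iff heat_kernel_commute)
  have "integrable (lborel \<Otimes>\<^sub>M lborel) (\<lambda>p. f (snd p) * heat_kernel t (fst p - snd p))"
    using lborel_pair.integrable_product_swap[OF A] by (simp only: eq)
  moreover have "integral\<^sup>L (lborel \<Otimes>\<^sub>M lborel) (\<lambda>p. f (snd p) * heat_kernel t (fst p - snd p)) = (LINT x|lborel. f x)"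
    using lborel_pair.integral_product_swap[OF borel_measurable_integrable[OF A]] B by (simp only: eq)
  ultimately show "has_bochner_integral (lborel \<Otimes>\<^sub>M lborel) (\<lambda>p. f (snd p) * heat_kernel t (fst p - snd p)) (LINT x|lborel. f x)"
    by (simp add: has_bochner_integral_iff)
qed

text \<open>Membership in L^1 makes the Fourier integral and the double integrals converge,
  membership in L^2 is what Plancherel's theorem needs. Square integrable functions of bounded
  support satisfy both.\<close>

definition integrable12 :: "('a::euclidean_space \<Rightarrow> real) \<Rightarrow> bool" where
  "integrable12 v \<longleftrightarrow> integrable lborel v \<and> integrable lborel (\<lambda>x. (v x)\<^sup>2)"

definition heat_deficit :: "real \<Rightarrow> ('a::euclidean_space \<Rightarrow> real) \<Rightarrow> real" where
  "heat_deficit t v = (LINT x|lborel. (v x)\<^sup>2) - heat_form t v"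

text \<open>Expanding the square gives twice the squared L^2 norm minus twice the heat form. In this
  shape an inequality between deficits follows from a pointwise inequality between squared
  differences.\<close>

lemma has_bochner_integral_heat_deficit:
  fixes v :: "'a::euclidean_space \<Rightarrow> real"
  assumes t: "t > 0" and v: "integrable12 v"
  shows "has_bochner_integral (lborel \<Otimes>\<^sub>M lborel) (\<lambda>p. (v (fst p) - v (snd p))\<^sup>2 * heat_kernel t (fst p - snd p))
     (2 * heat_deficit t v)"
proof -
  let ?P = "lborel \<Otimes>\<^sub>M lborel :: ('a \<times> 'a) measure"
  have v1: "integrable lborel v" and v2: "integrable lborel (\<lambda>x. (v x)\<^sup>2)"
    using v by (auto simp: integrable12_def)
  have "has_bochner_integral ?P (\<lambda>p. ((v (fst p))\<^sup>2 * heat_kernel t (fst p - snd p) + (v (snd p))\<^sup>2 * heat_kernel t (fst p - snd p))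
     - 2 * (v (fst p) * v (snd p) * heat_kernel t (fst p - snd p)))
     (((LINT x|lborel. (v x)\<^sup>2) + (LINT x|lborel. (v x)\<^sup>2)) - 2 * heat_form t v)"
    unfolding heat_form_def
    by (intro has_bochner_integral_diff has_bochner_integral_add has_bochner_integral_mult_right
        has_bochner_integral_heat_kernel_weight[OF t v2] has_bochner_integral_integrable integrable_heat_form[OF t v1])
  then show ?thesis
    by (simp add: heat_deficit_def power2_diff algebra_simps)
qed

lemma heat_deficit_nonneg: "t > 0 \<Longrightarrow> integrable12 v \<Longrightarrow> heat_deficit t v \<ge> 0"
  using has_bochner_integral_nonneg[OF has_bochner_integral_heat_deficit[of t v]] by auto

lemma heat_deficit_le: "t > 0 \<Longrightarrow> integrable12 v \<Longrightarrow> heat_deficit t v \<le> (LINT x|lborel. (v x)\<^sup>2)"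
  using heat_form_nonneg[of t v] by (auto simp: heat_deficit_def integrable12_def)

lemma integrable_square_add:
  fixes f g :: "'a::euclidean_space \<Rightarrow> real"
  assumes "f \<in> borel_measurable borel" "g \<in> borel_measurable borel"
    and "integrable lborel (\<lambda>x. (f x)\<^sup>2)" "integrable lborel (\<lambda>x. (g x)\<^sup>2)"
  shows "integrable lborel (\<lambda>x. (f x + g x)\<^sup>2)"
proof (rule Bochner_Integration.integrable_bound)
  show "integrable lborel (\<lambda>x. 2 * (f x)\<^sup>2 + 2 * (g x)\<^sup>2)" using assms by auto
  show "AE x in lborel. norm ((f x + g x)\<^sup>2) \<le> norm (2 * (f x)\<^sup>2 + 2 * (g x)\<^sup>2)"
  proof (rule AE_I2)
    fix x
    have "(f x + g x)\<^sup>2 \<le> 2 * (f x)\<^sup>2 + 2 * (g x)\<^sup>2"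
      using sum_squares_bound[of "f x" "g x"] by (simp add: power2_sum)
    then show "norm ((f x + g x)\<^sup>2) \<le> norm (2 * (f x)\<^sup>2 + 2 * (g x)\<^sup>2)" by simp
  qed
qed (use assms in measurable)

lemma integrable12_add: "integrable12 f \<Longrightarrow> integrable12 g \<Longrightarrow> integrable12 (\<lambda>x. f x + g x)"
  by (auto simp: integrable12_def intro!: integrable_square_add)

lemma integrable12_cmult: "integrable12 f \<Longrightarrow> integrable12 (\<lambda>x. c * f x)"
  by (auto simp: integrable12_def power_mult_distrib)

lemma integrable12_diff: "integrable12 f \<Longrightarrow> integrable12 g \<Longrightarrow> integrable12 (\<lambda>x. f x - g x)"
  using integrable12_add[OF _ integrable12_cmult[of g "-1"], of f] by simp

text \<open>Comes from (a + b)^2 <= 2 a^2 + 2 b^2 under the kernel; it carries smallness of the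
  deficit from a dense class to all of L^1 and L^2.\<close>

lemma heat_deficit_add_le:
  assumes t: "t > 0" and f: "integrable12 f" and g: "integrable12 g"
  shows "heat_deficit t (\<lambda>x. f x + g x) \<le> 2 * heat_deficit t f + 2 * heat_deficit t g"
proof -
  let ?K = "\<lambda>p. heat_kernel t (fst p - snd p)"
  have "2 * heat_deficit t (\<lambda>x. f x + g x) \<le> 2 * (2 * heat_deficit t f) + 2 * (2 * heat_deficit t g)"
  proof (rule has_bochner_integral_mono)
    show "has_bochner_integral (lborel \<Otimes>\<^sub>M lborel) (\<lambda>p. ((f (fst p) + g (fst p)) - (f (snd p) + g (snd p)))\<^sup>2 * ?K p)
       (2 * heat_deficit t (\<lambda>x. f x + g x))"
      by (rule has_bochner_integral_heat_deficit[OF t integrable12_add[OF f g]])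
    show "has_bochner_integral (lborel \<Otimes>\<^sub>M lborel) (\<lambda>p. 2 * ((f (fst p) - f (snd p))\<^sup>2 * ?K p) + 2 * ((g (fst p) - g (snd p))\<^sup>2 * ?K p))
       (2 * (2 * heat_deficit t f) + 2 * (2 * heat_deficit t g))"
      by (intro has_bochner_integral_add has_bochner_integral_mult_right has_bochner_integral_heat_deficit t f g)
    fix p
    have "((f (fst p) + g (fst p)) - (f (snd p) + g (snd p)))\<^sup>2 \<le> 2 * (f (fst p) - f (snd p))\<^sup>2 + 2 * (g (fst p) - g (snd p))\<^sup>2"
      using sum_squares_bound[of "f (fst p) - f (snd p)" "g (fst p) - g (snd p)"]
      by (simp add: power2_eq_square algebra_simps)
    then show "((f (fst p) + g (fst p)) - (f (snd p) + g (snd p)))\<^sup>2 * ?K p \<le> 2 * ((f (fst p) - f (snd p))\<^sup>2 * ?K p) + 2 * ((g (fst p) - g (snd p))\<^sup>2 * ?K p)"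
      using mult_right_mono[of _ _ "?K p"] t by (fastforce simp: distrib_right mult.assoc)
  qed
  then show ?thesis by simp
qed

subsection \<open>Plancherel's theorem\<close>

text \<open>A measurable function is an almost everywhere limit of continuous ones. Clipping these
  to [-M, M] and cutting them off in space provides a common majorant, so the convergence also holds
  in L^2.\<close>

lemma exists_continuous_L2_approx_bounded:
  fixes v :: "'a::euclidean_space \<Rightarrow> real"
  assumes v [measurable]: "v \<in> borel_measurable borel" and bd: "\<And>x. \<bar>v x\<bar> \<le> M"
    and supp: "\<And>x. norm x > R \<Longrightarrow> v x = 0" and "\<epsilon> > 0"
  shows "\<exists>g. continuous_on UNIV g \<and> (\<forall>x. \<bar>g x\<bar> \<le> M) \<and> (\<forall>x. norm x > R + 1 \<longrightarrow> g x = 0) \<and>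
     integrable lborel (\<lambda>x. (v x - g x)\<^sup>2) \<and> (LINT x|lborel. (v x - g x)\<^sup>2) < \<epsilon>"
proof -
  have M: "M \<ge> 0" using bd[of undefined] by linarith
  have "v measurable_on UNIV"
    by (rule lebesgue_measurable_imp_measurable_on_real) (auto intro: measurable_completion)
  then obtain N g where N: "negligible N" and g: "\<And>n::nat. continuous_on UNIV (g n)"
    and lim: "\<And>x. x \<notin> N \<Longrightarrow> (\<lambda>n. g n x) \<longlonglongrightarrow> v x"
    by (auto simp: measurable_on_def)
  \<comment> \<open>The cutoff equals 1 where norm x <= R and vanishes where norm x >= R +
    1.\<close>
  define c where "c = (\<lambda>x::'a. max 0 (min 1 (R + 1 - norm x)))"
  define h where "h = (\<lambda>n x. max (- M) (min M (g n x)) * c x)"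
  have c: "0 \<le> c x" "c x \<le> 1" for x by (auto simp: c_def)
  have cont: "continuous_on UNIV (h n)" for n
    unfolding h_def c_def using g by (intro continuous_intros) auto
  have hm [measurable]: "h n \<in> borel_measurable borel" for n
    using cont by (rule borel_measurable_continuous_onI)
  have hM: "\<bar>h n x\<bar> \<le> M" for n x
  proof -
    have "\<bar>h n x\<bar> \<le> M * 1" unfolding h_def abs_mult
      by (rule mult_mono) (use M c in \<open>auto\<close>)
    then show ?thesis by simp
  qed
  have h0: "h n x = 0" if "norm x > R + 1" for n x using that by (auto simp: h_def c_def)
  have ae: "AE x in lborel. (\<lambda>n. (v x - h n x)\<^sup>2) \<longlonglongrightarrow> 0"
  proof -
    have "AE x in lebesgue. x \<notin> N"
      using N by (intro AE_not_in) (simp add: negligible_iff_null_sets)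
    then have "AE x in lborel. x \<notin> N" by (simp add: AE_completion_iff)
    then show ?thesis
    proof eventually_elim
      case (elim x)
      have "(\<lambda>n. h n x) \<longlonglongrightarrow> max (- M) (min M (v x)) * c x"
        unfolding h_def using lim[OF elim] by (intro tendsto_intros)
      also have "max (- M) (min M (v x)) = v x" using bd[of x] by auto
      also have "v x * c x = v x" by (cases "norm x > R") (auto simp: supp c_def)
      finally have "(\<lambda>n. (v x - h n x)\<^sup>2) \<longlonglongrightarrow> (v x - v x)\<^sup>2" by (intro tendsto_intros)
      then show ?case by simp
    qed
  qed
  let ?w = "\<lambda>x::'a. (2 * M)\<^sup>2 * indicator (cball 0 (R + 1)) x :: real"
  have w: "integrable lborel ?w"
    using emeasure_lborel_cball_finite[of "0::'a" "R + 1"]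
    by (intro integrable_mult_right integrable_real_indicator) auto
  have dom: "norm ((v x - h n x)\<^sup>2) \<le> ?w x" for n x
  proof (cases "norm x > R + 1")
    case True
    then show ?thesis using h0 supp[of x] by (simp add: )
  next
    case False
    have "\<bar>v x - h n x\<bar> \<le> 2 * M" using bd[of x] hM[of n x] by linarith
    then have "(v x - h n x)\<^sup>2 \<le> (2 * M)\<^sup>2" by (metis abs_ge_zero power2_abs power_mono)
    then show ?thesis using False by simp
  qed
  have ints: "integrable lborel (\<lambda>x. (v x - h n x)\<^sup>2)" for n
    by (rule Bochner_Integration.integrable_bound[OF w]) (use dom in \<open>auto intro: order.trans[OF _ abs_ge_self]\<close>)
  have "(\<lambda>n. LINT x|lborel. (v x - h n x)\<^sup>2) \<longlonglongrightarrow> (LINT x::'a|lborel. 0::real)"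
    by (rule integral_dominated_convergence[OF _ _ w ae]) (use dom in auto)
  then have "eventually (\<lambda>n. (LINT x|lborel. (v x - h n x)\<^sup>2) < \<epsilon>) sequentially"
    using \<open>\<epsilon> > 0\<close> by (auto dest!: order_tendstoD(2)[of _ _ _ \<epsilon>])
  then obtain n where "(LINT x|lborel. (v x - h n x)\<^sup>2) < \<epsilon>"
    by (auto simp: eventually_sequentially)
  then show ?thesis using cont ints hM h0 by blast
qed

lemma exists_bounded_L2_approx:
  fixes v :: "'a::euclidean_space \<Rightarrow> real"
  assumes v: "integrable lborel (\<lambda>x. (v x)\<^sup>2)" and [measurable]: "v \<in> borel_measurable borel" and "\<epsilon> > 0"
  shows "\<exists>w M R. w \<in> borel_measurable borel \<and> (\<forall>x. \<bar>w x\<bar> \<le> M) \<and> (\<forall>x. norm x > R \<longrightarrow> w x = 0) \<and>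
     integrable lborel (\<lambda>x. (v x - w x)\<^sup>2) \<and> (LINT x|lborel. (v x - w x)\<^sup>2) < \<epsilon>"
proof -
  define w where "w = (\<lambda>(n::nat) x. if norm x \<le> real n \<and> \<bar>v x\<bar> \<le> real n then v x else 0)"
  have [measurable]: "w n \<in> borel_measurable borel" for n unfolding w_def by measurable
  have lim: "(\<lambda>n. (v x - w n x)\<^sup>2) \<longlonglongrightarrow> 0" for x
  proof -
    obtain m :: nat where m: "max (norm x) \<bar>v x\<bar> \<le> real m" using real_arch_simple by blast
    have "\<forall>n\<ge>m. (v x - w n x)\<^sup>2 = 0"
      using m by (auto simp: w_def)
    then show ?thesis by (intro tendsto_eventually) (auto simp: eventually_sequentially)
  qed
  have dom: "norm ((v x - w n x)\<^sup>2) \<le> (v x)\<^sup>2" for n x by (auto simp: w_def)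
  have ints: "integrable lborel (\<lambda>x. (v x - w n x)\<^sup>2)" for n
    by (rule Bochner_Integration.integrable_bound[OF v]) (use dom in auto)
  have "(\<lambda>n. LINT x|lborel. (v x - w n x)\<^sup>2) \<longlonglongrightarrow> (LINT x::'a|lborel. 0::real)"
    by (rule integral_dominated_convergence[where w = "\<lambda>x. (v x)\<^sup>2"]) (use v dom lim in auto)
  then have "eventually (\<lambda>n. (LINT x|lborel. (v x - w n x)\<^sup>2) < \<epsilon>) sequentially"
    using \<open>\<epsilon> > 0\<close> by (auto dest!: order_tendstoD(2)[of _ _ _ \<epsilon>])
  then obtain n where n: "(LINT x|lborel. (v x - w n x)\<^sup>2) < \<epsilon>"
    by (auto simp: eventually_sequentially)
  show ?thesis
    by (rule exI[of _ "w n"], rule exI[of _ "real n"], rule exI[of _ "real n"])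
      (use n ints in \<open>auto simp: w_def\<close>)
qed

text \<open>Substituting y = x - sqrt t z moves the time from the kernel into the argument of g. The
  weight is then the fixed kernel of time 1, and dominated convergence applies with majorant |g x| M
  \<open>heat_kernel 1 z\<close>.\<close>

lemma heat_deficit_tendsto_continuous:
  fixes g :: "'a::euclidean_space \<Rightarrow> real"
  assumes g: "integrable12 g" "continuous_on UNIV g" "\<And>x. \<bar>g x\<bar> \<le> M"
    and t: "\<And>n::nat. t n > 0" "t \<longlonglongrightarrow> 0"
  shows "(\<lambda>n. heat_deficit (t n) g) \<longlonglongrightarrow> 0"
proof -
  have gi: "integrable lborel g" using g by (auto simp: integrable12_def)
  have [measurable]: "g \<in> borel_measurable borel" using g by (intro borel_measurable_continuous_onI)
  let ?F = "\<lambda>n (p::'a\<times>'a). g (fst p) * (heat_kernel 1 (snd p) * g (fst p + (- sqrt (t n)) *\<^sub>R snd p))"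
  let ?G = "\<lambda>(p::'a\<times>'a). g (fst p) * (heat_kernel 1 (snd p) * g (fst p))"
  let ?W = "\<lambda>(p::'a\<times>'a). \<bar>g (fst p)\<bar> * (heat_kernel 1 (snd p) * M)"
  have K: "integrable lborel (heat_kernel 1 :: 'a \<Rightarrow> real)" "(LINT z|lborel. heat_kernel 1 (z::'a)) = 1"
    using integral_heat_kernel[of 1, where 'a='a] by (auto simp: has_bochner_integral_iff)
  have W: "integrable (lborel \<Otimes>\<^sub>M lborel) ?W"
    by (rule integrable_tensor) (auto intro: lborel.sigma_finite_measure_axioms gi K)
  have FW: "norm (?F n p) \<le> ?W p" for n p
    using g(3) by (auto simp: abs_mult intro!: mult_left_mono)
  have Fint: "integrable (lborel \<Otimes>\<^sub>M lborel) (?F n)" for n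
    by (rule Bochner_Integration.integrable_bound[OF W]) (use FW in \<open>auto intro!: AE_I2 intro: order.trans[OF _ abs_ge_self]\<close>)
  have Gint: "integrable (lborel \<Otimes>\<^sub>M lborel) ?G"
    by (rule Bochner_Integration.integrable_bound[OF W])
       (use g(3) in \<open>auto intro!: AE_I2 mult_left_mono intro: order.trans[OF _ abs_ge_self] simp: abs_mult\<close>)
  have form: "heat_form (t n) g = integral\<^sup>L (lborel \<Otimes>\<^sub>M lborel) (?F n)" for n
  proof -
    have s: "sqrt (t n) > 0" using t(1) by simp
    have "heat_form (t n) g = (LINT x|lborel. LINT y|lborel. g x * g y * heat_kernel (t n) (x - y))"
      unfolding heat_form_def by (subst lborel_pair.integral_fst'[symmetric, OF integrable_heat_form[OF t(1) gi]]) simp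
    also have "\<dots> = (LINT x|lborel. LINT z|lborel. g x * (heat_kernel 1 z * g (x + (- sqrt (t n)) *\<^sub>R z)))"
    proof (rule Bochner_Integration.integral_cong[OF refl])
      fix x :: 'a
      have "integrable lborel (\<lambda>y. g y * heat_kernel (t n) (x - y))"
      proof (rule Bochner_Integration.integrable_bound[OF integrable_mult_left[OF gi, of "heat_kernel (t n) (0::'a)"]])
        show "AE y in lborel. norm (g y * heat_kernel (t n) (x - y)) \<le> norm (g y * heat_kernel (t n) (0::'a))"
          using t(1)[of n] heat_kernel_le[OF t(1)[of n]] by (auto simp: abs_mult intro!: AE_I2 mult_left_mono)
      qed measurable
      then have "has_bochner_integral lborel (\<lambda>y. g y * heat_kernel (t n) (x - y)) (LINT y|lborel. g y * heat_kernel (t n) (x - y))"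
        by (rule has_bochner_integral_integrable)
      from has_bochner_integral_lborel_affine[OF _ this, of "- sqrt (t n)" x] s
      have "(LINT z|lborel. g (x + (- sqrt (t n)) *\<^sub>R z) * heat_kernel (t n) (sqrt (t n) *\<^sub>R z)) =
         (1 / sqrt (t n) ^ DIM('a)) * (LINT y|lborel. g y * heat_kernel (t n) (x - y))"
        by (simp add: has_bochner_integral_iff)
      then have "(LINT z|lborel. g (x + (- sqrt (t n)) *\<^sub>R z) * heat_kernel 1 z / sqrt (t n) ^ DIM('a)) =
         (1 / sqrt (t n) ^ DIM('a)) * (LINT y|lborel. g y * heat_kernel (t n) (x - y))"
        unfolding heat_kernel_eq_scaled[OF t(1)] by simp
      then have "(LINT z|lborel. g (x + (- sqrt (t n)) *\<^sub>R z) * heat_kernel 1 z) = (LINT y|lborel. g y * heat_kernel (t n) (x - y))"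
        using s by simp
      then show "(LINT y|lborel. g x * g y * heat_kernel (t n) (x - y)) = (LINT z|lborel. g x * (heat_kernel 1 z * g (x + (- sqrt (t n)) *\<^sub>R z)))"
        by (simp add: mult.assoc mult.commute[of "heat_kernel _ _"])
    qed
    also have "\<dots> = integral\<^sup>L (lborel \<Otimes>\<^sub>M lborel) (?F n)"
      using lborel_pair.integral_fst'[OF Fint[of n]] by simp
    finally show ?thesis .
  qed
  have "(\<lambda>n. integral\<^sup>L (lborel \<Otimes>\<^sub>M lborel) (?F n)) \<longlonglongrightarrow> integral\<^sup>L (lborel \<Otimes>\<^sub>M lborel) ?G"
  proof (rule integral_dominated_convergence[where w = ?W])
    show "AE p in lborel \<Otimes>\<^sub>M lborel. (\<lambda>n. ?F n p) \<longlonglongrightarrow> ?G p"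
    proof (rule AE_I2)
      fix p :: "'a \<times> 'a"
      have st: "(\<lambda>n. sqrt (t n)) \<longlonglongrightarrow> 0" using tendsto_real_sqrt[OF t(2)] by simp
      have "(\<lambda>n. fst p + (- sqrt (t n)) *\<^sub>R snd p) \<longlonglongrightarrow> fst p + (- 0) *\<^sub>R snd p"
        by (intro tendsto_intros st)
      then have "(\<lambda>n. g (fst p + (- sqrt (t n)) *\<^sub>R snd p)) \<longlonglongrightarrow> g (fst p)"
        using g(2) by (intro continuous_on_tendsto_compose[OF g(2)]) auto
      then show "(\<lambda>n. ?F n p) \<longlonglongrightarrow> ?G p" by (intro tendsto_intros)
    qed
  qed (use FW W in auto)
  also have "integral\<^sup>L (lborel \<Otimes>\<^sub>M lborel) ?G = (LINT x|lborel. (g x)\<^sup>2)"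
    by (subst lborel_pair.integral_fst'[symmetric, OF Gint]) (simp add: K power2_eq_square)
  finally have "(\<lambda>n. (LINT x|lborel. (g x)\<^sup>2) - heat_form (t n) g) \<longlonglongrightarrow> (LINT x|lborel. (g x)\<^sup>2) - (LINT x|lborel. (g x)\<^sup>2)"
    unfolding form by (intro tendsto_intros)
  then show ?thesis by (simp add: heat_deficit_def)
qed

text \<open>Strong continuity of the heat semigroup at time 0, by density: the deficit of the error
  v - g is bounded by its squared L^2 norm for all times at once.\<close>

lemma heat_deficit_tendsto:
  fixes v :: "'a::euclidean_space \<Rightarrow> real"
  assumes v: "integrable12 v" and t: "\<And>n::nat. t n > 0" "t \<longlonglongrightarrow> 0"
  shows "(\<lambda>n. heat_deficit (t n) v) \<longlonglongrightarrow> 0"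
proof (rule LIMSEQ_I)
  fix e :: real assume e: "e > 0"
  have v2: "integrable lborel (\<lambda>x. (v x)\<^sup>2)" and vm [measurable]: "v \<in> borel_measurable borel"
    using v by (auto simp: integrable12_def)
  \<comment> \<open>Two errors below e / 16 combine to a squared norm of v - g below e / 4;
    \<open>heat_deficit_add_le\<close> doubles this and the deficit e / 4 of g, for a total below
    e.\<close>
  obtain w M R where w [measurable]: "w \<in> borel_measurable borel" and wM: "\<And>x. \<bar>w x\<bar> \<le> M"
    and wR: "\<And>x. norm x > R \<Longrightarrow> w x = 0"
    and vw: "integrable lborel (\<lambda>x. (v x - w x)\<^sup>2)" "(LINT x|lborel. (v x - w x)\<^sup>2) < e / 16"
    using exists_bounded_L2_approx[OF v2 vm, of "e / 16"] e by auto
  obtain g where g: "continuous_on UNIV g" "\<And>x. \<bar>g x\<bar> \<le> M" and gR: "\<And>x. norm x > R + 1 \<Longrightarrow> g x = 0"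
    and wg: "integrable lborel (\<lambda>x. (w x - g x)\<^sup>2)" "(LINT x|lborel. (w x - g x)\<^sup>2) < e / 16"
    using exists_continuous_L2_approx_bounded[where v = w and M = M and R = R and \<epsilon> = "e / 16"] w wM wR e by auto
  have [measurable]: "g \<in> borel_measurable borel" using g by (intro borel_measurable_continuous_onI)
  have bi: "integrable lborel (\<lambda>x::'a. C * indicator (cball 0 (R + 1)) x :: real)" for C
    using emeasure_lborel_cball_finite[of "0::'a" "R + 1"]
    by (intro integrable_mult_right integrable_real_indicator) auto
  have g12: "integrable12 g"
    unfolding integrable12_def
  proof
    show "integrable lborel g"
      by (rule Bochner_Integration.integrable_bound[OF bi[of M]])
        (use g(2) gR in \<open>auto intro!: AE_I2 order.trans[OF _ abs_ge_self] simp: indicator_def not_le\<close>)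
    show "integrable lborel (\<lambda>x. (g x)\<^sup>2)"
    proof (rule Bochner_Integration.integrable_bound[OF bi[of "M\<^sup>2"]])
      have "(g x)\<^sup>2 \<le> M\<^sup>2" for x using g(2)[of x] by (metis abs_ge_zero power2_abs power_mono)
      then show "AE x in lborel. norm ((g x)\<^sup>2) \<le> norm (M\<^sup>2 * indicator (cball 0 (R + 1)) x :: real)"
        using gR by (auto intro!: AE_I2 simp: indicator_def not_le)
    qed measurable
  qed
  have vg12: "integrable12 (\<lambda>x. v x - g x)" by (rule integrable12_diff[OF v g12])
  have "(LINT x|lborel. (v x - g x)\<^sup>2) \<le> (LINT x|lborel. 2 * (v x - w x)\<^sup>2 + 2 * (w x - g x)\<^sup>2)"
  proof (rule integral_mono)
    show "integrable lborel (\<lambda>x. (v x - g x)\<^sup>2)" using vg12 by (auto simp: integrable12_def)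
    show "integrable lborel (\<lambda>x. 2 * (v x - w x)\<^sup>2 + 2 * (w x - g x)\<^sup>2)" using vw wg by auto
    show "(v x - g x)\<^sup>2 \<le> 2 * (v x - w x)\<^sup>2 + 2 * (w x - g x)\<^sup>2" for x
      using sum_squares_bound[of "v x - w x" "w x - g x"] by (simp add: power2_eq_square algebra_simps)
  qed
  also have "\<dots> = 2 * (LINT x|lborel. (v x - w x)\<^sup>2) + 2 * (LINT x|lborel. (w x - g x)\<^sup>2)"
    using vw wg by simp
  also have "\<dots> < e / 4" using vw wg by linarith
  finally have vg: "(LINT x|lborel. (v x - g x)\<^sup>2) < e / 4" .
  have "(\<lambda>n. heat_deficit (t n) g) \<longlonglongrightarrow> 0"
    by (rule heat_deficit_tendsto_continuous[OF g12 g t])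
  from LIMSEQ_D[OF this, of "e / 4"] e obtain N where N0: "\<forall>n\<ge>N. norm (heat_deficit (t n) g - 0) < e / 4"
    by auto
  have N: "heat_deficit (t n) g < e / 4" if "n \<ge> N" for n
    using N0[rule_format, OF that] by simp
  have "norm (heat_deficit (t n) v - 0) < e" if "n \<ge> N" for n
  proof -
    have "heat_deficit (t n) (\<lambda>x. g x + (v x - g x)) \<le> 2 * heat_deficit (t n) g + 2 * heat_deficit (t n) (\<lambda>x. v x - g x)"
      by (rule heat_deficit_add_le[OF t(1) g12 vg12])
    also have "\<dots> < e" using N[OF that] vg heat_deficit_le[OF t(1) vg12, of n] by linarith
    finally show ?thesis using heat_deficit_nonneg[OF t(1) v, of n] by simp
  qed
  then show "\<exists>N. \<forall>n\<ge>N. norm (heat_deficit (t n) v - 0) < e" by blast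
qed

text \<open>Gaussian summation: the weights exp(-t |\<xi>|^2) increase to 1 as t decreases to 0, so
  monotone convergence applies on the Fourier side, while the heat forms converge to the squared L^2
  norm because the deficit vanishes.\<close>

theorem plancherel:
  fixes v :: "'a::euclidean_space \<Rightarrow> real"
  assumes v: "integrable12 v"
  shows "has_bochner_integral lborel (\<lambda>\<xi>. (norm (fourier_integral v \<xi>))\<^sup>2) ((2 * pi) ^ DIM('a) * (LINT x|lborel. (v x)\<^sup>2))"
proof -
  have v1: "integrable lborel v" using v by (auto simp: integrable12_def)
  have [measurable]: "v \<in> borel_measurable borel" using v1 by auto
  define t where "t = (\<lambda>n::nat. 1 / real (Suc n))"
  have t: "\<And>n. t n > 0" "t \<longlonglongrightarrow> 0" unfolding t_def using LIMSEQ_Suc[OF lim_1_over_n] by auto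
  have dec: "t n \<ge> t (Suc n)" for n by (auto simp: t_def field_simps)
  show ?thesis
    unfolding has_bochner_integral_iff
  proof
    let ?f = "\<lambda>n \<xi>. exp (- t n * (norm \<xi>)\<^sup>2) * (norm (fourier_integral v \<xi>))\<^sup>2"
    have fi: "integrable lborel (?f n)" "integral\<^sup>L lborel (?f n) = (2 * pi) ^ DIM('a) * heat_form (t n) v" for n
      using gaussian_fourier_integral[OF t(1) v1, of n] by (auto simp: has_bochner_integral_iff)
    have mono: "AE \<xi> in lborel. mono (\<lambda>n. ?f n \<xi>)"
      by (intro AE_I2 monoI mult_right_mono) (auto intro!: mult_right_mono lift_Suc_antimono_le[of t, OF dec])
    have lim: "AE \<xi> in lborel. (\<lambda>n. ?f n \<xi>) \<longlonglongrightarrow> (norm (fourier_integral v \<xi>))\<^sup>2"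
    proof (rule AE_I2)
      fix \<xi> :: 'a
      have "(\<lambda>n. ?f n \<xi>) \<longlonglongrightarrow> exp (- 0 * (norm \<xi>)\<^sup>2) * (norm (fourier_integral v \<xi>))\<^sup>2"
        by (intro tendsto_intros t)
      then show "(\<lambda>n. ?f n \<xi>) \<longlonglongrightarrow> (norm (fourier_integral v \<xi>))\<^sup>2" by simp
    qed
    have "(\<lambda>n. (2 * pi) ^ DIM('a) * ((LINT x|lborel. (v x)\<^sup>2) - heat_deficit (t n) v)) \<longlonglongrightarrow>
       (2 * pi) ^ DIM('a) * ((LINT x|lborel. (v x)\<^sup>2) - 0)"
      by (intro tendsto_intros heat_deficit_tendsto[OF v] t)
    then have il: "(\<lambda>n. integral\<^sup>L lborel (?f n)) \<longlonglongrightarrow> (2 * pi) ^ DIM('a) * (LINT x|lborel. (v x)\<^sup>2)"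
      unfolding fi(2) by (simp add: heat_deficit_def)
    show "integrable lborel (\<lambda>\<xi>. (norm (fourier_integral v \<xi>))\<^sup>2)"
      by (rule integrable_monotone_convergence[OF fi(1) mono lim il]) measurable
    show "(LINT \<xi>|lborel. (norm (fourier_integral v \<xi>))\<^sup>2) = (2 * pi) ^ DIM('a) * (LINT x|lborel. (v x)\<^sup>2)"
      by (rule integral_monotone_convergence[OF fi(1) mono lim il]) measurable
  qed
qed

subsection \<open>The half Laplacian as a superposition of heat deficits\<close>

definition energy_density :: "('a::euclidean_space \<Rightarrow> real) \<Rightarrow> 'a \<Rightarrow> real" where
  "energy_density v \<xi> = norm \<xi> * (norm (fourier_integral v \<xi>))\<^sup>2"

lemma energy_density_nonneg [simp]: "energy_density v \<xi> \<ge> 0"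
  by (simp add: energy_density_def)

lemma borel_measurable_energy_density [measurable]:
  "v \<in> borel_measurable borel \<Longrightarrow> energy_density v \<in> borel_measurable borel"
  unfolding energy_density_def by measurable

text \<open>Valued in \<open>ennreal\<close>, so that infinite energy is a genuine value and
  membership in H^(1/2) becomes finiteness. The factor (2 pi)^(-d) is left to
  \<open>half_form\<close>.\<close>

definition half_energy :: "('a::euclidean_space \<Rightarrow> real) \<Rightarrow> ennreal" where
  "half_energy v = (\<integral>\<^sup>+\<xi>. ennreal (energy_density v \<xi>) \<partial>lborel)"

text \<open>Parametrising time as t = 1 / \<tau>^2 replaces the usual weight t^(-3/2) dt by Lebesgue
  measure in \<tau>, up to a constant, so that homogeneity of degree one is a plain dilation of
  \<tau>. What counts is that the value lies strictly between 0 and infinity, which lets it be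
  cancelled.\<close>

definition subordination_const :: ennreal where
  "subordination_const = (\<integral>\<^sup>+(\<tau>::real). ennreal (1 - exp (- (1 / \<tau>\<^sup>2))) \<partial>lborel)"

lemma subordination_const_pos: "subordination_const > 0"
proof (rule ccontr)
  assume "\<not> ?thesis"
  then have "subordination_const = 0" by (simp add: zero_less_iff_neq_zero)
  then have "AE \<tau>::real in lborel. ennreal (1 - exp (- (1 / \<tau>\<^sup>2))) = 0"
    unfolding subordination_const_def by (subst (asm) nn_integral_0_iff_AE) auto
  \<comment> \<open>At \<tau> = 0 the convention 1 / 0 = 0 makes the integrand 0; it is positive
    everywhere else.\<close>
  moreover have "AE \<tau>::real in lborel. \<tau> \<noteq> 0" by (rule AE_lborel_singleton)
  ultimately have "AE \<tau>::real in lborel. False"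
    by eventually_elim (auto simp: ennreal_eq_0_iff)
  then have "(UNIV :: real set) \<in> null_sets lborel" by (subst (asm) AE_iff_null) auto
  then show False by (auto simp: null_sets_def)
qed

lemma subordination_const_finite: "subordination_const < \<infinity>"
proof -
  have I: "integrable lborel (\<lambda>\<tau>::real. inverse (1 + \<tau>\<^sup>2))"
    using integrable_inverse_1_plus_square by (simp add: set_integrable_def)
  \<comment> \<open>For \<tau>^2 <= 1 the left side is at most 1 and the right side at least 1;
    beyond that, 1 - exp(-x) <= x with x = 1 / \<tau>^2 suffices.\<close>
  have le: "1 - exp (- (1 / \<tau>\<^sup>2)) \<le> 2 * inverse (1 + \<tau>\<^sup>2)" for \<tau> :: real
  proof (cases "\<tau>\<^sup>2 \<le> 1")
    case True
    then have "inverse (1 + \<tau>\<^sup>2) \<ge> 1 / 2"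
      using le_imp_inverse_le[of "1 + \<tau>\<^sup>2" 2] by (simp add: add_pos_nonneg)
    moreover have "1 - exp (- (1 / \<tau>\<^sup>2)) \<le> 1" by simp
    ultimately show ?thesis by linarith
  next
    case False
    have le: "1 / x \<le> 2 * inverse (1 + x)" if "x > 1" for x :: real
      using that by (simp add: field_simps)
    have "1 - exp (- (1 / \<tau>\<^sup>2)) \<le> 1 / \<tau>\<^sup>2" using exp_ge_add_one_self[of "- (1 / \<tau>\<^sup>2)"] by simp
    also have "\<dots> \<le> 2 * inverse (1 + \<tau>\<^sup>2)" using False by (intro le) simp
    finally show ?thesis .
  qed
  have "subordination_const \<le> (\<integral>\<^sup>+(\<tau>::real). ennreal (2 * inverse (1 + \<tau>\<^sup>2)) \<partial>lborel)"
    unfolding subordination_const_def by (intro nn_integral_mono ennreal_leI le)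
  also have "\<dots> = ennreal (LINT \<tau>|lborel. 2 * inverse (1 + \<tau>\<^sup>2))"
    by (intro nn_integral_eq_integral integrable_mult_right I) (auto intro!: AE_I2)
  also have "\<dots> < \<infinity>" by simp
  finally show ?thesis .
qed

text \<open>For s > 0 the substitution of s \<tau> for \<tau> removes s from the integrand and
  leaves it as the Jacobian.\<close>

lemma subordination:
  assumes "s \<ge> 0"
  shows "(\<integral>\<^sup>+(\<tau>::real). ennreal (1 - exp (- (1 / \<tau>\<^sup>2) * s\<^sup>2)) \<partial>lborel) = ennreal s * subordination_const"
proof (cases "s = 0")
  case False
  have [measurable]: "(\<lambda>\<tau>::real. ennreal (1 - exp (- (1 / \<tau>\<^sup>2) * s\<^sup>2))) \<in> borel_measurable borel"
    by measurable
  show ?thesis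
    using False assms unfolding subordination_const_def
    by (subst nn_integral_real_affine[where c = s and t = 0]) (auto simp: power_mult_distrib)
qed simp

lemma heat_deficit_fourier:
  fixes v :: "'a::euclidean_space \<Rightarrow> real"
  assumes t: "t > 0" and v: "integrable12 v"
  shows "(\<integral>\<^sup>+\<xi>. ennreal ((1 - exp (- t * (norm \<xi>)\<^sup>2)) * (norm (fourier_integral v \<xi>))\<^sup>2) \<partial>lborel) =
    ennreal ((2 * pi) ^ DIM('a) * heat_deficit t v)"
proof -
  have "has_bochner_integral lborel (\<lambda>\<xi>. (norm (fourier_integral v \<xi>))\<^sup>2 - exp (- t * (norm \<xi>)\<^sup>2) * (norm (fourier_integral v \<xi>))\<^sup>2)
     ((2 * pi) ^ DIM('a) * (LINT x|lborel. (v x)\<^sup>2) - (2 * pi) ^ DIM('a) * heat_form t v)"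
    using v by (intro has_bochner_integral_diff plancherel gaussian_fourier_integral t) (auto simp: integrable12_def)
  then have "has_bochner_integral lborel (\<lambda>\<xi>. (1 - exp (- t * (norm \<xi>)\<^sup>2)) * (norm (fourier_integral v \<xi>))\<^sup>2)
     ((2 * pi) ^ DIM('a) * heat_deficit t v)"
    by (simp add: heat_deficit_def algebra_simps)
  then show ?thesis
    using t by (subst nn_integral_eq_integral) (auto simp: has_bochner_integral_iff intro!: AE_I2 mult_nonneg_nonneg)
qed

lemma borel_measurable_heat_deficit [measurable]:
  assumes [measurable]: "v \<in> borel_measurable borel"
  shows "(\<lambda>t. heat_deficit t v) \<in> borel_measurable borel"
  unfolding heat_deficit_def heat_form_def heat_kernel_def by measurable

text \<open>The factor norm \<xi> in the energy density is replaced by its integral over \<tau>, and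
  Tonelli exchanges \<tau> with \<xi>; for fixed \<tau> the inner integral is the heat deficit on
  the Fourier side.\<close>

lemma half_energy_heat_deficit:
  fixes v :: "'a::euclidean_space \<Rightarrow> real"
  assumes v: "integrable12 v"
  shows "subordination_const * half_energy v =
    ennreal ((2 * pi) ^ DIM('a)) * (\<integral>\<^sup>+(\<tau>::real). ennreal (heat_deficit (1 / \<tau>\<^sup>2) v) \<partial>lborel)"
proof -
  have [measurable]: "v \<in> borel_measurable borel" using v by (auto simp: integrable12_def)
  let ?N = "\<lambda>\<xi>. (norm (fourier_integral v \<xi>))\<^sup>2"
  have "subordination_const * half_energy v =
    (\<integral>\<^sup>+\<xi>. ennreal (?N \<xi>) * (ennreal (norm \<xi>) * subordination_const) \<partial>lborel)"
    unfolding half_energy_def energy_density_def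
    by (subst nn_integral_cmult[symmetric]) (auto simp: ennreal_mult' mult_ac)
  also have "\<dots> = (\<integral>\<^sup>+\<xi>. (\<integral>\<^sup>+(\<tau>::real). ennreal (?N \<xi>) * ennreal (1 - exp (- (1 / \<tau>\<^sup>2) * (norm \<xi>)\<^sup>2)) \<partial>lborel) \<partial>lborel)"
    by (simp only: subordination[OF norm_ge_zero, symmetric]) (simp add: nn_integral_cmult)
  also have "\<dots> = (\<integral>\<^sup>+(\<tau>::real). (\<integral>\<^sup>+\<xi>. ennreal (?N \<xi>) * ennreal (1 - exp (- (1 / \<tau>\<^sup>2) * (norm \<xi>)\<^sup>2)) \<partial>lborel) \<partial>lborel)"
    by (rule lborel_pair.Fubini') measurable
  also have "\<dots> = (\<integral>\<^sup>+(\<tau>::real). ennreal ((2 * pi) ^ DIM('a)) * ennreal (heat_deficit (1 / \<tau>\<^sup>2) v) \<partial>lborel)"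
  proof (rule nn_integral_cong_AE)
    \<comment> \<open>At \<tau> = 0 the time 1 / \<tau>^2 would read as 0, where the heat kernel is
      degenerate.\<close>
    have "AE \<tau>::real in lborel. \<tau> \<noteq> 0" by (rule AE_lborel_singleton)
    then show "AE \<tau>::real in lborel. (\<integral>\<^sup>+\<xi>. ennreal (?N \<xi>) * ennreal (1 - exp (- (1 / \<tau>\<^sup>2) * (norm \<xi>)\<^sup>2)) \<partial>lborel) =
       ennreal ((2 * pi) ^ DIM('a)) * ennreal (heat_deficit (1 / \<tau>\<^sup>2) v)"
    proof eventually_elim
      case (elim \<tau>)
      then have t: "1 / \<tau>\<^sup>2 > 0" by simp
      have "ennreal (?N \<xi>) * ennreal (1 - exp (- (1 / \<tau>\<^sup>2) * (norm \<xi>)\<^sup>2)) =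
        ennreal ((1 - exp (- (1 / \<tau>\<^sup>2) * (norm \<xi>)\<^sup>2)) * ?N \<xi>)" for \<xi>
        by (subst mult.commute, subst ennreal_mult'[symmetric]) auto
      moreover have "ennreal ((2 * pi) ^ DIM('a)) * ennreal (heat_deficit (1 / \<tau>\<^sup>2) v) =
        ennreal ((2 * pi) ^ DIM('a) * heat_deficit (1 / \<tau>\<^sup>2) v)"
        by (subst ennreal_mult'[symmetric]) auto
      ultimately show ?case
        using heat_deficit_fourier[OF t v] by (simp only:)
    qed
  qed
  also have "\<dots> = ennreal ((2 * pi) ^ DIM('a)) * (\<integral>\<^sup>+(\<tau>::real). ennreal (heat_deficit (1 / \<tau>\<^sup>2) v) \<partial>lborel)"
    by (rule nn_integral_cmult) measurable
  finally show ?thesis .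
qed

lemma half_energy_mono:
  fixes v w :: "'a::euclidean_space \<Rightarrow> real"
  assumes v: "integrable12 v" and w: "integrable12 w"
    and le: "\<And>t. t > 0 \<Longrightarrow> heat_deficit t w \<le> heat_deficit t v"
  shows "half_energy w \<le> half_energy v"
proof -
  have "subordination_const * half_energy w \<le> subordination_const * half_energy v"
    unfolding half_energy_heat_deficit[OF v] half_energy_heat_deficit[OF w]
  proof (intro mult_left_mono nn_integral_mono_AE)
    have "AE \<tau>::real in lborel. \<tau> \<noteq> 0" by (rule AE_lborel_singleton)
    then show "AE \<tau>::real in lborel. ennreal (heat_deficit (1 / \<tau>\<^sup>2) w) \<le> ennreal (heat_deficit (1 / \<tau>\<^sup>2) v)"
      by eventually_elim (intro ennreal_leI le, simp)
  qed auto
  then show ?thesis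
    using subordination_const_pos subordination_const_finite
    by (subst (asm) ennreal_mult_le_mult_iff) auto
qed

text \<open>The difference of the two deficits is nonnegative with integral zero over \<tau>, hence
  zero for almost every \<tau>. Finite energy is what allows the integrals to be subtracted.\<close>

lemma half_energy_eq_imp_heat_deficit_eq:
  fixes v w :: "'a::euclidean_space \<Rightarrow> real"
  assumes v: "integrable12 v" and w: "integrable12 w"
    and le: "\<And>t. t > 0 \<Longrightarrow> heat_deficit t w \<le> heat_deficit t v"
    and fin: "half_energy v < top" and ge: "half_energy v \<le> half_energy w"
  shows "\<exists>t>0. heat_deficit t w = heat_deficit t v"
proof -
  have [measurable]: "v \<in> borel_measurable borel" "w \<in> borel_measurable borel"
    using v w by (auto simp: integrable12_def)
  let ?D = "\<lambda>u (\<tau>::real). ennreal (heat_deficit (1 / \<tau>\<^sup>2) u)"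
  let ?c = "ennreal ((2 * pi) ^ DIM('a))"
  have c: "?c \<noteq> 0" "?c < top" by (auto simp: ennreal_eq_0_iff not_le)
  have eq: "half_energy v = half_energy w" using half_energy_mono[OF v w le] ge by auto
  have "?c * integral\<^sup>N lborel (?D v) = ?c * integral\<^sup>N lborel (?D w)"
    by (simp only: half_energy_heat_deficit[OF v, symmetric] half_energy_heat_deficit[OF w, symmetric] eq)
  then have eq2: "integral\<^sup>N lborel (?D v) = integral\<^sup>N lborel (?D w)"
    using c by (subst (asm) ennreal_mult_cancel_left) auto
  have "?c * integral\<^sup>N lborel (?D w) < \<infinity>"
    unfolding half_energy_heat_deficit[OF w, symmetric]
    using fin eq subordination_const_finite by (auto simp: ennreal_mult_less_top)
  then have fin2: "integral\<^sup>N lborel (?D w) \<noteq> \<infinity>" using c by (auto simp: ennreal_mult_less_top)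
  have nz: "AE \<tau>::real in lborel. \<tau> \<noteq> 0" by (rule AE_lborel_singleton)
  then have le': "AE \<tau> in lborel. ?D w \<tau> \<le> ?D v \<tau>"
    by eventually_elim (intro ennreal_leI le, simp)
  have "(\<integral>\<^sup>+\<tau>. (?D v \<tau> - ?D w \<tau>) \<partial>lborel) = integral\<^sup>N lborel (?D v) - integral\<^sup>N lborel (?D w)"
    by (rule nn_integral_diff[OF _ _ fin2 le']) auto
  also have "\<dots> = 0" using eq2 fin2 by simp
  finally have "AE \<tau> in lborel. ?D v \<tau> - ?D w \<tau> = 0"
    by (subst (asm) nn_integral_0_iff_AE) auto
  with nz have "AE \<tau>::real in lborel. \<exists>t>0. heat_deficit t w = heat_deficit t v"
  proof eventually_elim
    case (elim \<tau>)
    then have t: "1 / \<tau>\<^sup>2 > 0" by simp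
    have "?D v \<tau> \<le> ?D w \<tau>" using elim by (simp add: diff_eq_0_iff_ennreal)
    then have "heat_deficit (1 / \<tau>\<^sup>2) v \<le> heat_deficit (1 / \<tau>\<^sup>2) w"
      using heat_deficit_nonneg[OF t w] by (simp add: ennreal_le_iff)
    then show ?case using le[OF t] t by (intro exI[of _ "1 / \<tau>\<^sup>2"]) auto
  qed
  \<comment> \<open>The property no longer depends on \<tau>; if it failed, the whole line would be
    a null set.\<close>
  then show ?thesis
  proof (rule contrapos_pp)
    assume "\<not> ?thesis"
    then show "\<not> (AE \<tau>::real in lborel. \<exists>t>0. heat_deficit t w = heat_deficit t v)"
      by (auto simp: AE_iff_null null_sets_def)
  qed
qed

section \<open>Functions of bounded support: Plancherel transform and H^(1/2)\<close>

definition essentially_bounded_support :: "('a::euclidean_space \<Rightarrow> real) \<Rightarrow> bool" where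
  "essentially_bounded_support v \<longleftrightarrow> (\<exists>R. AE x in lborel. x \<notin> cball 0 R \<longrightarrow> v x = 0)"

text \<open>Inside the ball |v| <= 1 + v^2, and outside it v vanishes.\<close>

lemma integrable12_bounded_support:
  fixes v :: "'a::euclidean_space \<Rightarrow> real"
  assumes v: "essentially_bounded_support v" and [measurable]: "v \<in> borel_measurable borel"
    and v2: "integrable lborel (\<lambda>x. (v x)\<^sup>2)"
  shows "integrable12 v"
proof -
  obtain R where R: "AE x in lborel. x \<notin> cball 0 R \<longrightarrow> v x = 0"
    using v by (auto simp: essentially_bounded_support_def)
  have "integrable lborel (\<lambda>x. indicator (cball 0 R) x + (v x)\<^sup>2)"
    using emeasure_lborel_cball_finite[of "0::'a" R] v2
    by (intro Bochner_Integration.integrable_add integrable_real_indicator) auto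
  then have "integrable lborel v"
  proof (rule Bochner_Integration.integrable_bound)
    show "AE x in lborel. norm (v x) \<le> norm (indicator (cball 0 R) x + (v x)\<^sup>2)"
      using R
    proof eventually_elim
      case (elim x)
      have "\<bar>v x\<bar> \<le> 1 + (v x)\<^sup>2"
        using zero_le_power2[of "\<bar>v x\<bar> - 1"] by (simp add: power2_diff)
      then show ?case using elim by (cases "x \<in> cball 0 R") auto
    qed
  qed simp
  with v2 show ?thesis by (simp add: integrable12_def)
qed

text \<open>Once the truncation ball contains the support, truncating changes nothing: the limit in
  the definition of \<open>has_fourier\<close> is along an eventually constant family.\<close>

lemma fourier_trunc_bounded_support:
  fixes v :: "'a::euclidean_space \<Rightarrow> real"
  assumes v: "essentially_bounded_support v" and [measurable]: "v \<in> borel_measurable borel"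
  shows "eventually (\<lambda>R. fourier_trunc R (\<lambda>x. complex_of_real (v x)) = fourier_integral v) at_top"
proof -
  obtain R where R: "AE x in lborel. x \<notin> cball 0 R \<longrightarrow> v x = 0"
    using v by (auto simp: essentially_bounded_support_def)
  have "fourier_trunc S (\<lambda>x. complex_of_real (v x)) \<xi> = fourier_integral v \<xi>" if "S \<ge> R" for S \<xi>
    unfolding fourier_trunc_def fourier_integral_def set_lebesgue_integral_def
  proof (rule integral_cong_AE)
    have [measurable]: "cball 0 S \<in> sets (borel :: 'a measure)" by simp
    show "(\<lambda>x. indicat_real (cball 0 S) x *\<^sub>R (cis (- (x \<bullet> \<xi>)) * complex_of_real (v x))) \<in> borel_measurable lborel"
      by measurable
    show "AE x in lborel. indicat_real (cball 0 S) x *\<^sub>R (cis (- (x \<bullet> \<xi>)) * complex_of_real (v x)) =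
      cis (- (x \<bullet> \<xi>)) * complex_of_real (v x)"
      using R by eventually_elim (use that in \<open>auto simp: indicator_def\<close>)
  qed measurable
  then show ?thesis by (auto simp: eventually_at_top_linorder fun_eq_iff)
qed

text \<open>Convergence of an eventually constant family to g in L^2 means that the L^2 distance is
  zero. Plancherel's theorem supplies the square integrability demanded of g.\<close>

lemma has_fourier_iff_bounded_support:
  fixes v :: "'a::euclidean_space \<Rightarrow> real"
  assumes b: "essentially_bounded_support v" and v: "integrable12 v"
  shows "has_fourier (\<lambda>x. complex_of_real (v x)) g \<longleftrightarrow>
    g \<in> borel_measurable borel \<and> (AE \<xi> in lborel. g \<xi> = fourier_integral v \<xi>)"
proof -
  have vm [measurable]: "v \<in> borel_measurable borel" using v by (auto simp: integrable12_def)
  let ?I = "\<integral>\<^sup>+ \<xi>. ennreal ((norm (g \<xi> - fourier_integral v \<xi>))\<^sup>2) \<partial>lborel"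
  have sv: "square_integrable (\<lambda>x. complex_of_real (v x))"
    using v by (auto simp: square_integrable_def integrable12_def)
  have ev: "eventually (\<lambda>R. (\<integral>\<^sup>+ \<xi>. ennreal ((norm (g \<xi> - fourier_trunc R (\<lambda>x. complex_of_real (v x)) \<xi>))\<^sup>2) \<partial>lborel) = ?I) at_top"
    using fourier_trunc_bounded_support[OF b vm] by eventually_elim simp
  have lim: "((\<lambda>R. \<integral>\<^sup>+ \<xi>. ennreal ((norm (g \<xi> - fourier_trunc R (\<lambda>x. complex_of_real (v x)) \<xi>))\<^sup>2) \<partial>lborel) \<longlongrightarrow> 0) at_top
     \<longleftrightarrow> ?I = 0"
    by (subst tendsto_cong[OF ev]) (simp add: tendsto_const_iff)
  have zero: "?I = 0 \<longleftrightarrow> (AE \<xi> in lborel. g \<xi> = fourier_integral v \<xi>)" if [measurable]: "g \<in> borel_measurable borel"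
    by (subst nn_integral_0_iff_AE) (auto simp: ennreal_eq_0_iff)
  have sg: "square_integrable g" if gm [measurable]: "g \<in> borel_measurable borel" and ae: "AE \<xi> in lborel. g \<xi> = fourier_integral v \<xi>"
  proof -
    have "integrable lborel (\<lambda>\<xi>. (norm (fourier_integral v \<xi>))\<^sup>2)"
      using plancherel[OF v] by (auto simp: has_bochner_integral_iff)
    then have "integrable lborel (\<lambda>\<xi>. (norm (g \<xi>))\<^sup>2)"
      by (rule integrable_cong_AE_imp) (use ae in auto)
    then show ?thesis by (simp add: square_integrable_def)
  qed
  show ?thesis
    unfolding has_fourier_def lim using sv sg zero by (auto simp: square_integrable_def)
qed

text \<open>The Fourier integral is a witness for the choice in \<open>fourier\<close>, so the
  chosen function does satisfy \<open>has_fourier\<close>.\<close>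

lemma fourier_bounded_support:
  fixes v :: "'a::euclidean_space \<Rightarrow> real"
  assumes b: "essentially_bounded_support v" and v: "integrable12 v"
  shows "has_fourier (\<lambda>x. complex_of_real (v x)) (fourier v)"
    "fourier v \<in> borel_measurable borel" "AE \<xi> in lborel. fourier v \<xi> = fourier_integral v \<xi>"
proof -
  have [measurable]: "v \<in> borel_measurable borel" using v by (auto simp: integrable12_def)
  have "has_fourier (\<lambda>x. complex_of_real (v x)) (fourier_integral v)"
    by (subst has_fourier_iff_bounded_support[OF b v]) auto
  then show 1: "has_fourier (\<lambda>x. complex_of_real (v x)) (fourier v)"
    unfolding fourier_def by (rule someI[of "has_fourier (\<lambda>x. complex_of_real (v x))"])
  then show "fourier v \<in> borel_measurable borel" "AE \<xi> in lborel. fourier v \<xi> = fourier_integral v \<xi>"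
    by (auto simp: has_fourier_iff_bounded_support[OF b v])
qed

lemma half_energy_finite_iff:
  assumes [measurable]: "v \<in> borel_measurable borel"
  shows "half_energy v < top \<longleftrightarrow> integrable lborel (energy_density v)"
  unfolding half_energy_def by (subst integrable_iff_bounded) auto

text \<open>The squared Sobolev weight is sqrt (1 + |\<xi>|^2), which lies between |\<xi>| and 1 +
  |\<xi>|; the summand 1 is handled by Plancherel's theorem.\<close>

lemma sobolev_half_iff:
  fixes v :: "'a::euclidean_space \<Rightarrow> real"
  assumes b: "essentially_bounded_support v"
  shows "v \<in> sobolev (1/2) \<longleftrightarrow> integrable12 v \<and> half_energy v < top"
proof -
  let ?m = "\<lambda>\<xi>::'a. (1 + (norm \<xi>)\<^sup>2) powr (1/2/2)"
  have 1: "integrable12 v" if "v \<in> sobolev (1/2)"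
  proof -
    have sq: "square_integrable (\<lambda>x. complex_of_real (v x))"
      using that by (auto simp: sobolev_def has_fourier_def)
    then have "(\<lambda>x. complex_of_real (v x)) \<in> borel_measurable borel"
      by (simp add: square_integrable_def)
    then have "(\<lambda>x. Re (complex_of_real (v x))) \<in> borel_measurable borel" by measurable
    then show ?thesis
      using sq by (intro integrable12_bounded_support[OF b]) (auto simp: square_integrable_def)
  qed
  have 2: "v \<in> sobolev (1/2) \<longleftrightarrow> half_energy v < top" if v: "integrable12 v"
  proof -
    have vm [measurable]: "v \<in> borel_measurable borel" using v by (auto simp: integrable12_def)
    note [measurable] = fourier_bounded_support(2)[OF b v]
    note ae = fourier_bounded_support(3)[OF b v]
    have m2: "(?m \<xi>)\<^sup>2 = sqrt (1 + (norm \<xi>)\<^sup>2)" for \<xi>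
      by (simp add: power2_eq_square powr_half_sqrt add_nonneg_nonneg flip: powr_add)
    have P: "integrable lborel (\<lambda>\<xi>. (norm (fourier_integral v \<xi>))\<^sup>2)"
      using plancherel[OF v] by (auto simp: has_bochner_integral_iff)
    have "v \<in> sobolev (1/2) \<longleftrightarrow> square_integrable (\<lambda>\<xi>. complex_of_real (?m \<xi>) * fourier v \<xi>)"
      using fourier_bounded_support(1)[OF b v] by (simp add: sobolev_def)
    also have "\<dots> \<longleftrightarrow> integrable lborel (\<lambda>\<xi>. sqrt (1 + (norm \<xi>)\<^sup>2) * (norm (fourier v \<xi>))\<^sup>2)"
      unfolding square_integrable_def norm_mult power_mult_distrib norm_of_real power2_abs m2 by auto
    also have "\<dots> \<longleftrightarrow> integrable lborel (\<lambda>\<xi>. sqrt (1 + (norm \<xi>)\<^sup>2) * (norm (fourier_integral v \<xi>))\<^sup>2)"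
      by (rule integrable_cong_AE) (use ae in auto)
    also have "\<dots> \<longleftrightarrow> integrable lborel (energy_density v)"
    proof
      assume A: "integrable lborel (\<lambda>\<xi>. sqrt (1 + (norm \<xi>)\<^sup>2) * (norm (fourier_integral v \<xi>))\<^sup>2)"
      show "integrable lborel (energy_density v)"
      proof (rule Bochner_Integration.integrable_bound[OF A])
        show "AE \<xi> in lborel. norm (energy_density v \<xi>) \<le> norm (sqrt (1 + (norm \<xi>)\<^sup>2) * (norm (fourier_integral v \<xi>))\<^sup>2)"
          by (intro AE_I2) (auto simp: energy_density_def abs_mult intro!: mult_right_mono real_le_rsqrt)
      qed measurable
    next
      assume B: "integrable lborel (energy_density v)"
      show "integrable lborel (\<lambda>\<xi>. sqrt (1 + (norm \<xi>)\<^sup>2) * (norm (fourier_integral v \<xi>))\<^sup>2)"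
      proof (rule Bochner_Integration.integrable_bound[OF Bochner_Integration.integrable_add[OF P B]])
        show "AE \<xi> in lborel. norm (sqrt (1 + (norm \<xi>)\<^sup>2) * (norm (fourier_integral v \<xi>))\<^sup>2)
           \<le> norm ((norm (fourier_integral v \<xi>))\<^sup>2 + energy_density v \<xi>)"
        proof (rule AE_I2)
          fix \<xi> :: 'a
          have "sqrt (1 + (norm \<xi>)\<^sup>2) \<le> 1 + norm \<xi>"
            by (rule real_le_lsqrt) (auto simp: power2_sum)
          then have "sqrt (1 + (norm \<xi>)\<^sup>2) * (norm (fourier_integral v \<xi>))\<^sup>2 \<le> (1 + norm \<xi>) * (norm (fourier_integral v \<xi>))\<^sup>2"
            by (rule mult_right_mono) simp
          then show "norm (sqrt (1 + (norm \<xi>)\<^sup>2) * (norm (fourier_integral v \<xi>))\<^sup>2)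
           \<le> norm ((norm (fourier_integral v \<xi>))\<^sup>2 + energy_density v \<xi>)"
            by (simp add: energy_density_def algebra_simps abs_mult)
        qed
      qed measurable
    qed
    also have "\<dots> \<longleftrightarrow> half_energy v < top" by (simp only: half_energy_finite_iff[OF vm])
    finally show ?thesis .
  qed
  show ?thesis using 1 2 by blast
qed

text \<open>\<open>enn2real\<close> sends infinity to 0, so the value is meaningful only for
  functions of finite \<open>half_energy\<close>.\<close>

definition half_form :: "('a::euclidean_space \<Rightarrow> real) \<Rightarrow> real" where
  "half_form v = enn2real (half_energy v) / (2 * pi) ^ DIM('a)"

lemma half_laplacian_eq_half_form:
  fixes v :: "'a::euclidean_space \<Rightarrow> real"
  assumes b: "essentially_bounded_support v" and v: "integrable12 v"
  shows "half_laplacian v v = half_form v"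
proof -
  have [measurable]: "v \<in> borel_measurable borel" using v by (auto simp: integrable12_def)
  note [measurable] = fourier_bounded_support(2)[OF b v]
  note ae = fourier_bounded_support(3)[OF b v]
  have "(LINT \<xi>|lborel. norm \<xi> * (norm (fourier v \<xi>))\<^sup>2) = (LINT \<xi>|lborel. energy_density v \<xi>)"
    unfolding energy_density_def by (rule integral_cong_AE) (use ae in auto)
  also have "\<dots> = enn2real (half_energy v)"
    unfolding half_energy_def by (rule integral_eq_nn_integral) auto
  finally show ?thesis by (simp add: half_laplacian_pairing_self half_form_def)
qed

text \<open>For bounded \<Omega> these are exactly the competitors in \<open>energy\<close>, rid of
  the chosen transform \<open>fourier\<close>; the identification is made in
  \<open>energy_bounded\<close>.\<close>

definition torsion_admissible :: "'a::euclidean_space set \<Rightarrow> ('a \<Rightarrow> real) set" where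
  "torsion_admissible \<Omega> = {v. integrable12 v \<and> half_energy v < top \<and> (AE x in lborel. x \<notin> \<Omega> \<longrightarrow> v x = 0)}"

text \<open>Its minimisers over a fixed \<Omega> satisfy (-Delta)^(1/2) u = 1 in \<Omega>, the
  fractional analogue of the torsion problem.\<close>

definition torsion_functional :: "('a::euclidean_space \<Rightarrow> real) \<Rightarrow> real" where
  "torsion_functional v = 1/2 * half_form v - (LINT x|lborel. v x)"

lemma energy_bounded:
  assumes "bounded \<Omega>"
  shows "energy \<Omega> = (INF v \<in> torsion_admissible \<Omega>. ereal (torsion_functional v))"
proof -
  obtain R where "\<And>x. x \<in> \<Omega> \<Longrightarrow> norm x \<le> R" using assms by (auto simp: bounded_iff)
  then have R: "\<And>x. x \<notin> cball 0 R \<Longrightarrow> x \<notin> \<Omega>" by force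
  have b: "essentially_bounded_support v" if "AE x in lborel. x \<notin> \<Omega> \<longrightarrow> v x = 0" for v
    unfolding essentially_bounded_support_def
    by (rule exI[of _ R]) (use that R in \<open>auto elim!: eventually_mono\<close>)
  have eq: "{v \<in> sobolev (1/2). AE x in lborel. x \<notin> \<Omega> \<longrightarrow> v x = 0} = torsion_admissible \<Omega>"
    using sobolev_half_iff b by (auto simp: torsion_admissible_def)
  show ?thesis
    unfolding energy_def eq torsion_functional_def
    by (rule INF_cong[OF refl]) (use b half_laplacian_eq_half_form in \<open>auto simp: torsion_admissible_def\<close>)
qed

subsection \<open>Existence of a minimiser\<close>

lemma integrable12_borel [dest]: "integrable12 v \<Longrightarrow> v \<in> borel_measurable borel"
  by (auto simp: integrable12_def)

lemma fourier_integral_add: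
  assumes "integrable lborel u" "integrable lborel v"
  shows "fourier_integral (\<lambda>x. u x + v x) \<xi> = fourier_integral u \<xi> + fourier_integral v \<xi>"
proof -
  have "fourier_integral (\<lambda>x. u x + v x) \<xi> =
    (LINT x|lborel. cis (- (x \<bullet> \<xi>)) * complex_of_real (u x) + cis (- (x \<bullet> \<xi>)) * complex_of_real (v x))"
    by (simp add: fourier_integral_def algebra_simps)
  also have "\<dots> = fourier_integral u \<xi> + fourier_integral v \<xi>"
    unfolding fourier_integral_def
    by (rule Bochner_Integration.integral_add) (intro integrable_fourier_integral assms)+
  finally show ?thesis .
qed

lemma fourier_integral_cmult:
  "fourier_integral (\<lambda>x. c * v x) \<xi> = complex_of_real c * fourier_integral v \<xi>"
proof -
  have "fourier_integral (\<lambda>x. c * v x) \<xi> =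
    (LINT x|lborel. complex_of_real c * (cis (- (x \<bullet> \<xi>)) * complex_of_real (v x)))"
    by (simp add: fourier_integral_def mult_ac)
  then show ?thesis by (simp only: fourier_integral_def integral_mult_right_zero)
qed

lemma energy_density_cmult: "energy_density (\<lambda>x. c * v x) \<xi> = c\<^sup>2 * energy_density v \<xi>"
  by (simp add: energy_density_def fourier_integral_cmult norm_mult power_mult_distrib)

lemma energy_density_parallelogram:
  assumes "integrable lborel u" "integrable lborel v"
  shows "energy_density (\<lambda>x. u x + v x) \<xi> + energy_density (\<lambda>x. u x - v x) \<xi> =
    2 * energy_density u \<xi> + 2 * energy_density v \<xi>"
proof -
  have diff: "fourier_integral (\<lambda>x. u x - v x) \<xi> = fourier_integral u \<xi> - fourier_integral v \<xi>"
    using fourier_integral_add[of u "\<lambda>x. (-1) * v x"] assms fourier_integral_cmult[of "-1" v] by simp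
  have *: "(norm (a + b))\<^sup>2 + (norm (a - b))\<^sup>2 = 2 * (norm a)\<^sup>2 + 2 * (norm b)\<^sup>2" for a b :: complex
    unfolding cmod_power2 by (simp add: power2_eq_square algebra_simps)
  show ?thesis
    using arg_cong[OF *[of "fourier_integral u \<xi>" "fourier_integral v \<xi>"], of "\<lambda>z. norm \<xi> * z"]
    by (simp only: energy_density_def fourier_integral_add[OF assms] diff distrib_left mult.left_commute)
qed

lemma torsion_admissible_cmult:
  assumes "v \<in> torsion_admissible \<Omega>" shows "(\<lambda>x. c * v x) \<in> torsion_admissible \<Omega>"
proof -
  have v: "integrable12 v" "half_energy v < top" and s: "AE x in lborel. x \<notin> \<Omega> \<longrightarrow> v x = 0"
    using assms by (auto simp: torsion_admissible_def)
  note [measurable] = integrable12_borel[OF v(1)]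
  have "energy_density (\<lambda>x. c * v x) = (\<lambda>\<xi>. c\<^sup>2 * energy_density v \<xi>)"
    by (rule ext) (rule energy_density_cmult)
  then have "integrable lborel (energy_density (\<lambda>x. c * v x))"
    using v half_energy_finite_iff[of v] by simp
  then have "half_energy (\<lambda>x. c * v x) < top"
    by (subst half_energy_finite_iff) auto
  then show ?thesis
    using integrable12_cmult[OF v(1)] s by (auto simp: torsion_admissible_def elim: eventually_mono)
qed

lemma torsion_admissible_add:
  assumes u: "u \<in> torsion_admissible \<Omega>" and v: "v \<in> torsion_admissible \<Omega>"
  shows "(\<lambda>x. u x + v x) \<in> torsion_admissible \<Omega>"
proof -
  have uv: "integrable12 u" "integrable12 v" "half_energy u < top" "half_energy v < top"
    using u v by (auto simp: torsion_admissible_def)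
  note [measurable] = integrable12_borel[OF uv(1)] integrable12_borel[OF uv(2)]
  have i: "integrable lborel u" "integrable lborel v" using uv by (auto simp: integrable12_def)
  have "integrable lborel (\<lambda>\<xi>. 2 * energy_density u \<xi> + 2 * energy_density v \<xi>)"
    using uv by (simp add: half_energy_finite_iff)
  then have "integrable lborel (energy_density (\<lambda>x. u x + v x))"
  proof (rule Bochner_Integration.integrable_bound)
    have "energy_density (\<lambda>x. u x + v x) \<xi> \<le> 2 * energy_density u \<xi> + 2 * energy_density v \<xi>" for \<xi>
      using energy_density_parallelogram[OF i, of \<xi>] energy_density_nonneg[of "\<lambda>x. u x - v x" \<xi>] by linarith
    then show "AE \<xi> in lborel. norm (energy_density (\<lambda>x. u x + v x) \<xi>) \<le> norm (2 * energy_density u \<xi> + 2 * energy_density v \<xi>)"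
      by (auto intro!: AE_I2)
  qed measurable
  then have "half_energy (\<lambda>x. u x + v x) < top"
    by (subst half_energy_finite_iff) auto
  moreover have "AE x in lborel. x \<notin> \<Omega> \<longrightarrow> u x + v x = 0"
    using u v by (auto simp: torsion_admissible_def)
  ultimately show ?thesis
    using integrable12_add[OF uv(1,2)] by (simp add: torsion_admissible_def)
qed

lemma torsion_admissible_diff:
  assumes "u \<in> torsion_admissible \<Omega>" "v \<in> torsion_admissible \<Omega>"
  shows "(\<lambda>x. u x - v x) \<in> torsion_admissible \<Omega>"
  using torsion_admissible_add[OF assms(1) torsion_admissible_cmult[OF assms(2), of "-1"]] by simp

lemma half_form_eq_integral:
  fixes v :: "'a::euclidean_space \<Rightarrow> real"
  assumes "v \<in> torsion_admissible \<Omega>"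
  shows "half_form v = (LINT \<xi>|lborel. energy_density v \<xi>) / (2 * pi) ^ DIM('a)"
    "integrable lborel (energy_density v)"
proof -
  have v: "integrable12 v" "half_energy v < top" using assms by (auto simp: torsion_admissible_def)
  note [measurable] = integrable12_borel[OF v(1)]
  show "half_form v = (LINT \<xi>|lborel. energy_density v \<xi>) / (2 * pi) ^ DIM('a)"
    unfolding half_form_def half_energy_def by (subst integral_eq_nn_integral) auto
  show "integrable lborel (energy_density v)" using v by (simp add: half_energy_finite_iff)
qed

lemma half_form_nonneg [simp]: "half_form v \<ge> 0" by (simp add: half_form_def)

lemma half_energy_eq:
  fixes v :: "'a::euclidean_space \<Rightarrow> real"
  shows "half_energy v < top \<Longrightarrow> half_energy v = ennreal ((2 * pi) ^ DIM('a) * half_form v)"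
  by (simp add: half_form_def)

lemma half_form_cmult:
  fixes v :: "'a::euclidean_space \<Rightarrow> real"
  assumes "v \<in> torsion_admissible \<Omega>" shows "half_form (\<lambda>x. c * v x) = c\<^sup>2 * half_form v"
  by (simp add: half_form_eq_integral[OF assms] half_form_eq_integral[OF torsion_admissible_cmult[OF assms]]
      energy_density_cmult)

text \<open>Holds already for the densities at each frequency. It is what makes a minimising
  sequence Cauchy in energy.\<close>

lemma half_form_parallelogram:
  fixes v :: "'a::euclidean_space \<Rightarrow> real"
  assumes u: "u \<in> torsion_admissible \<Omega>" and v: "v \<in> torsion_admissible \<Omega>"
  shows "half_form (\<lambda>x. u x + v x) + half_form (\<lambda>x. u x - v x) = 2 * half_form u + 2 * half_form v"
proof -
  have i: "integrable lborel u" "integrable lborel v"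
    using u v by (auto simp: torsion_admissible_def integrable12_def)
  note e = half_form_eq_integral[OF u] half_form_eq_integral[OF v]
    half_form_eq_integral[OF torsion_admissible_add[OF u v]] half_form_eq_integral[OF torsion_admissible_diff[OF u v]]
  have "(LINT \<xi>|lborel. energy_density (\<lambda>x. u x + v x) \<xi>) + (LINT \<xi>|lborel. energy_density (\<lambda>x. u x - v x) \<xi>) =
    (LINT \<xi>|lborel. energy_density (\<lambda>x. u x + v x) \<xi> + energy_density (\<lambda>x. u x - v x) \<xi>)"
    using e by simp
  also have "\<dots> = (LINT \<xi>|lborel. 2 * energy_density u \<xi> + 2 * energy_density v \<xi>)"
    by (simp only: energy_density_parallelogram[OF i])
  also have "\<dots> = 2 * (LINT \<xi>|lborel. energy_density u \<xi>) + 2 * (LINT \<xi>|lborel. energy_density v \<xi>)"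
    using e by simp
  finally show ?thesis
    unfolding e by (simp add: add_divide_distrib[symmetric])
qed

text \<open>Cauchy-Schwarz on a set of measure one, obtained by integrating the square of |v| - l
  over \<Omega>, where l is the L^1 norm.\<close>

lemma L1_le_L2:
  fixes v :: "'a::euclidean_space \<Rightarrow> real"
  assumes \<Omega> [measurable]: "\<Omega> \<in> sets borel" and m: "measure lborel \<Omega> = 1"
    and v: "integrable12 v" "AE x in lborel. x \<notin> \<Omega> \<longrightarrow> v x = 0"
  shows "(LINT x|lborel. \<bar>v x\<bar>)\<^sup>2 \<le> (LINT x|lborel. (v x)\<^sup>2)"
proof -
  define l where "l = (LINT x|lborel. \<bar>v x\<bar>)"
  have i: "integrable lborel (\<lambda>x. \<bar>v x\<bar>)" "integrable lborel (\<lambda>x. (v x)\<^sup>2)"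
    using v by (auto simp: integrable12_def)
  \<comment> \<open>Measure 1 excludes infinite measure, which \<open>measure\<close> would send to
    0.\<close>
  have I: "integrable lborel (indicator \<Omega> :: 'a \<Rightarrow> real)"
    using m by (intro integrable_real_indicator) (auto simp: measure_def top.not_eq_extremum[symmetric])
  have "0 \<le> (LINT x|lborel. (v x)\<^sup>2 - 2 * l * \<bar>v x\<bar> + l\<^sup>2 * indicator \<Omega> x)"
  proof (rule integral_nonneg_AE)
    show "AE x in lborel. 0 \<le> (v x)\<^sup>2 - 2 * l * \<bar>v x\<bar> + l\<^sup>2 * indicator \<Omega> x"
      using v(2)
    proof eventually_elim
      case (elim x)
      show ?case
        using zero_le_power2[of "\<bar>v x\<bar> - l"] elim by (cases "x \<in> \<Omega>") (auto simp: power2_diff mult_ac)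
    qed
  qed
  also have "\<dots> = (LINT x|lborel. (v x)\<^sup>2) - 2 * l * l + l\<^sup>2 * 1"
    using i I m by (simp add: l_def)
  finally show ?thesis by (simp add: l_def power2_eq_square)
qed

text \<open>Frequencies are split at the cube [-1, 1]^d. Inside it the squared transform is at most
  the squared L^1 norm, hence at most the squared L^2 norm; outside it |\<xi>| >= 1, so the energy
  density dominates. The cube has volume 2^d against the factor (2 pi)^d of Plancherel's theorem,
  and pi^d >= 2 allows its contribution to be absorbed.\<close>

lemma poincare:
  fixes v :: "'a::euclidean_space \<Rightarrow> real"
  assumes \<Omega> [measurable]: "\<Omega> \<in> sets borel" and m: "measure lborel \<Omega> = 1"
    and v: "v \<in> torsion_admissible \<Omega>"
  shows "(LINT x|lborel. (v x)\<^sup>2) \<le> 2 * half_form v"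
proof -
  have v12: "integrable12 v" "AE x in lborel. x \<notin> \<Omega> \<longrightarrow> v x = 0"
    using v by (auto simp: torsion_admissible_def)
  let ?N = "LINT x|lborel. (v x)\<^sup>2" and ?C = "cbox (- One) One :: 'a set"
  have i: "integrable lborel v" using v12 by (auto simp: integrable12_def)
  have L1: "(LINT x|lborel. \<bar>v x\<bar>)\<^sup>2 \<le> ?N" by (rule L1_le_L2[OF \<Omega> m v12])
  have C: "measure lborel ?C = 2 ^ DIM('a)"
  proof -
    have "(\<Prod>b\<in>Basis. (One - (- One :: 'a)) \<bullet> b) = (\<Prod>b\<in>(Basis :: 'a set). 2)"
      by (rule prod.cong) (auto simp: inner_diff_left inner_add_left)
    then show ?thesis by (subst measure_lborel_cbox_eq) auto
  qed
  have P: "has_bochner_integral lborel (\<lambda>\<xi>. (norm (fourier_integral v \<xi>))\<^sup>2) ((2 * pi) ^ DIM('a) * ?N)"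
    by (rule plancherel[OF v12(1)])
  have Ci: "integrable lborel (indicator ?C :: 'a \<Rightarrow> real)"
    using emeasure_lborel_cbox_finite[of "- One" "One :: 'a"] by (intro integrable_real_indicator) auto
  have "(2 * pi) ^ DIM('a) * ?N \<le> ?N * 2 ^ DIM('a) + (2 * pi) ^ DIM('a) * half_form v"
  proof (rule has_bochner_integral_mono[OF P])
    show "has_bochner_integral lborel (\<lambda>\<xi>. ?N * indicator ?C \<xi> + energy_density v \<xi>)
      (?N * 2 ^ DIM('a) + (2 * pi) ^ DIM('a) * half_form v)"
      using half_form_eq_integral[OF v] Ci C by (simp add: has_bochner_integral_iff)
    fix \<xi> :: 'a
    show "(norm (fourier_integral v \<xi>))\<^sup>2 \<le> ?N * indicator ?C \<xi> + energy_density v \<xi>"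
    proof (cases "\<xi> \<in> ?C")
      case True
      have "(norm (fourier_integral v \<xi>))\<^sup>2 \<le> (LINT x|lborel. \<bar>v x\<bar>)\<^sup>2"
        by (intro power_mono norm_fourier_integral_le i) auto
      also note L1
      finally show ?thesis using True by (simp add: add_increasing2)
    next
      case False
      have "norm \<xi> \<ge> 1"
      proof (rule ccontr)
        assume "\<not> ?thesis"
        then have "\<bar>\<xi> \<bullet> b\<bar> \<le> 1" if "b \<in> Basis" for b
          using Basis_le_norm[OF that, of \<xi>] by linarith
        then show False using False by (auto simp: mem_box abs_le_iff)
      qed
      then have "1 * (norm (fourier_integral v \<xi>))\<^sup>2 \<le> energy_density v \<xi>"
        unfolding energy_density_def by (rule mult_right_mono) simp
      then show ?thesis using False by simp
    qed
  qed
  then have "2 ^ DIM('a) * (pi ^ DIM('a) * ?N) \<le> 2 ^ DIM('a) * (?N + pi ^ DIM('a) * half_form v)"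
    by (simp add: power_mult_distrib algebra_simps)
  then have 1: "pi ^ DIM('a) * ?N \<le> ?N + pi ^ DIM('a) * half_form v" by simp
  have "pi ^ DIM('a) \<ge> pi ^ 1" using pi_gt3 by (intro power_increasing) auto
  then have pd: "pi ^ DIM('a) \<ge> 2" using pi_gt3 by simp
  have "2 * ?N \<le> pi ^ DIM('a) * ?N" by (intro mult_right_mono pd) auto
  with 1 have "pi ^ DIM('a) * ?N \<le> pi ^ DIM('a) * ?N / 2 + pi ^ DIM('a) * half_form v" by linarith
  then have "pi ^ DIM('a) * ?N \<le> pi ^ DIM('a) * (2 * half_form v)" by linarith
  then show ?thesis by simp
qed

text \<open>Fatou's lemma in the form used below: bounds along a sequence survive the almost
  everywhere limit.\<close>

lemma nn_integral_fatou_bound: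
  fixes f :: "nat \<Rightarrow> 'a \<Rightarrow> real"
  assumes [measurable]: "\<And>n. f n \<in> borel_measurable M"
    and lim: "AE x in M. (\<lambda>n. f n x) \<longlonglongrightarrow> g x"
    and le: "\<And>n. (\<integral>\<^sup>+x. ennreal (f n x) \<partial>M) \<le> ennreal (B n)" and B: "B \<longlonglongrightarrow> b"
  shows "(\<integral>\<^sup>+x. ennreal (g x) \<partial>M) \<le> ennreal b"
proof -
  have "(\<integral>\<^sup>+x. ennreal (g x) \<partial>M) = (\<integral>\<^sup>+x. liminf (\<lambda>n. ennreal (f n x)) \<partial>M)"
  proof (rule nn_integral_cong_AE)
    show "AE x in M. ennreal (g x) = liminf (\<lambda>n. ennreal (f n x))"
      using lim
    proof eventually_elim
      case (elim x)
      then have "(\<lambda>n. ennreal (f n x)) \<longlonglongrightarrow> ennreal (g x)" by (rule tendsto_ennrealI)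
      then show ?case by (simp add: lim_imp_Liminf)
    qed
  qed
  also have "\<dots> \<le> liminf (\<lambda>n. \<integral>\<^sup>+x. ennreal (f n x) \<partial>M)"
    by (rule nn_integral_liminf) auto
  also have "\<dots> \<le> liminf (\<lambda>n. ennreal (B n))"
    by (rule Liminf_mono) (use le in auto)
  also have "\<dots> = ennreal b"
    by (rule lim_imp_Liminf) (auto intro!: tendsto_ennrealI B)
  finally show ?thesis .
qed

text \<open>The direct method without weak compactness. Terms that approach the infimum at a
  geometric rate are Cauchy in energy by the parallelogram law and hence summably close in L^1 by
  \<open>poincare\<close>. This yields an almost everywhere limit with an integrable majorant, so
  the linear term and all Fourier integrals converge, and Fatou gives lower semicontinuity of the
  energy.\<close>

theorem exists_torsion_minimizer:
  fixes \<Omega> :: "'a::euclidean_space set"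
  assumes \<Omega> [measurable]: "\<Omega> \<in> sets borel" and m: "measure lborel \<Omega> = 1"
  shows "\<exists>u\<in>torsion_admissible \<Omega>. \<forall>v\<in>torsion_admissible \<Omega>. torsion_functional u \<le> torsion_functional v"
proof -
  let ?A = "torsion_admissible \<Omega>" and ?J = torsion_functional
  note L1 = L1_le_L2[OF \<Omega> m] and PC = poincare[OF \<Omega> m]
  have Adm: "integrable12 v" "AE x in lborel. x \<notin> \<Omega> \<longrightarrow> v x = 0" "integrable lborel v" "v \<in> borel_measurable borel"
    "half_energy v < top" if "v \<in> ?A" for v
    using that by (auto simp: torsion_admissible_def integrable12_def)
  have zero: "(\<lambda>x. 0) \<in> ?A"
    by (auto simp: torsion_admissible_def integrable12_def half_energy_def energy_density_def fourier_integral_def)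
  have L1q: "(LINT x|lborel. \<bar>v x\<bar>)\<^sup>2 \<le> 2 * half_form v" if "v \<in> ?A" for v
    using L1[of v] PC[of v] Adm[OF that] that by linarith
  \<comment> \<open>With I the L^1 norm, I <= I^2 / 4 + 1 and I^2 <= 2 \<open>half_form v\<close>
    give I <= \<open>half_form v\<close> / 2 + 1.\<close>
  have lower: "?J v \<ge> - 1" if v: "v \<in> ?A" for v
  proof -
    let ?I = "LINT x|lborel. \<bar>v x\<bar>"
    have "(LINT x|lborel. v x) \<le> ?I" by (rule integral_mono) (use Adm[OF v] in auto)
    moreover have "?I \<le> ?I\<^sup>2 / 4 + 1"
      using zero_le_power2[of "?I / 2 - 1"] by (simp add: power2_diff power_divide)
    ultimately show ?thesis using L1q[OF v] by (simp add: torsion_functional_def)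
  qed
  define l where "l = (INF v\<in>?A. ?J v)"
  have bdd: "bdd_below (?J ` ?A)" using lower by (auto intro!: bdd_belowI)
  have l_le: "l \<le> ?J v" if "v \<in> ?A" for v unfolding l_def using that bdd by (rule cINF_lower[rotated])
  \<comment> \<open>The rate is fixed by 16 e n = ((1/2)^n)^2, which makes the L^1 norms of
    successive differences at most (1/2)^n.\<close>
  define e where "e = (\<lambda>n::nat. (1/4)^n / 16 :: real)"
  have "\<exists>v\<in>?A. ?J v < l + e n" for n
  proof -
    have "l < l + e n" by (simp add: e_def)
    then show ?thesis unfolding l_def using zero bdd by (subst (asm) cINF_less_iff) auto
  qed
  then obtain v where vA: "\<And>n. v n \<in> ?A" and vJ: "\<And>n. ?J (v n) < l + e n" by metis
  note [measurable] = Adm(4)[OF vA]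
  have vi: "integrable lborel (v n)" for n by (rule Adm(3)[OF vA])
  define d where "d = (\<lambda>n x. v (Suc n) x - v n x)"
  have dA: "d n \<in> ?A" for n unfolding d_def by (rule torsion_admissible_diff[OF vA vA])
  have di: "integrable lborel (d n)" for n by (rule Adm(3)[OF dA])
  define I where "I = (\<lambda>n. LINT x|lborel. v n x)"
  have JI: "?J (v n) = 1/2 * half_form (v n) - I n" for n
    by (simp add: torsion_functional_def I_def)
  \<comment> \<open>The midpoint of two consecutive terms is a competitor, so its value is at least
    l; the parallelogram law turns this into a bound on the energy of the difference.\<close>
  have d_hf: "half_form (d n) \<le> 8 * e n" for n
  proof -
    let ?p = "\<lambda>x. v (Suc n) x + v n x"
    have p: "?p \<in> ?A" by (rule torsion_admissible_add[OF vA vA])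
    have h: "(\<lambda>x. (1/2) * ?p x) \<in> ?A" by (rule torsion_admissible_cmult[OF p])
    have "half_form ?p + half_form (d n) = 2 * half_form (v (Suc n)) + 2 * half_form (v n)"
      unfolding d_def by (rule half_form_parallelogram[OF vA vA])
    moreover have "l \<le> 1/8 * half_form ?p - 1/2 * (I (Suc n) + I n)"
    proof -
      have "?J (\<lambda>x. (1/2) * ?p x) = 1/8 * half_form ?p - 1/2 * (I (Suc n) + I n)"
        using vi unfolding torsion_functional_def half_form_cmult[OF p] integral_mult_right_zero I_def
        by (simp add: power2_eq_square)
      then show ?thesis using l_le[OF h] by simp
    qed
    moreover have "e (Suc n) \<le> e n" by (simp add: e_def)
    moreover have "hd \<le> 8 * \<delta>" if "hp + hd = 2 * a + 2 * b" "l \<le> 1/8 * hp - 1/2 * (i + j)"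
        "\<epsilon> \<le> \<delta>" "1/2 * b - j < l + \<delta>" "1/2 * a - i < l + \<epsilon>" for hd hp a b i j \<delta> \<epsilon> :: real
      using that by argo
    ultimately show ?thesis
      using vJ[of n] vJ[of "Suc n"] unfolding JI by blast
  qed
  have d_L1: "(LINT x|lborel. norm (d n x)) \<le> (1/2)^n" for n
  proof (rule power2_le_imp_le)
    have "(LINT x|lborel. norm (d n x))\<^sup>2 \<le> 16 * e n"
      using L1q[OF dA, of n] d_hf[of n] by simp
    also have "\<dots> = ((1/2)^n)\<^sup>2"
      by (simp add: e_def power_mult[symmetric] power_divide mult.commute[of n]) (simp add: power_mult)
    finally show "(LINT x|lborel. norm (d n x))\<^sup>2 \<le> ((1/2)^n)\<^sup>2" .
  qed simp
  have d_sum: "summable (\<lambda>n. LINT x|lborel. norm (d n x))"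
    by (rule summable_comparison_test'[where g = "\<lambda>n. (1/2)^n" and N = 0]) (use d_L1 in \<open>auto intro: summable_geometric\<close>)
  have d_ae: "AE x in lborel. summable (\<lambda>n. norm (d n x))"
  proof -
    have "(\<integral>\<^sup>+x. (\<Sum>n. ennreal (norm (d n x))) \<partial>lborel) = (\<Sum>n. \<integral>\<^sup>+x. ennreal (norm (d n x)) \<partial>lborel)"
      using di by (intro nn_integral_suminf) auto
    also have "\<dots> = (\<Sum>n. ennreal (LINT x|lborel. norm (d n x)))"
      using di by (intro suminf_cong nn_integral_eq_integral) auto
    also have "\<dots> = ennreal (\<Sum>n. LINT x|lborel. norm (d n x))"
      by (rule suminf_ennreal2) (use d_sum in auto)
    finally have "(\<integral>\<^sup>+x. (\<Sum>n. ennreal (norm (d n x))) \<partial>lborel) \<noteq> \<infinity>" by simp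
    then have "AE x in lborel. (\<Sum>n. ennreal (norm (d n x))) \<noteq> \<infinity>"
      using di by (intro nn_integral_PInf_AE) auto
    then show ?thesis
      by eventually_elim (auto intro!: summable_suminf_not_top)
  qed
  \<comment> \<open>By telescoping, this dominates every term of the sequence.\<close>
  define G where "G = (\<lambda>x. \<bar>v 0 x\<bar> + (\<Sum>n. norm (d n x)))"
  have Gi: "integrable lborel G"
    unfolding G_def using di d_ae d_sum
    by (intro Bochner_Integration.integrable_add integrable_abs vi integrable_suminf) auto
  have vsum: "v n x = v 0 x + (\<Sum>k<n. d k x)" for n x
    unfolding d_def by (subst sum_lessThan_telescope) simp
  \<comment> \<open>Where the sequence diverges \<open>lim\<close> is unspecified, but u is Borel
    measurable everywhere and divergence is confined to a null set.\<close>
  define u where "u = (\<lambda>x. lim (\<lambda>n. v n x))"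
  have [measurable]: "u \<in> borel_measurable borel" unfolding u_def by measurable
  have conv: "AE x in lborel. (\<lambda>n. v n x) \<longlonglongrightarrow> u x"
    using d_ae
  proof eventually_elim
    case (elim x)
    then have "summable (\<lambda>n. d n x)" by (rule summable_norm_cancel)
    then have "(\<lambda>n. v 0 x + (\<Sum>k<n. d k x)) \<longlonglongrightarrow> v 0 x + (\<Sum>k. d k x)"
      by (intro tendsto_intros summable_LIMSEQ)
    then have "convergent (\<lambda>n. v n x)" unfolding vsum[symmetric] by (rule convergentI)
    then show ?case by (simp add: u_def convergent_LIMSEQ_iff)
  qed
  have dom: "AE x in lborel. norm (v n x) \<le> G x" for n
    using d_ae
  proof eventually_elim
    case (elim x)
    have "norm (v n x) \<le> \<bar>v 0 x\<bar> + norm (\<Sum>k<n. d k x)" unfolding vsum[of n] by (simp add: abs_triangle_ineq)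
    also have "norm (\<Sum>k<n. d k x) \<le> (\<Sum>k<n. norm (d k x))" by (rule norm_sum)
    also have "\<dots> \<le> (\<Sum>k. norm (d k x))" using elim by (intro sum_le_suminf) auto
    finally show ?case by (simp add: G_def)
  qed
  have ui: "integrable lborel u"
    by (rule integrable_dominated_convergence[OF _ _ Gi conv dom]) auto
  have lim_int: "(\<lambda>n. LINT x|lborel. v n x) \<longlonglongrightarrow> (LINT x|lborel. u x)"
    by (rule integral_dominated_convergence[OF _ _ Gi conv dom]) auto
  have lim_F: "(\<lambda>n. fourier_integral (v n) \<xi>) \<longlonglongrightarrow> fourier_integral u \<xi>" for \<xi>
    unfolding fourier_integral_def
  proof (rule integral_dominated_convergence[OF _ _ Gi])
    show "AE x in lborel. (\<lambda>n. cis (- (x \<bullet> \<xi>)) * complex_of_real (v n x)) \<longlonglongrightarrow> cis (- (x \<bullet> \<xi>)) * complex_of_real (u x)"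
      using conv by eventually_elim (intro tendsto_intros)
    show "AE x in lborel. norm (cis (- (x \<bullet> \<xi>)) * complex_of_real (v n x)) \<le> G x" for n
      using dom[of n] by eventually_elim (simp add: norm_mult)
  qed measurable
  have lim_J: "(\<lambda>n. ?J (v n)) \<longlonglongrightarrow> l"
  proof (rule tendsto_sandwich)
    show "\<forall>\<^sub>F n in sequentially. l \<le> ?J (v n)" using l_le vA by auto
    show "\<forall>\<^sub>F n in sequentially. ?J (v n) \<le> l + e n" using vJ less_imp_le by (intro always_eventually allI) blast
    have "(\<lambda>n. l + (1/4)^n / 16) \<longlonglongrightarrow> l + 0 / 16"
      by (intro tendsto_intros LIMSEQ_realpow_zero) auto
    then show "(\<lambda>n. l + e n) \<longlonglongrightarrow> l" by (simp add: e_def)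
  qed simp
  \<comment> \<open>The limit of the quadratic parts, known because both the functionals and the
    linear terms converge.\<close>
  let ?q = "2 * (l + (LINT x|lborel. u x))"
  have lim_hf: "(\<lambda>n. half_form (v n)) \<longlonglongrightarrow> ?q"
  proof -
    have "(\<lambda>n. 2 * (?J (v n) + (LINT x|lborel. v n x))) \<longlonglongrightarrow> ?q"
      by (intro tendsto_intros lim_J lim_int)
    then show ?thesis by (simp add: torsion_functional_def)
  qed
  have q0: "?q \<ge> 0" by (rule LIMSEQ_le_const[OF lim_hf]) auto
  have he: "half_energy u \<le> ennreal ((2 * pi) ^ DIM('a) * ?q)"
    unfolding half_energy_def
  proof (rule nn_integral_fatou_bound)
    show "AE \<xi> in lborel. (\<lambda>n. energy_density (v n) \<xi>) \<longlonglongrightarrow> energy_density u \<xi>"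
      unfolding energy_density_def by (intro AE_I2 tendsto_intros lim_F)
    show "(\<integral>\<^sup>+\<xi>. ennreal (energy_density (v n) \<xi>) \<partial>lborel) \<le> ennreal ((2 * pi) ^ DIM('a) * half_form (v n))" for n
      using half_energy_eq[OF Adm(5)[OF vA[of n]]] by (simp add: half_energy_def)
    show "(\<lambda>n. (2 * pi) ^ DIM('a) * half_form (v n)) \<longlonglongrightarrow> (2 * pi) ^ DIM('a) * ?q"
      by (intro tendsto_intros lim_hf)
  qed measurable
  have u2: "(\<integral>\<^sup>+x. ennreal ((u x)\<^sup>2) \<partial>lborel) \<le> ennreal (2 * ?q)"
  proof (rule nn_integral_fatou_bound)
    show "AE x in lborel. (\<lambda>n. (v n x)\<^sup>2) \<longlonglongrightarrow> (u x)\<^sup>2"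
      using conv by eventually_elim (intro tendsto_intros)
    show "(\<integral>\<^sup>+x. ennreal ((v n x)\<^sup>2) \<partial>lborel) \<le> ennreal (2 * half_form (v n))" for n
      using PC[OF vA[of n]] Adm(1)[OF vA[of n]]
      by (subst nn_integral_eq_integral) (auto simp: integrable12_def intro!: ennreal_leI)
    show "(\<lambda>n. 2 * half_form (v n)) \<longlonglongrightarrow> 2 * ?q"
      by (intro tendsto_intros lim_hf)
  qed measurable
  have "integrable lborel (\<lambda>x. (u x)\<^sup>2)"
    using order.strict_trans1[OF u2 ennreal_less_top] by (intro integrableI_bounded) auto
  with ui have "integrable12 u" by (simp add: integrable12_def)
  moreover have hef: "half_energy u < top" using order.strict_trans1[OF he ennreal_less_top] by simp
  moreover have "AE x in lborel. x \<notin> \<Omega> \<longrightarrow> u x = 0"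
  proof -
    have "AE x in lborel. \<forall>n. x \<notin> \<Omega> \<longrightarrow> v n x = 0"
      unfolding AE_all_countable using Adm(2)[OF vA] by blast
    with conv show ?thesis
    proof eventually_elim
      case (elim x)
      show ?case
      proof
        assume "x \<notin> \<Omega>"
        then have "(\<lambda>n. v n x) = (\<lambda>n. 0)" using elim by auto
        then show "u x = 0" using elim(1) LIMSEQ_unique[OF _ tendsto_const] by metis
      qed
    qed
  qed
  ultimately have uA: "u \<in> ?A" by (simp add: torsion_admissible_def)
  have "(2 * pi) ^ DIM('a) * half_form u \<le> (2 * pi) ^ DIM('a) * ?q"
    using he q0 unfolding half_energy_eq[OF hef] by (subst (asm) ennreal_le_iff) auto
  then have "half_form u \<le> ?q" by (rule mult_left_le_imp_le) simp
  then have "?J u \<le> l" by (simp add: torsion_functional_def)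
  then show ?thesis using uA l_le by (intro bexI[of _ u]) (auto intro: order.trans)
qed

text \<open>Taking absolute values shrinks all differences, hence every heat deficit and the energy,
  and it can only raise the integral.\<close>

lemma torsion_functional_abs_le:
  fixes v :: "'a::euclidean_space \<Rightarrow> real"
  assumes v: "v \<in> torsion_admissible \<Omega>"
  shows "(\<lambda>x. \<bar>v x\<bar>) \<in> torsion_admissible \<Omega>" "torsion_functional (\<lambda>x. \<bar>v x\<bar>) \<le> torsion_functional v"
proof -
  have v12: "integrable12 v" "half_energy v < top" and s: "AE x in lborel. x \<notin> \<Omega> \<longrightarrow> v x = 0"
    using v by (auto simp: torsion_admissible_def)
  have a12: "integrable12 (\<lambda>x. \<bar>v x\<bar>)" using v12 by (auto simp: integrable12_def)
  have "heat_deficit t (\<lambda>x. \<bar>v x\<bar>) \<le> heat_deficit t v" if t: "t > 0" for t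
  proof -
    have "2 * heat_deficit t (\<lambda>x. \<bar>v x\<bar>) \<le> 2 * heat_deficit t v"
    proof (rule has_bochner_integral_mono[OF has_bochner_integral_heat_deficit[OF t a12] has_bochner_integral_heat_deficit[OF t v12(1)]])
      fix p :: "'a \<times> 'a"
      have "\<bar>\<bar>v (fst p)\<bar> - \<bar>v (snd p)\<bar>\<bar> \<le> \<bar>v (fst p) - v (snd p)\<bar>" by linarith
      then have "(\<bar>v (fst p)\<bar> - \<bar>v (snd p)\<bar>)\<^sup>2 \<le> (v (fst p) - v (snd p))\<^sup>2" by (simp add: abs_le_square_iff)
      then show "(\<bar>v (fst p)\<bar> - \<bar>v (snd p)\<bar>)\<^sup>2 * heat_kernel t (fst p - snd p) \<le> (v (fst p) - v (snd p))\<^sup>2 * heat_kernel t (fst p - snd p)"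
        by (rule mult_right_mono) (use t in simp)
    qed
    then show ?thesis by simp
  qed
  then have he: "half_energy (\<lambda>x. \<bar>v x\<bar>) \<le> half_energy v" by (rule half_energy_mono[OF v12(1) a12])
  then show "(\<lambda>x. \<bar>v x\<bar>) \<in> torsion_admissible \<Omega>"
    using a12 s v12(2) by (auto simp: torsion_admissible_def elim: eventually_mono)
  have "half_form (\<lambda>x. \<bar>v x\<bar>) \<le> half_form v"
    unfolding half_form_def using he v12(2) by (intro divide_right_mono enn2real_mono) auto
  moreover have "(LINT x|lborel. v x) \<le> (LINT x|lborel. \<bar>v x\<bar>)"
    using v12(1) a12 by (intro integral_mono) (auto simp: integrable12_def)
  ultimately show "torsion_functional (\<lambda>x. \<bar>v x\<bar>) \<le> torsion_functional v"
    by (simp add: torsion_functional_def)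
qed

section \<open>Lipschitz competitors and negativity of the minimum\<close>

lemma fourier_integral_shift:
  fixes v :: "'a::euclidean_space \<Rightarrow> real"
  assumes v: "integrable lborel v"
  shows "fourier_integral (\<lambda>x. v (h + x)) \<xi> = cis (h \<bullet> \<xi>) * fourier_integral v \<xi>"
proof -
  have "has_bochner_integral lborel (\<lambda>x. cis (- (x \<bullet> \<xi>)) * complex_of_real (v x)) (fourier_integral v \<xi>)"
    unfolding fourier_integral_def by (intro has_bochner_integral_integrable integrable_fourier_integral v)
  from has_bochner_integral_lborel_affine[OF _ this, of 1 h]
  have "has_bochner_integral lborel (\<lambda>x. cis (h \<bullet> \<xi>) * (cis (- ((h + x) \<bullet> \<xi>)) * complex_of_real (v (h + x)))) (cis (h \<bullet> \<xi>) * fourier_integral v \<xi>)"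
    by (intro has_bochner_integral_mult_right) simp
  moreover have "cis (h \<bullet> \<xi>) * (cis (- ((h + x) \<bullet> \<xi>)) * complex_of_real (v (h + x))) = cis (- (x \<bullet> \<xi>)) * complex_of_real (v (h + x))" for x
    by (simp add: mult.assoc[symmetric] cis_mult inner_add_left)
  ultimately show ?thesis by (simp add: fourier_integral_def has_bochner_integral_iff)
qed

lemma tendsto_scaled_sin: "(\<lambda>n. real (Suc n) * sin (a / real (Suc n))) \<longlonglongrightarrow> a"
proof -
  have "((\<lambda>x. sin (a * x)) has_real_derivative a) (at 0)"
    by (auto intro!: derivative_eq_intros)
  then have "((\<lambda>h. sin (a * h) / h) \<longlongrightarrow> a) (at 0)" by (simp add: DERIV_def)
  moreover have "filterlim (\<lambda>n. 1 / real (Suc n)) (at 0) sequentially"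
    unfolding filterlim_at using LIMSEQ_Suc[OF lim_1_over_n] by (auto simp: eventually_sequentially)
  ultimately have "(\<lambda>n. sin (a * (1 / real (Suc n))) / (1 / real (Suc n))) \<longlonglongrightarrow> a"
    by (rule filterlim_compose)
  then show ?thesis by (simp add: mult.commute)
qed

lemma norm_cis_minus_one: "(norm (cis \<theta> - 1))\<^sup>2 = 4 * (sin (\<theta> / 2))\<^sup>2"
proof -
  have "(norm (cis \<theta> - 1))\<^sup>2 = (cos \<theta> - 1)\<^sup>2 + (sin \<theta>)\<^sup>2" by (simp add: cmod_power2)
  also have "\<dots> = 2 - 2 * cos \<theta>" using sin_cos_squared_add[of \<theta>] by (simp add: power2_eq_square algebra_simps)
  also have "cos \<theta> = 1 - 2 * (sin (\<theta> / 2))\<^sup>2" using cos_double_sin[of "\<theta> / 2"] by simp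
  finally show ?thesis by simp
qed

text \<open>Difference quotients along a basis vector b have bounded L^2 norms, and their Fourier
  multipliers converge in modulus to |\<xi> \<bullet> b|. Fatou then bounds the integral of
  |\<xi>|^2 |fourier_integral v|^2, and |\<xi>| <= 1 + |\<xi>|^2.\<close>

lemma half_energy_lipschitz:
  fixes v :: "'a::euclidean_space \<Rightarrow> real"
  assumes v: "integrable12 v" and lip: "\<And>x y. \<bar>v x - v y\<bar> \<le> norm (x - y)"
    and supp: "\<And>x. norm x > R \<Longrightarrow> v x = 0"
  shows "half_energy v < top"
proof -
  have v1: "integrable lborel v" using v by (auto simp: integrable12_def)
  have [measurable]: "v \<in> borel_measurable borel" using v by auto
  \<comment> \<open>Shifts have length at most 1, so the difference of v and its shift lives in the
    ball of radius R + 1.\<close>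
  define V where "V = measure lborel (cball (0::'a) (R + 1))"
  let ?N = "\<lambda>\<xi>. (norm (fourier_integral v \<xi>))\<^sup>2"
  have CI: "integrable lborel (\<lambda>x::'a. c * indicator (cball 0 (R + 1)) x :: real)" for c
    using emeasure_lborel_cball_finite[of "0::'a" "R + 1"]
    by (intro integrable_mult_right integrable_real_indicator) auto
  have shift: "integrable12 (\<lambda>x. v (h + x))" for h
    using has_bochner_integral_lborel_affine[of 1 v _ h, OF _ has_bochner_integral_integrable[OF v1]]
      has_bochner_integral_lborel_affine[of 1 "\<lambda>x. (v x)\<^sup>2" _ h, OF _ has_bochner_integral_integrable] v
    by (auto simp: integrable12_def has_bochner_integral_iff)
  have b: "integrable lborel (\<lambda>\<xi>. (\<xi> \<bullet> b)\<^sup>2 * ?N \<xi>)" if b: "b \<in> Basis" for b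
  proof -
    let ?f = "\<lambda>n \<xi>. (real (Suc n))\<^sup>2 * ((norm (cis ((\<xi> \<bullet> b) / real (Suc n)) - 1))\<^sup>2 * ?N \<xi>)"
    have "(\<integral>\<^sup>+\<xi>. ennreal ((\<xi> \<bullet> b)\<^sup>2 * ?N \<xi>) \<partial>lborel) \<le> ennreal ((2 * pi) ^ DIM('a) * V)"
    proof (rule nn_integral_fatou_bound)
      show "AE \<xi> in lborel. (\<lambda>n. ?f n \<xi>) \<longlonglongrightarrow> (\<xi> \<bullet> b)\<^sup>2 * ?N \<xi>"
      proof (rule AE_I2)
        fix \<xi> :: 'a
        have L: "(\<lambda>n. 4 * (real (Suc n) * sin (((\<xi> \<bullet> b) / 2) / real (Suc n)))\<^sup>2 * ?N \<xi>) \<longlonglongrightarrow> 4 * ((\<xi> \<bullet> b) / 2)\<^sup>2 * ?N \<xi>"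
          by (intro tendsto_intros tendsto_scaled_sin)
        have eq: "4 * (real (Suc n) * sin (((\<xi> \<bullet> b) / 2) / real (Suc n)))\<^sup>2 * ?N \<xi> = ?f n \<xi>" for n
          unfolding norm_cis_minus_one by (simp add: power_mult_distrib mult_ac)
        have "4 * ((\<xi> \<bullet> b) / 2)\<^sup>2 * ?N \<xi> = (\<xi> \<bullet> b)\<^sup>2 * ?N \<xi>" by (simp add: power_divide)
        then show "(\<lambda>n. ?f n \<xi>) \<longlonglongrightarrow> (\<xi> \<bullet> b)\<^sup>2 * ?N \<xi>" using L unfolding eq by (simp only:)
      qed
      show "(\<integral>\<^sup>+\<xi>. ennreal (?f n \<xi>) \<partial>lborel) \<le> ennreal ((2 * pi) ^ DIM('a) * V)" for n
      proof -
        define h where "h = (1 / real (Suc n)) *\<^sub>R b"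
        have nh: "norm h = 1 / real (Suc n)" using b by (simp add: h_def)
        have w12: "integrable12 (\<lambda>x. v (h + x) - v x)" by (rule integrable12_diff[OF shift v])
        have F: "fourier_integral (\<lambda>x. v (h + x) - v x) \<xi> = (cis ((\<xi> \<bullet> b) / real (Suc n)) - 1) * fourier_integral v \<xi>" for \<xi>
        proof -
          have i: "integrable lborel (\<lambda>x. v (h + x))" "integrable lborel (\<lambda>x. (- 1) * v x)"
            using shift[of h] v1 by (auto simp: integrable12_def)
          have "fourier_integral (\<lambda>x. v (h + x) + (- 1) * v x) \<xi> = cis (h \<bullet> \<xi>) * fourier_integral v \<xi> + complex_of_real (-1) * fourier_integral v \<xi>"
            unfolding fourier_integral_add[OF i] fourier_integral_shift[OF v1] fourier_integral_cmult ..
          moreover have "h \<bullet> \<xi> = (\<xi> \<bullet> b) / real (Suc n)" by (simp add: h_def inner_commute)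
          ultimately show ?thesis by (simp add: algebra_simps)
        qed
        have "(LINT x|lborel. (v (h + x) - v x)\<^sup>2) \<le> (LINT x|lborel. (norm h)\<^sup>2 * indicator (cball (0::'a) (R + 1)) x)"
        proof (rule integral_mono[OF _ CI])
          show "integrable lborel (\<lambda>x. (v (h + x) - v x)\<^sup>2)" using w12 by (simp add: integrable12_def)
          fix x :: 'a
          show "(v (h + x) - v x)\<^sup>2 \<le> (norm h)\<^sup>2 * indicator (cball 0 (R + 1)) x"
          proof (cases "norm x \<le> R + 1")
            case True
            have "\<bar>v (h + x) - v x\<bar> \<le> norm h" using lip[of "h + x" x] by simp
            then have "(v (h + x) - v x)\<^sup>2 \<le> (norm h)\<^sup>2" by (simp add: power2_le_iff_abs_le)
            then show ?thesis using True by simp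
          next
            case False
            have "norm x \<le> norm (h + x) + norm h" using norm_triangle_ineq4[of "h + x" h] by simp
            moreover have "norm h \<le> 1" unfolding nh by simp
            ultimately have "norm (h + x) > R" "norm x > R" using False by linarith+
            then show ?thesis using supp by simp
          qed
        qed
        also have "\<dots> = (norm h)\<^sup>2 * V"
          using emeasure_lborel_cball_finite[of "0::'a" "R + 1"] by (simp add: V_def)
        finally have L: "(real (Suc n))\<^sup>2 * (LINT x|lborel. (v (h + x) - v x)\<^sup>2) \<le> V"
          unfolding nh by (simp add: field_simps)
        have "has_bochner_integral lborel (?f n) ((real (Suc n))\<^sup>2 * ((2 * pi) ^ DIM('a) * (LINT x|lborel. (v (h + x) - v x)\<^sup>2)))"
          using plancherel[OF w12] unfolding F norm_mult power_mult_distrib by (rule has_bochner_integral_mult_right)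
        then have "(\<integral>\<^sup>+\<xi>. ennreal (?f n \<xi>) \<partial>lborel) = ennreal ((real (Suc n))\<^sup>2 * ((2 * pi) ^ DIM('a) * (LINT x|lborel. (v (h + x) - v x)\<^sup>2)))"
          by (subst nn_integral_eq_integral) (auto simp: has_bochner_integral_iff)
        also have "(real (Suc n))\<^sup>2 * ((2 * pi) ^ DIM('a) * (LINT x|lborel. (v (h + x) - v x)\<^sup>2)) =
           (2 * pi) ^ DIM('a) * ((real (Suc n))\<^sup>2 * (LINT x|lborel. (v (h + x) - v x)\<^sup>2))"
          by (rule mult.left_commute)
        also have "ennreal \<dots> \<le> ennreal ((2 * pi) ^ DIM('a) * V)"
          by (intro ennreal_leI mult_left_mono L) simp
        finally show ?thesis .
      qed
      show "(\<lambda>n. (2 * pi) ^ DIM('a) * V) \<longlonglongrightarrow> (2 * pi) ^ DIM('a) * V" by simp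
    qed measurable
    then have "(\<integral>\<^sup>+\<xi>. ennreal ((\<xi> \<bullet> b)\<^sup>2 * ?N \<xi>) \<partial>lborel) < \<infinity>"
      by (rule order.strict_trans1) simp
    then show ?thesis by (intro integrableI_bounded) auto
  qed
  have "integrable lborel (\<lambda>\<xi>. ?N \<xi> + (\<Sum>b\<in>Basis. (\<xi> \<bullet> b)\<^sup>2 * ?N \<xi>))"
    using plancherel[OF v] b by (intro Bochner_Integration.integrable_add Bochner_Integration.integrable_sum) (auto simp: has_bochner_integral_iff)
  then have "integrable lborel (energy_density v)"
  proof (rule Bochner_Integration.integrable_bound)
    show "AE \<xi> in lborel. norm (energy_density v \<xi>) \<le> norm (?N \<xi> + (\<Sum>b\<in>Basis. (\<xi> \<bullet> b)\<^sup>2 * ?N \<xi>))"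
    proof (rule AE_I2)
      fix \<xi> :: 'a
      have "norm \<xi> \<le> 1 + (norm \<xi>)\<^sup>2"
        using zero_le_power2[of "norm \<xi> - 1"] norm_ge_zero[of \<xi>] unfolding power2_diff by (simp del: norm_ge_zero)
      then have "norm \<xi> * ?N \<xi> \<le> (1 + (norm \<xi>)\<^sup>2) * ?N \<xi>" by (rule mult_right_mono) simp
      also have "\<dots> = ?N \<xi> + (\<Sum>b\<in>Basis. (\<xi> \<bullet> b)\<^sup>2 * ?N \<xi>)"
        by (simp add: norm_sq_eq_sum_Basis[of \<xi>] distrib_right sum_distrib_right)
      finally show "norm (energy_density v \<xi>) \<le> norm (?N \<xi> + (\<Sum>b\<in>Basis. (\<xi> \<bullet> b)\<^sup>2 * ?N \<xi>))"
        by (simp add: energy_density_def abs_mult)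
    qed
  qed measurable
  then show ?thesis by (simp add: half_energy_finite_iff)
qed

text \<open>A cone over a ball inside \<Omega> has finite energy and positive integral; for a small
  multiple of it the linear term beats the quadratic one.\<close>

lemma exists_torsion_functional_negative:
  fixes \<Omega> :: "'a::euclidean_space set"
  assumes "open \<Omega>" "\<Omega> \<noteq> {}"
  shows "\<exists>v\<in>torsion_admissible \<Omega>. torsion_functional v < 0"
proof -
  obtain c where "c \<in> \<Omega>" using assms by auto
  then obtain r where r: "r > 0" "ball c r \<subseteq> \<Omega>" using assms open_contains_ball by blast
  define f where "f = (\<lambda>x. max 0 (r - dist c x))"
  have [measurable]: "f \<in> borel_measurable borel"
    unfolding f_def by (intro borel_measurable_continuous_onI continuous_intros)
  have f0: "f x \<ge> 0" "f x \<le> r" for x using r by (auto simp: f_def)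
  have fpos: "f x > 0 \<longleftrightarrow> x \<in> ball c r" for x by (auto simp: f_def)
  have supp: "f x = 0" if "x \<notin> \<Omega>" for x using that r fpos[of x] f0(1)[of x] by (auto simp: less_le)
  have eb: "essentially_bounded_support f"
    unfolding essentially_bounded_support_def
  proof (intro exI AE_I2 impI)
    fix x :: 'a assume "x \<notin> cball 0 (norm c + r)"
    then have "norm c + r < norm x" by simp
    then have "dist c x > r" using norm_triangle_ineq2[of x c] by (simp add: dist_norm norm_minus_commute)
    then show "f x = 0" by (simp add: f_def)
  qed
  have "integrable lborel (\<lambda>x. (f x)\<^sup>2)"
  proof (rule Bochner_Integration.integrable_bound)
    show "integrable lborel (\<lambda>x::'a. r\<^sup>2 * indicator (ball c r) x :: real)"
      using emeasure_lborel_ball_finite[of c r] by (intro integrable_mult_right integrable_real_indicator) auto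
    show "AE x in lborel. norm ((f x)\<^sup>2) \<le> norm (r\<^sup>2 * indicator (ball c r) x :: real)"
    proof (rule AE_I2)
      fix x
      show "norm ((f x)\<^sup>2) \<le> norm (r\<^sup>2 * indicator (ball c r) x :: real)"
        using f0[of x] fpos[of x] by (cases "x \<in> ball c r") (auto intro: power_mono)
    qed
  qed measurable
  then have f12: "integrable12 f" by (intro integrable12_bounded_support eb) auto
  have "half_energy f < top"
  proof (rule half_energy_lipschitz[OF f12])
    show "\<bar>f x - f y\<bar> \<le> norm (x - y)" for x y
      unfolding f_def using dist_triangle[of c x y] dist_triangle[of c y x] by (auto simp: dist_norm norm_minus_commute abs_if max_def)
    show "f x = 0" if "norm x > norm c + r" for x
    proof -
      have "dist c x > r" using that norm_triangle_ineq2[of x c] by (simp add: dist_norm norm_minus_commute)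
      then show ?thesis by (simp add: f_def)
    qed
  qed
  then have fA: "f \<in> torsion_admissible \<Omega>" using f12 supp by (auto simp: torsion_admissible_def)
  have fi: "integrable lborel f" using f12 by (simp add: integrable12_def)
  have I: "(LINT x|lborel. f x) > 0"
  proof (rule ccontr)
    assume "\<not> ?thesis"
    then have "(LINT x|lborel. f x) = 0" using f0 by (intro antisym integral_nonneg) auto
    then have "AE x in lborel. f x = 0" using fi f0 by (subst (asm) integral_nonneg_eq_0_iff_AE) auto
    then have "AE x in lborel. x \<notin> ball c r" by eventually_elim (use fpos in force)
    then have "ball c r \<in> null_sets lborel" by (subst (asm) AE_iff_null_sets[symmetric]) auto
    then have "emeasure lborel (ball c r) = 0" by (rule null_setsD1)
    then show False using content_ball_pos[OF r(1), of c] by (simp add: measure_def)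
  qed
  let ?I = "LINT x|lborel. f x"
  \<comment> \<open>The added 1 avoids division by zero and still gives s \<open>half_form f\<close>
    <= ?I, twice as good as needed.\<close>
  define s where "s = ?I / (half_form f + 1)"
  have q: "half_form f + 1 > 0" using half_form_nonneg[of f] by linarith
  have s: "s > 0" unfolding s_def using I q by simp
  have "torsion_functional (\<lambda>x. s * f x) = s * (s * half_form f / 2 - ?I)"
    unfolding torsion_functional_def half_form_cmult[OF fA] by (simp add: power2_eq_square algebra_simps)
  moreover have "s * half_form f / 2 < ?I"
  proof -
    have "s * half_form f \<le> s * (half_form f + 1)" using s by simp
    also have "\<dots> = ?I" using q by (simp add: s_def)
    finally show ?thesis using I by linarith
  qed
  ultimately have "torsion_functional (\<lambda>x. s * f x) < 0" using s by (simp add: mult_pos_neg)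
  then show ?thesis using torsion_admissible_cmult[OF fA, of s] by blast
qed

corollary exists_nonneg_torsion_minimizer:
  fixes \<Omega> :: "'a::euclidean_space set"
  assumes o: "open \<Omega>" and m: "measure lborel \<Omega> = 1"
  shows "\<exists>u\<in>torsion_admissible \<Omega>. (\<forall>x. u x \<ge> 0) \<and> torsion_functional u < 0 \<and>
    (\<forall>v\<in>torsion_admissible \<Omega>. torsion_functional u \<le> torsion_functional v)"
proof -
  have "\<Omega> \<noteq> {}" using m by auto
  then obtain w where w: "w \<in> torsion_admissible \<Omega>" "torsion_functional w < 0"
    using exists_torsion_functional_negative[OF o] by blast
  obtain u where u: "u \<in> torsion_admissible \<Omega>" "\<forall>v\<in>torsion_admissible \<Omega>. torsion_functional u \<le> torsion_functional v"
    using exists_torsion_minimizer[OF borel_open[OF o] m] by blast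
  show ?thesis
    using torsion_functional_abs_le[OF u(1)] u w by (intro bexI[of _ "\<lambda>x. \<bar>u x\<bar>"]) force+
qed

subsection \<open>Polarization\<close>

text \<open>A reflection, in the hyperplane x \<bullet> e = s, only for a unit vector e; hence the
  assumption \<open>norm e = 1\<close> throughout.\<close>

definition reflect :: "'a::real_inner \<Rightarrow> real \<Rightarrow> 'a \<Rightarrow> 'a" where
  "reflect e s x = x - (2 * (x \<bullet> e - s)) *\<^sub>R e"

lemma reflect_inner: "norm e = 1 \<Longrightarrow> reflect e s x \<bullet> e - s = - (x \<bullet> e - s)"
  by (simp add: reflect_def inner_diff_left dot_square_norm)

lemma reflect_reflect [simp]: "norm e = 1 \<Longrightarrow> reflect e s (reflect e s x) = x"
proof -
  assume e: "norm e = 1"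
  have "reflect e s (reflect e s x) = reflect e s x + (2 * (x \<bullet> e - s)) *\<^sub>R e"
    unfolding reflect_def[of e s "reflect e s x"] reflect_inner[OF e]
    by (simp only: mult_minus_right scaleR_minus_left diff_minus_eq_add)
  also have "\<dots> = x" unfolding reflect_def[of e s x] by (rule diff_add_cancel)
  finally show ?thesis .
qed

lemma reflect_eq_self: "x \<bullet> e = s \<Longrightarrow> reflect e s x = x"
  by (simp add: reflect_def)

text \<open>The identity behind polarization: reflecting one of two points increases their distance
  exactly when both lie strictly on the same side of the hyperplane.\<close>

lemma norm_diff_reflect:
  assumes "norm e = 1"
  shows "(norm (x - reflect e s y))\<^sup>2 = (norm (x - y))\<^sup>2 + 4 * (x \<bullet> e - s) * (y \<bullet> e - s)"
proof -
  have "(norm (x - reflect e s y))\<^sup>2 = (norm ((x - y) + (2 * (y \<bullet> e - s)) *\<^sub>R e))\<^sup>2"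
    by (simp add: reflect_def algebra_simps)
  also have "\<dots> = (norm (x - y))\<^sup>2 + 4 * (y \<bullet> e - s) * ((x - y) \<bullet> e) + 4 * (y \<bullet> e - s)\<^sup>2"
  proof -
    have "e \<bullet> e = 1" using assms by (simp add: dot_square_norm)
    then have "(norm (z + c *\<^sub>R e))\<^sup>2 = (norm z)\<^sup>2 + 2 * c * (z \<bullet> e) + c\<^sup>2" for z c
      by (simp add: power2_norm_eq_inner inner_add_left inner_add_right inner_commute[of e z] power2_eq_square[of c] distrib_left)
    then show ?thesis by (simp only: power_mult_distrib) simp
  qed
  also have "\<dots> = (norm (x - y))\<^sup>2 + 4 * (x \<bullet> e - s) * (y \<bullet> e - s)"
    by (simp add: inner_diff_left power2_eq_square algebra_simps)
  finally show ?thesis .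
qed

lemma norm_reflect_diff_reflect:
  assumes e: "norm e = 1"
  shows "norm (reflect e s x - reflect e s y) = norm (x - y)"
proof -
  have "(norm (reflect e s x - reflect e s y))\<^sup>2 = (norm (reflect e s x - y))\<^sup>2 + 4 * (- (x \<bullet> e - s)) * (y \<bullet> e - s)"
    by (simp only: norm_diff_reflect[OF e] reflect_inner[OF e])
  also have "norm (reflect e s x - y) = norm (y - reflect e s x)" by (rule norm_minus_commute)
  also have "(norm (y - reflect e s x))\<^sup>2 = (norm (x - y))\<^sup>2 + 4 * (x \<bullet> e - s) * (y \<bullet> e - s)"
    unfolding norm_diff_reflect[OF e] norm_minus_commute[of y x] by (simp add: algebra_simps)
  finally have "(norm (reflect e s x - reflect e s y))\<^sup>2 = (norm (x - y))\<^sup>2" by (simp add: algebra_simps)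
  then show ?thesis by simp
qed

lemma continuous_reflect [continuous_intros]: "continuous_on A (reflect e s)"
  unfolding reflect_def by (intro continuous_intros)

lemma borel_measurable_reflect [measurable]: "reflect e s \<in> borel \<rightarrow>\<^sub>M (borel :: 'a::euclidean_space measure)"
  by (intro borel_measurable_continuous_onI continuous_reflect)

text \<open>The reflection is an orthogonal linear map followed by the translation by 2 s e. Being
  an involution, its preimages of boxes are images, and boxes determine Lebesgue measure.\<close>

lemma lborel_distr_reflect:
  fixes e :: "real ^ 'n::{finite,wellorder}"
  assumes e: "norm e = 1"
  shows "distr lborel borel (reflect e s) = lborel"
proof (rule lborel_eqI[symmetric])
  fix l u :: "(real, 'n) vec"
  assume lu: "\<And>b. b \<in> Basis \<Longrightarrow> l \<bullet> b \<le> u \<bullet> b"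
  define r where "r = reflect e 0"
  have "linear r"
    unfolding r_def reflect_def by (rule linearI) (auto simp: inner_add_left scaleR_add_left algebra_simps)
  moreover have "norm (r x) = norm x" for x
    using norm_reflect_diff_reflect[OF e, of 0 x 0] by (simp add: r_def) (simp add: reflect_def)
  ultimately have orth: "orthogonal_transformation r" by (simp add: orthogonal_transformation)
  have split: "reflect e s = (\<lambda>x. (2 * s) *\<^sub>R e + x) \<circ> r"
    by (auto simp: fun_eq_iff reflect_def r_def algebra_simps)
  have pre: "reflect e s -` box l u = reflect e s ` box l u"
    using e by (force simp: image_iff intro: bexI[of _ "reflect e s _"])
  have box: "box l u \<in> lmeasurable" by simp
  have img: "reflect e s ` box l u = (+) ((2 * s) *\<^sub>R e) ` (r ` box l u)"
    unfolding split image_comp[symmetric] by auto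
  have lm: "reflect e s ` box l u \<in> lmeasurable"
    unfolding img by (intro measurable_translation measurable_orthogonal_image[OF orth box])
  have meas: "measure lebesgue (reflect e s ` box l u) = measure lebesgue (box l u)"
    unfolding img measure_translation by (rule measure_orthogonal_image[OF orth box])
  have sb: "reflect e s -` box l u \<in> sets borel"
    using measurable_sets_borel[OF borel_measurable_reflect, of "box l u" e s] by simp
  have "emeasure (distr lborel borel (reflect e s)) (box l u) = emeasure lborel (reflect e s -` box l u)"
    by (subst emeasure_distr) auto
  also have "\<dots> = emeasure lebesgue (reflect e s -` box l u)"
    using sb by (simp add: emeasure_completion)
  also have "\<dots> = ennreal (measure lebesgue (reflect e s -` box l u))"
    using lm unfolding pre by (intro emeasure_eq_measure2) (auto simp: fmeasurable_def)
  also have "\<dots> = ennreal (measure lebesgue (box l u))" unfolding pre meas ..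
  also have "\<dots> = (\<Prod>b\<in>Basis. (u - l) \<bullet> b)"
    using lu by (simp add: measure_lborel_box_eq)
  finally show "emeasure (distr lborel borel (reflect e s)) (box l u) = (\<Prod>b\<in>Basis. (u - l) \<bullet> b)" .
qed simp

lemma AE_reflect:
  fixes e :: "real ^ 'n::{finite,wellorder}"
  assumes e: "norm e = 1" and P: "AE x in lborel. P x"
  shows "AE x in lborel. P (reflect e s x)"
proof -
  have "AE x in distr lborel borel (reflect e s). P x" unfolding lborel_distr_reflect[OF e] by (rule P)
  then show ?thesis by (rule AE_distrD[rotated]) simp
qed

lemma has_bochner_integral_reflect:
  fixes e :: "real ^ 'n::{finite,wellorder}" and f :: "_ \<Rightarrow> real"
  assumes e: "norm e = 1" and f: "has_bochner_integral lborel f I"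
  shows "has_bochner_integral lborel (\<lambda>x. f (reflect e s x)) I"
proof -
  have "has_bochner_integral (distr lborel borel (reflect e s)) f I"
    using f by (simp add: lborel_distr_reflect[OF e])
  moreover have "f \<in> borel_measurable borel" using f by (auto simp: has_bochner_integral_iff dest: borel_measurable_integrable)
  ultimately show ?thesis
    by (simp add: has_bochner_integral_iff integrable_distr_eq integral_distr)
qed

text \<open>Only the second variable is moved; together with
  \<open>has_bochner_integral_swap\<close> this reaches all four reflected copies of a pair.\<close>

lemma has_bochner_integral_reflect_snd:
  fixes e :: "real ^ 'n::{finite,wellorder}" and f :: "(real, 'n) vec \<times> (real, 'n) vec \<Rightarrow> real"
  assumes e: "norm e = 1" and f: "has_bochner_integral (lborel \<Otimes>\<^sub>M lborel) f I"
  shows "has_bochner_integral (lborel \<Otimes>\<^sub>M lborel) (\<lambda>p. f (fst p, reflect e s (snd p))) I"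
proof -
  have "distr lborel borel (\<lambda>x. x) \<Otimes>\<^sub>M distr lborel borel (reflect e s) =
     distr (lborel \<Otimes>\<^sub>M lborel) (borel \<Otimes>\<^sub>M borel) (\<lambda>(x, y). (x :: (real, 'n) vec, reflect e s y))"
    by (rule pair_measure_distr) (simp_all add: lborel_distr_reflect[OF e] lborel.sigma_finite_measure_axioms)
  moreover have "distr lborel borel (\<lambda>x. x :: (real, 'n) vec) = lborel"
    by (rule distr_id2) simp
  ultimately have D: "lborel \<Otimes>\<^sub>M lborel = distr (lborel \<Otimes>\<^sub>M lborel) (borel \<Otimes>\<^sub>M borel) (\<lambda>p. (fst p :: (real, 'n) vec, reflect e s (snd p)))"
    by (simp add: lborel_distr_reflect[OF e] case_prod_beta')
  have "f \<in> borel_measurable (lborel \<Otimes>\<^sub>M lborel)"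
    using f by (auto simp: has_bochner_integral_iff dest: borel_measurable_integrable)
  moreover have "sets (lborel \<Otimes>\<^sub>M lborel) = sets (borel \<Otimes>\<^sub>M borel :: ((real, 'n) vec \<times> (real, 'n) vec) measure)"
    by (rule sets_pair_measure_cong) auto
  ultimately have fm: "f \<in> borel_measurable (borel \<Otimes>\<^sub>M borel)"
    by (simp cong: measurable_cong_sets)
  have "(\<lambda>p. (fst p :: (real, 'n) vec, reflect e s (snd p))) \<in> lborel \<Otimes>\<^sub>M lborel \<rightarrow>\<^sub>M borel \<Otimes>\<^sub>M borel"
    by measurable
  moreover have "has_bochner_integral (distr (lborel \<Otimes>\<^sub>M lborel) (borel \<Otimes>\<^sub>M borel) (\<lambda>p. (fst p :: (real, 'n) vec, reflect e s (snd p)))) f I"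
    using f by (simp only: D[symmetric])
  ultimately show ?thesis
    using fm by (simp add: has_bochner_integral_iff integrable_distr_eq integral_distr)
qed

lemma has_bochner_integral_swap:
  fixes f :: "'a::euclidean_space \<times> 'a \<Rightarrow> real"
  assumes f: "has_bochner_integral (lborel \<Otimes>\<^sub>M lborel) f I"
  shows "has_bochner_integral (lborel \<Otimes>\<^sub>M lborel) (\<lambda>p. f (snd p, fst p)) I"
proof -
  have i: "integrable (lborel \<Otimes>\<^sub>M lborel) f" "integral\<^sup>L (lborel \<Otimes>\<^sub>M lborel) f = I"
    using f by (auto simp: has_bochner_integral_iff)
  have "(\<lambda>p. f (snd p, fst p)) = (\<lambda>(x, y). f (y, x))" by auto
  then show ?thesis
    using lborel_pair.integrable_product_swap[OF i(1)] lborel_pair.integral_product_swap[OF borel_measurable_integrable[OF i(1)]] i(2)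
    by (simp add: has_bochner_integral_iff)
qed

text \<open>On the hyperplane itself the two values coincide, so it may belong to either
  branch.\<close>

definition polarize :: "'a::real_inner \<Rightarrow> real \<Rightarrow> ('a \<Rightarrow> real) \<Rightarrow> 'a \<Rightarrow> real" where
  "polarize e s v x = (if x \<bullet> e > s then max (v x) (v (reflect e s x)) else min (v x) (v (reflect e s x)))"

lemma borel_measurable_polarize [measurable]:
  fixes e :: "'a::euclidean_space"
  assumes [measurable]: "v \<in> borel_measurable borel"
  shows "polarize e s v \<in> borel_measurable borel"
  unfolding polarize_def by measurable

lemma polarize_pair:
  assumes e: "norm e = 1"
  shows "polarize e s v x = v x \<and> polarize e s v (reflect e s x) = v (reflect e s x) \<or>
    polarize e s v x = v (reflect e s x) \<and> polarize e s v (reflect e s x) = v x"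
  using reflect_inner[OF e, of s x] e reflect_eq_self[of x e s]
  by (auto simp: polarize_def max_def min_def)

text \<open>Under the reflection the even part of v is kept, and the odd part is replaced by its
  modulus carrying the sign of the side. On the hyperplane both sides are 0.\<close>

lemma polarize_diff:
  assumes e: "norm e = 1"
  shows "polarize e s v x - polarize e s v (reflect e s x) = sgn (x \<bullet> e - s) * \<bar>v x - v (reflect e s x)\<bar>"
  using reflect_inner[OF e, of s x] e reflect_eq_self[of x e s]
  by (auto simp: polarize_def max_def min_def sgn_if)

text \<open>Polarization at most exchanges the two values on a pair {x,
  \<open>reflect e s x\<close>}, so F has the same sum over the pair before and after; integrating
  this sum counts each integral twice.\<close>

lemma has_bochner_integral_polarize:
  fixes e :: "real ^ 'n::{finite,wellorder}" and F :: "real \<Rightarrow> real"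
  assumes e: "norm e = 1" and v [measurable]: "v \<in> borel_measurable borel" and F [measurable]: "F \<in> borel_measurable borel"
    and f: "has_bochner_integral lborel (\<lambda>x. F (v x)) I"
  shows "has_bochner_integral lborel (\<lambda>x. F (polarize e s v x)) I"
proof -
  let ?w = "polarize e s v"
  have sum: "F (?w x) + F (?w (reflect e s x)) = F (v x) + F (v (reflect e s x))" for x
    using polarize_pair[OF e, of s v x] by auto
  have S: "has_bochner_integral lborel (\<lambda>x. F (v x) + F (v (reflect e s x))) (I + I)"
    by (intro has_bochner_integral_add f has_bochner_integral_reflect[OF e f])
  have "has_bochner_integral lborel (\<lambda>x. \<bar>F (v x)\<bar>) (LINT x|lborel. \<bar>F (v x)\<bar>)"
    using f by (intro has_bochner_integral_integrable integrable_abs) (auto simp: has_bochner_integral_iff)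
  then have T: "integrable lborel (\<lambda>x. \<bar>F (v x)\<bar> + \<bar>F (v (reflect e s x))\<bar>)"
    using has_bochner_integral_reflect[OF e, of "\<lambda>x. \<bar>F (v x)\<bar>" _ s]
    by (intro Bochner_Integration.integrable_add) (auto simp: has_bochner_integral_iff)
  have i: "integrable lborel (\<lambda>x. F (?w x))"
  proof (rule Bochner_Integration.integrable_bound[OF T])
    have "\<bar>F (?w x)\<bar> \<le> \<bar>F (v x)\<bar> + \<bar>F (v (reflect e s x))\<bar>" for x
      using polarize_pair[OF e, of s v x] by auto
    then show "AE x in lborel. norm (F (?w x)) \<le> norm (\<bar>F (v x)\<bar> + \<bar>F (v (reflect e s x))\<bar>)"
      by (auto intro!: AE_I2)
  qed measurable
  define J where "J = (LINT x|lborel. F (?w x))"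
  have J: "has_bochner_integral lborel (\<lambda>x. F (?w x)) J" using i by (simp add: J_def has_bochner_integral_iff)
  have "has_bochner_integral lborel (\<lambda>x. F (?w x) + F (?w (reflect e s x))) (J + J)"
    by (intro has_bochner_integral_add J has_bochner_integral_reflect[OF e J])
  then have "J + J = I + I" unfolding sum using S by (rule has_bochner_integral_eq)
  then show ?thesis using J by simp
qed

lemma integrable12_polarize:
  fixes e :: "real ^ 'n::{finite,wellorder}"
  assumes e: "norm e = 1" and v: "integrable12 v"
  shows "integrable12 (polarize e s v)" "(LINT x|lborel. polarize e s v x) = (LINT x|lborel. v x)"
    "(LINT x|lborel. (polarize e s v x)\<^sup>2) = (LINT x|lborel. (v x)\<^sup>2)"
proof -
  have [measurable]: "v \<in> borel_measurable borel" using v by auto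
  have 1: "has_bochner_integral lborel (\<lambda>x. v x) (LINT x|lborel. v x)"
    and 2: "has_bochner_integral lborel (\<lambda>x. (v x)\<^sup>2) (LINT x|lborel. (v x)\<^sup>2)"
    using v by (auto simp: integrable12_def has_bochner_integral_iff)
  have 3: "has_bochner_integral lborel (\<lambda>x. polarize e s v x) (LINT x|lborel. v x)"
    by (rule has_bochner_integral_polarize[OF e, where F = "\<lambda>x. x"]) (use 1 in simp_all)
  have 4: "has_bochner_integral lborel (\<lambda>x. (polarize e s v x)\<^sup>2) (LINT x|lborel. (v x)\<^sup>2)"
    by (rule has_bochner_integral_polarize[OF e, where F = "\<lambda>x. x\<^sup>2"]) (use 2 in simp_all)
  show "integrable12 (polarize e s v)" "(LINT x|lborel. polarize e s v x) = (LINT x|lborel. v x)"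
    "(LINT x|lborel. (polarize e s v x)\<^sup>2) = (LINT x|lborel. (v x)\<^sup>2)"
    using 3 4 by (auto simp: integrable12_def has_bochner_integral_iff)
qed

lemma heat_kernel_cong_norm: "norm x = norm (y :: 'a::euclidean_space) \<Longrightarrow> heat_kernel t (x :: 'a) = heat_kernel t y"
  by (simp add: heat_kernel_def)

lemma heat_kernel_strict_mono:
  fixes x y :: "'a::euclidean_space"
  assumes "t > 0" "(norm x)\<^sup>2 < (norm y)\<^sup>2"
  shows "heat_kernel t y < heat_kernel t x"
  using assms by (auto simp: heat_kernel_def divide_simps)

text \<open>Averaging over the four reflected copies of a pair of points separates a part that polarization
  does not change from one that it can only increase.\<close>

lemma has_bochner_integral_heat_form_symmetrized:
  fixes e :: "real ^ 'n::{finite,wellorder}"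
  assumes e: "norm e = 1" and t: "t > 0" and v: "integrable lborel v"
  shows "has_bochner_integral (lborel \<Otimes>\<^sub>M lborel)
    (\<lambda>p. (heat_kernel t (fst p - snd p) + heat_kernel t (fst p - reflect e s (snd p))) *
           ((v (fst p) + v (reflect e s (fst p))) * (v (snd p) + v (reflect e s (snd p)))) +
         (heat_kernel t (fst p - snd p) - heat_kernel t (fst p - reflect e s (snd p))) *
           ((v (fst p) - v (reflect e s (fst p))) * (v (snd p) - v (reflect e s (snd p)))))
    (8 * heat_form t v)"
proof -
  let ?P = "lborel \<Otimes>\<^sub>M lborel :: ((real, 'n) vec \<times> (real, 'n) vec) measure" and ?r = "reflect e s"
  let ?K = "\<lambda>x y. heat_kernel t (x - y)"
  have K1: "?K (?r x) (?r y) = ?K x y" for x y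
    by (rule heat_kernel_cong_norm) (rule norm_reflect_diff_reflect[OF e])
  have K2: "?K (?r x) y = ?K x (?r y)" for x y
    using K1[of x "?r y"] e by simp
  have h1: "has_bochner_integral ?P (\<lambda>p. v (fst p) * v (snd p) * ?K (fst p) (snd p)) (heat_form t v)"
    unfolding heat_form_def by (intro has_bochner_integral_integrable integrable_heat_form t v)
  have h2: "has_bochner_integral ?P (\<lambda>p. v (fst p) * v (?r (snd p)) * ?K (fst p) (?r (snd p))) (heat_form t v)"
    using has_bochner_integral_reflect_snd[OF e h1, of s] by simp
  have h3: "has_bochner_integral ?P (\<lambda>p. v (?r (fst p)) * v (snd p) * ?K (fst p) (?r (snd p))) (heat_form t v)"
  proof -
    have eq: "v (snd p) * v (?r (fst p)) * ?K (snd p) (?r (fst p)) = v (?r (fst p)) * v (snd p) * ?K (fst p) (?r (snd p))" for p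
      using K2[of "fst p" "snd p"] heat_kernel_commute[of t "snd p" "?r (fst p)"] by simp
    show ?thesis using has_bochner_integral_swap[OF h2] by (simp only: fst_conv snd_conv eq)
  qed
  have h4: "has_bochner_integral ?P (\<lambda>p. v (?r (fst p)) * v (?r (snd p)) * ?K (fst p) (snd p)) (heat_form t v)"
    using has_bochner_integral_reflect_snd[OF e h3, of s] e by simp
  \<comment> \<open>The sum and difference products expand to twice the four reflected copies, which
    explains the factor 8.\<close>
  have "has_bochner_integral ?P (\<lambda>p. 2 * (v (fst p) * v (snd p) * ?K (fst p) (snd p) + v (fst p) * v (?r (snd p)) * ?K (fst p) (?r (snd p)) +
     v (?r (fst p)) * v (snd p) * ?K (fst p) (?r (snd p)) + v (?r (fst p)) * v (?r (snd p)) * ?K (fst p) (snd p)))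
     (2 * (heat_form t v + heat_form t v + heat_form t v + heat_form t v))"
    by (intro has_bochner_integral_add has_bochner_integral_mult_right h1 h2 h3 h4)
  then show ?thesis by (simp add: algebra_simps)
qed

text \<open>In the symmetrised form the even parts are untouched. The weight of the odd parts, the
  kernel at x - y minus the kernel at x - \<open>reflect e s y\<close>, has the sign of h x * h y by
  monotonicity of the heat kernel, and polarization gives the product of odd parts that same sign.
  The gain D is therefore pointwise nonnegative, and equality makes it vanish almost
  everywhere.\<close>

lemma heat_form_polarize:
  fixes e :: "real ^ 'n::{finite,wellorder}"
  assumes e: "norm e = 1" and t: "t > 0" and v: "integrable12 v"
  shows "heat_form t v \<le> heat_form t (polarize e s v)"
    and "heat_form t v = heat_form t (polarize e s v) \<Longrightarrow>
      (AE x in lborel. x \<bullet> e > s \<longrightarrow> v (reflect e s x) \<le> v x) \<or>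
      (AE x in lborel. x \<bullet> e > s \<longrightarrow> v x \<le> v (reflect e s x))"
proof -
  let ?P = "lborel \<Otimes>\<^sub>M lborel :: ((real, 'n) vec \<times> (real, 'n) vec) measure"
  let ?r = "reflect e s" and ?w = "polarize e s v"
  have vm [measurable]: "v \<in> borel_measurable borel" using v by auto
  define \<delta> where "\<delta> = (\<lambda>x. v x - v (?r x))"
  have [measurable]: "\<delta> \<in> borel_measurable borel" unfolding \<delta>_def by measurable
  define h where "h = (\<lambda>x. x \<bullet> e - s)"
  define D where "D = (\<lambda>p. (heat_kernel t (fst p - snd p) - heat_kernel t (fst p - ?r (snd p))) *
     (sgn (h (fst p)) * sgn (h (snd p)) * \<bar>\<delta> (fst p)\<bar> * \<bar>\<delta> (snd p)\<bar> - \<delta> (fst p) * \<delta> (snd p)))"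
  have iv: "integrable lborel v" "integrable lborel ?w"
    using v integrable12_polarize(1)[OF e v] by (auto simp: integrable12_def)
  have sum: "?w x + ?w (?r x) = v x + v (?r x)" for x
    using polarize_pair[OF e, of s v x] by auto
  have diff: "?w x - ?w (?r x) = sgn (h x) * \<bar>\<delta> x\<bar>" for x
    unfolding h_def \<delta>_def by (rule polarize_diff[OF e])
  have HD: "has_bochner_integral ?P D (8 * heat_form t ?w - 8 * heat_form t v)"
    using has_bochner_integral_diff[OF has_bochner_integral_heat_form_symmetrized[OF e t iv(2), of s]
        has_bochner_integral_heat_form_symmetrized[OF e t iv(1), of s]]
    unfolding sum diff D_def \<delta>_def by (simp add: algebra_simps)
  have \<delta>0: "\<delta> x = 0" if "h x = 0" for x
    using that reflect_eq_self[of x e s] by (simp add: \<delta>_def h_def)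
  have norm_diff: "(norm (x - ?r y))\<^sup>2 = (norm (x - y))\<^sup>2 + 4 * (h x * h y)" for x y
    using norm_diff_reflect[OF e, of x s y] by (simp only: h_def mult.assoc)
  have Kpos: "heat_kernel t (x - ?r y) < heat_kernel t (x - y)" if "h x * h y > 0" for x y
    using that norm_diff by (intro heat_kernel_strict_mono t) simp
  have Kneg: "heat_kernel t (x - y) < heat_kernel t (x - ?r y)" if "h x * h y < 0" for x y
    using that norm_diff by (intro heat_kernel_strict_mono t) simp
  have D0: "D p \<ge> 0" for p
  proof -
    let ?x = "fst p" and ?y = "snd p"
    have ab: "\<bar>\<delta> ?x * \<delta> ?y\<bar> = \<bar>\<delta> ?x\<bar> * \<bar>\<delta> ?y\<bar>" by (rule abs_mult)
    consider "h ?x * h ?y > 0" | "h ?x * h ?y < 0" | "h ?x = 0 \<or> h ?y = 0"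
      by (metis linorder_less_linear mult_eq_0_iff)
    then show ?thesis
    proof cases
      case 1
      then have "sgn (h ?x) * sgn (h ?y) = 1" by (metis sgn_mult sgn_pos)
      then have "D p = (heat_kernel t (?x - ?y) - heat_kernel t (?x - ?r ?y)) * (\<bar>\<delta> ?x * \<delta> ?y\<bar> - \<delta> ?x * \<delta> ?y)"
        unfolding D_def ab by simp
      then show ?thesis using Kpos[OF 1] by (simp add: mult_nonneg_nonneg)
    next
      case 2
      then have "sgn (h ?x) * sgn (h ?y) = -1" by (metis sgn_mult sgn_neg)
      then have "D p = (heat_kernel t (?x - ?y) - heat_kernel t (?x - ?r ?y)) * (- \<bar>\<delta> ?x * \<delta> ?y\<bar> - \<delta> ?x * \<delta> ?y)"
        unfolding D_def ab by simp
      moreover have "- \<bar>\<delta> ?x * \<delta> ?y\<bar> - \<delta> ?x * \<delta> ?y \<le> 0" by linarith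
      ultimately show ?thesis using Kneg[OF 2] by (simp add: mult_nonpos_nonpos)
    next
      case 3
      then show ?thesis using \<delta>0 by (auto simp: D_def)
    qed
  qed
  show "heat_form t v \<le> heat_form t ?w"
    using has_bochner_integral_nonneg[OF HD D0] by simp
  assume eq: "heat_form t v = heat_form t ?w"
  have "integral\<^sup>L ?P D = 0" "integrable ?P D" using HD eq by (auto simp: has_bochner_integral_iff)
  then have aeD: "AE p in ?P. D p = 0" using D0 by (subst (asm) integral_nonneg_eq_0_iff_AE) auto
  \<comment> \<open>A and B collect the points of the half-space where v exceeds its reflection, or
    falls below it. D is strictly positive on A \<times> B, so this product is null and one of its
    factors must be.\<close>
  define A B where "A = {x. h x > 0 \<and> \<delta> x > 0}" and "B = {x. h x > 0 \<and> \<delta> x < 0}"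
  have ABm [measurable]: "A \<in> sets lborel" "B \<in> sets lborel" unfolding A_def B_def h_def by measurable
  have "AE p in ?P. p \<notin> A \<times> B"
    using aeD
  proof eventually_elim
    case (elim p)
    show ?case
    proof
      assume "p \<in> A \<times> B"
      then have p: "h (fst p) > 0" "h (snd p) > 0" "\<delta> (fst p) > 0" "\<delta> (snd p) < 0" by (auto simp: A_def B_def)
      then have "\<delta> (fst p) * \<delta> (snd p) < 0" by (simp add: mult_pos_neg)
      moreover have "heat_kernel t (fst p - snd p) - heat_kernel t (fst p - ?r (snd p)) > 0"
        using Kpos[of "fst p" "snd p"] p by simp
      moreover have "D p = (heat_kernel t (fst p - snd p) - heat_kernel t (fst p - ?r (snd p))) * (- 2 * (\<delta> (fst p) * \<delta> (snd p)))"
        using p by (simp add: D_def)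
      ultimately have "D p > 0" by (simp only: mult_pos_neg mult_pos_pos mult_neg_neg neg_numeral_less_zero)
      then show False using elim by simp
    qed
  qed
  moreover have AB: "A \<times> B \<in> sets ?P" using ABm by (intro pair_measureI) auto
  ultimately have "A \<times> B \<in> null_sets ?P" using AE_iff_null_sets[OF AB] by simp
  then have "emeasure ?P (A \<times> B) = 0" by (rule null_setsD1)
  then have "emeasure lborel A * emeasure lborel B = 0"
    using lborel.emeasure_pair_measure_Times[OF ABm] by simp
  then consider "A \<in> null_sets lborel" | "B \<in> null_sets lborel"
    using ABm by (auto simp: null_sets_def)
  then show "(AE x in lborel. x \<bullet> e > s \<longrightarrow> v (?r x) \<le> v x) \<or> (AE x in lborel. x \<bullet> e > s \<longrightarrow> v x \<le> v (?r x))"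
  proof cases
    case 1
    then have "AE x in lborel. x \<notin> A" by (rule AE_not_in)
    then have "AE x in lborel. x \<bullet> e > s \<longrightarrow> v x \<le> v (?r x)"
      by eventually_elim (auto simp: A_def h_def \<delta>_def)
    then show ?thesis ..
  next
    case 2
    then have "AE x in lborel. x \<notin> B" by (rule AE_not_in)
    then have "AE x in lborel. x \<bullet> e > s \<longrightarrow> v (?r x) \<le> v x"
      by eventually_elim (auto simp: B_def h_def \<delta>_def)
    then show ?thesis ..
  qed
qed

section \<open>Polarized sets and polarized competitors\<close>

definition polarize_set :: "'a::real_inner \<Rightarrow> real \<Rightarrow> 'a set \<Rightarrow> 'a set" where
  "polarize_set e s \<Omega> = {x. x \<bullet> e > s} \<inter> (\<Omega> \<union> reflect e s -` \<Omega>) \<union> \<Omega> \<inter> reflect e s -` \<Omega>"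

text \<open>The intersection is adjoined on all of space, although the union absorbs it in the
  half-space; this exhibits the set as a union of open sets, with no condition at the
  hyperplane.\<close>

lemma open_polarize_set:
  assumes "open \<Omega>" shows "open (polarize_set e s \<Omega>)"
proof -
  have "open (reflect e s -` \<Omega>)" by (intro open_vimage assms continuous_reflect)
  moreover have "open {x. x \<bullet> e > s}" using open_halfspace_gt[of s e] by (simp add: inner_commute)
  ultimately show ?thesis unfolding polarize_set_def using assms by (intro open_Un open_Int)
qed

lemma bounded_polarize_set:
  assumes e: "norm e = 1" and "bounded \<Omega>" shows "bounded (polarize_set e s \<Omega>)"
proof -
  obtain R where R: "\<And>x. x \<in> \<Omega> \<Longrightarrow> norm x \<le> R" using assms(2) by (auto simp: bounded_iff)
  have "norm x \<le> R + norm (reflect e s 0)" if "reflect e s x \<in> \<Omega>" for x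
  proof -
    have "norm x = norm (reflect e s x - reflect e s 0)"
      using norm_reflect_diff_reflect[OF e, of s x 0] by simp
    also have "\<dots> \<le> norm (reflect e s x) + norm (reflect e s 0)" by (rule norm_triangle_ineq4)
    also have "\<dots> \<le> R + norm (reflect e s 0)" using R[OF that] by simp
    finally show ?thesis .
  qed
  then have "bounded (reflect e s -` \<Omega>)" by (auto simp: bounded_iff)
  then show ?thesis
    by (rule bounded_subset[OF bounded_Un[THEN iffD2, OF conjI, OF assms(2)]]) (auto simp: polarize_set_def)
qed

lemma indicator_polarize_set:
  "indicator (polarize_set e s \<Omega>) x = polarize e s (indicator \<Omega>) x"
  by (auto simp: polarize_set_def polarize_def indicator_def)

lemma measure_polarize_set:
  fixes e :: "real ^ 'n::{finite,wellorder}"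
  assumes e: "norm e = 1" and o: "open \<Omega>" and b: "bounded \<Omega>"
  shows "measure lborel (polarize_set e s \<Omega>) = measure lborel \<Omega>"
proof -
  have "has_bochner_integral lborel (\<lambda>x. indicator \<Omega> x :: real) (measure lborel \<Omega>)"
    using o emeasure_bounded_finite[OF b] by (intro has_bochner_integral_real_indicator) auto
  then have "has_bochner_integral lborel (\<lambda>x. polarize e s (indicator \<Omega>) x) (measure lborel \<Omega>)"
    using o by (intro has_bochner_integral_polarize[OF e, where F = "\<lambda>x. x"]) simp_all
  then have "has_bochner_integral lborel (indicator (polarize_set e s \<Omega>) :: _ \<Rightarrow> real) (measure lborel \<Omega>)"
    by (simp only: indicator_polarize_set[symmetric])
  then show ?thesis
    using open_polarize_set[OF o, of e s] by (auto simp: has_bochner_integral_iff)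
qed

text \<open>Preserved L^2 norms turn larger heat forms into smaller deficits at every time.
  Conversely, equal energies yield a time with equal deficits, to which the equality case of
  \<open>heat_form_polarize\<close> applies.\<close>

lemma polarize_torsion_admissible:
  fixes e :: "real ^ 'n::{finite,wellorder}"
  assumes e: "norm e = 1" and v: "v \<in> torsion_admissible \<Omega>" and nn: "\<And>x. v x \<ge> 0"
  shows "polarize e s v \<in> torsion_admissible (polarize_set e s \<Omega>)"
    and "half_energy (polarize e s v) \<le> half_energy v"
    and "half_energy v \<le> half_energy (polarize e s v) \<Longrightarrow>
      (AE x in lborel. x \<bullet> e > s \<longrightarrow> v (reflect e s x) \<le> v x) \<or>
      (AE x in lborel. x \<bullet> e > s \<longrightarrow> v x \<le> v (reflect e s x))"
proof -
  let ?w = "polarize e s v"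
  have v12: "integrable12 v" and fin: "half_energy v < top" and supp: "AE x in lborel. x \<notin> \<Omega> \<longrightarrow> v x = 0"
    using v by (auto simp: torsion_admissible_def)
  have w12: "integrable12 ?w" by (rule integrable12_polarize(1)[OF e v12])
  have le: "heat_deficit t ?w \<le> heat_deficit t v" if "t > 0" for t
    using heat_form_polarize(1)[OF e that v12] integrable12_polarize(3)[OF e v12] by (simp add: heat_deficit_def)
  show he: "half_energy ?w \<le> half_energy v" by (rule half_energy_mono[OF v12 w12 le])
  \<comment> \<open>Nonnegativity enters here: outside the half-space the smaller value is 0 as soon
    as one of the two is.\<close>
  have "AE x in lborel. x \<notin> polarize_set e s \<Omega> \<longrightarrow> ?w x = 0"
    using supp AE_reflect[OF e supp, of s]
  proof eventually_elim
    case (elim x)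
    then show ?case using nn[of x] nn[of "reflect e s x"]
      by (auto simp: polarize_set_def polarize_def max_def min_def)
  qed
  then show "?w \<in> torsion_admissible (polarize_set e s \<Omega>)"
    using w12 he fin by (auto simp: torsion_admissible_def)
  assume "half_energy v \<le> half_energy ?w"
  then obtain t where t: "t > 0" "heat_deficit t ?w = heat_deficit t v"
    using half_energy_eq_imp_heat_deficit_eq[OF v12 w12 le] fin by auto
  then have "heat_form t v = heat_form t ?w"
    using integrable12_polarize(3)[OF e v12, of s] by (simp add: heat_deficit_def)
  then show "(AE x in lborel. x \<bullet> e > s \<longrightarrow> v (reflect e s x) \<le> v x) \<or>
      (AE x in lborel. x \<bullet> e > s \<longrightarrow> v x \<le> v (reflect e s x))"
    by (rule heat_form_polarize(2)[OF e t(1) v12])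
qed

subsection \<open>Sets determined by their polarizations\<close>

text \<open>Turns a statement about almost every displacement w into one about almost every target
  point y = x - w.\<close>

lemma AE_lborel_reflect_point:
  fixes x :: "'a::euclidean_space"
  assumes "AE w in lborel. P w"
  shows "AE y in lborel. P (x - y)"
proof -
  have "lborel = distr lborel borel (\<lambda>y. x + (- 1) *\<^sub>R y)"
    using lborel_affine[of "- 1" x] by (simp add: density_1)
  then have eq: "lborel = distr lborel borel (\<lambda>y. x - y)" by simp
  have "AE w in distr lborel borel (\<lambda>y. x - y). P w" by (subst eq[symmetric]) (rule assms)
  then show ?thesis by (rule AE_distrD[rotated]) simp
qed

text \<open>The factor x \<bullet> e - s is odd under the reflection, so antisymmetrising f doubles
  the moment.\<close>

lemma has_bochner_integral_reflection_moment:
  fixes e :: "real ^ 'n::{finite,wellorder}"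
  assumes e: "norm e = 1" and f: "has_bochner_integral lborel (\<lambda>x. f x * (x \<bullet> e - s)) I"
  shows "has_bochner_integral lborel (\<lambda>x. (f x - f (reflect e s x)) * (x \<bullet> e - s)) (2 * I)"
proof -
  have "has_bochner_integral lborel (\<lambda>x. f (reflect e s x) * (reflect e s x \<bullet> e - s)) I"
    by (rule has_bochner_integral_reflect[OF e f])
  from has_bochner_integral_add[OF f this] show ?thesis
    unfolding reflect_inner[OF e] by (simp add: algebra_simps)
qed

text \<open>Comparing first moments: the reflected set wins on the side that contains the barycentre,
  and a hyperplane through the barycentre is a hyperplane of symmetry.  Composing two parallel
  reflections gives translations.\<close>

lemma AE_translate_of_reflection_dichotomy:
  fixes A :: "(real ^ 'n::{finite,wellorder}) set"
  assumes A [measurable]: "A \<in> sets borel" and bnd: "bounded A" and pos: "measure lborel A > 0"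
    and dich: "\<And>e s. norm e = 1 \<Longrightarrow>
      (AE x in lborel. x \<bullet> e > s \<longrightarrow> reflect e s x \<in> A \<longrightarrow> x \<in> A) \<or>
      (AE x in lborel. x \<bullet> e > s \<longrightarrow> x \<in> A \<longrightarrow> reflect e s x \<in> A)"
  shows "\<exists>c. \<forall>w. AE x in lborel. norm (x - w - c) < norm (x - c) \<longrightarrow> x \<in> A \<longrightarrow> x - w \<in> A"
proof -
  have fin: "emeasure lborel A < \<infinity>" by (rule emeasure_bounded_finite[OF bnd])
  obtain R where R: "\<And>x. x \<in> A \<Longrightarrow> norm x \<le> R" using bnd by (auto simp: bounded_iff)
  have iA: "integrable lborel (\<lambda>x. indicator A x :: real)"
    using fin by (intro integrable_real_indicator) auto
  have iX: "integrable lborel (\<lambda>x. indicat_real A x *\<^sub>R x)"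
  proof (rule Bochner_Integration.integrable_bound)
    show "integrable lborel (\<lambda>x. R * indicat_real A x)" using iA by simp
    show "AE x in lborel. norm (indicat_real A x *\<^sub>R x) \<le> norm (R * indicat_real A x)"
      using R by (auto intro!: AE_I2 order.trans[OF _ abs_ge_self] simp: indicator_def)
  qed measurable
  let ?m = "measure lborel A"
  \<comment> \<open>The barycentre of A.\<close>
  define c where "c = (1 / ?m) *\<^sub>R (LINT x|lborel. indicat_real A x *\<^sub>R x)"
  have moment: "has_bochner_integral lborel (\<lambda>x. indicat_real A x * (x \<bullet> e - s)) (?m * (c \<bullet> e - s))" for e s
  proof -
    have "has_bochner_integral lborel (\<lambda>x. (indicat_real A x *\<^sub>R x) \<bullet> e - s * indicat_real A x)
       ((LINT x|lborel. indicat_real A x *\<^sub>R x) \<bullet> e - s * (LINT x|lborel. indicat_real A x))"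
      by (intro has_bochner_integral_diff has_bochner_integral_inner_left has_bochner_integral_mult_right has_bochner_integral_integrable iA iX)
    moreover have "(LINT x|lborel. indicat_real A x *\<^sub>R x) = ?m *\<^sub>R c" using pos by (simp add: c_def)
    ultimately show ?thesis by (simp add: algebra_simps)
  qed
  \<comment> \<open>Under either alternative the antisymmetrised integrand keeps one sign on all of
    space: the alternative itself covers the side x \<bullet> e > s, its reflected version the other
    side.\<close>
  have case1: "(AE x in lborel. 0 \<le> (indicat_real A x - indicat_real A (reflect e s x)) * (x \<bullet> e - s))"
    if e: "norm e = 1" and 1: "AE x in lborel. x \<bullet> e > s \<longrightarrow> reflect e s x \<in> A \<longrightarrow> x \<in> A" for e s
    using 1 AE_reflect[OF e 1, of s]
  proof eventually_elim
    case (elim x)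
    have "reflect e s x \<bullet> e > s \<longleftrightarrow> x \<bullet> e < s" using reflect_inner[OF e, of s x] by linarith
    then show ?case using elim e
      by (cases "x \<bullet> e" s rule: linorder_cases) (auto simp: indicator_def split: if_splits)
  qed
  have case2: "(AE x in lborel. 0 \<le> - ((indicat_real A x - indicat_real A (reflect e s x)) * (x \<bullet> e - s)))"
    if e: "norm e = 1" and 1: "AE x in lborel. x \<bullet> e > s \<longrightarrow> x \<in> A \<longrightarrow> reflect e s x \<in> A" for e s
    using 1 AE_reflect[OF e 1, of s]
  proof eventually_elim
    case (elim x)
    have "reflect e s x \<bullet> e > s \<longleftrightarrow> x \<bullet> e < s" using reflect_inner[OF e, of s x] by linarith
    then show ?case using elim e
      by (cases "x \<bullet> e" s rule: linorder_cases) (auto simp: indicator_def split: if_splits)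
  qed
  \<comment> \<open>The other alternative would make the moment nonnegative, yet it has the sign of
    c \<bullet> e - s.\<close>
  have far: "AE x in lborel. x \<bullet> e > s \<longrightarrow> x \<in> A \<longrightarrow> reflect e s x \<in> A" if e: "norm e = 1" and s: "s > c \<bullet> e" for e s
  proof (rule ccontr)
    assume "\<not> ?thesis"
    then have "AE x in lborel. x \<bullet> e > s \<longrightarrow> reflect e s x \<in> A \<longrightarrow> x \<in> A" using dich[OF e, of s] by blast
    note nn = case1[OF e this]
    have "0 \<le> 2 * (?m * (c \<bullet> e - s))"
      using has_bochner_integral_reflection_moment[OF e moment[of e s]] integral_nonneg_AE[OF nn]
      by (simp add: has_bochner_integral_iff)
    then show False using pos s by (simp add: zero_le_mult_iff)
  qed
  \<comment> \<open>Here the moment is zero, so an integrand of constant sign vanishes almost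
    everywhere.\<close>
  have sym: "AE x in lborel. x \<in> A \<longleftrightarrow> reflect e (c \<bullet> e) x \<in> A" if e: "norm e = 1" for e
  proof -
    let ?s = "c \<bullet> e" and ?g = "\<lambda>x. (indicat_real A x - indicat_real A (reflect e (c \<bullet> e) x)) * (x \<bullet> e - c \<bullet> e)"
    have g: "has_bochner_integral lborel ?g 0"
      using has_bochner_integral_reflection_moment[OF e moment[of e ?s]] by simp
    have g': "has_bochner_integral lborel (\<lambda>x. - ?g x) 0"
      using has_bochner_integral_minus[OF g] by simp
    from dich[OF e, of ?s] have "AE x in lborel. ?g x = 0"
    proof
      assume "AE x in lborel. x \<bullet> e > ?s \<longrightarrow> reflect e ?s x \<in> A \<longrightarrow> x \<in> A"
      from case1[OF e this] g show ?thesis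
        using integral_nonneg_eq_0_iff_AE[of lborel ?g] by (simp add: has_bochner_integral_iff)
    next
      assume "AE x in lborel. x \<bullet> e > ?s \<longrightarrow> x \<in> A \<longrightarrow> reflect e ?s x \<in> A"
      from case2[OF e this] g' have "AE x in lborel. - ?g x = 0"
        using integral_nonneg_eq_0_iff_AE[of lborel "\<lambda>x. - ?g x"] by (simp add: has_bochner_integral_iff del: minus_mult_left)
      then show ?thesis by eventually_elim simp
    qed
    then show ?thesis
    proof eventually_elim
      case (elim x)
      show ?case
        using elim reflect_eq_self[of x e ?s] by (cases "x \<bullet> e = c \<bullet> e") (auto simp: indicator_def split: if_splits)
    qed
  qed
  have "AE x in lborel. norm (x - w - c) < norm (x - c) \<longrightarrow> x \<in> A \<longrightarrow> x - w \<in> A" for w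
  proof (cases "w = 0")
    case False
    define e where "e = (1 / norm w) *\<^sub>R w"
    have e: "norm e = 1" and w: "w = norm w *\<^sub>R e" using False by (simp_all add: e_def)
    \<comment> \<open>The hyperplanes at levels s and c \<bullet> e are norm w / 2 apart, so
      reflecting in the first and then in the second translates by -w.\<close>
    define s where "s = c \<bullet> e + norm w / 2"
    have s: "s > c \<bullet> e" using False by (simp add: s_def)
    show ?thesis
      using far[OF e s] AE_reflect[OF e sym[OF e], of s]
    proof eventually_elim
      case (elim x)
      have comp: "reflect e (c \<bullet> e) (reflect e s x) = x - w"
      proof -
        have "reflect e s x \<bullet> e = 2 * s - x \<bullet> e" using reflect_inner[OF e, of s x] by simp
        then have "reflect e (c \<bullet> e) (reflect e s x) = reflect e s x - (2 * (2 * s - x \<bullet> e - c \<bullet> e)) *\<^sub>R e"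
          by (simp add: reflect_def[of e "c \<bullet> e"])
        also have "\<dots> = x - (2 * (x \<bullet> e - s) + 2 * (2 * s - x \<bullet> e - c \<bullet> e)) *\<^sub>R e"
          unfolding reflect_def[of e s] by (simp only: scaleR_add_left diff_diff_eq)
        also have "2 * (x \<bullet> e - s) + 2 * (2 * s - x \<bullet> e - c \<bullet> e) = norm w" by (simp add: s_def)
        finally show ?thesis using w by simp
      qed
      show ?case
      proof (intro impI)
        assume n: "norm (x - w - c) < norm (x - c)" and xA: "x \<in> A"
        \<comment> \<open>Translating by -w brings x closer to c only if x lies beyond the
          hyperplane at level s.\<close>
        have "(norm (x - w - c))\<^sup>2 < (norm (x - c))\<^sup>2" using n by (intro power_strict_mono) auto
        moreover have "(norm (x - w - c))\<^sup>2 = (norm (x - c))\<^sup>2 - 2 * ((x - c) \<bullet> w) + (norm w)\<^sup>2"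
          by (simp add: power2_norm_eq_inner inner_diff_left inner_diff_right inner_commute algebra_simps)
        ultimately have "(norm w)\<^sup>2 < 2 * ((x - c) \<bullet> w)" by linarith
        also have "(x - c) \<bullet> w = norm w * ((x - c) \<bullet> e)" by (subst w) simp
        finally have "norm w * norm w < norm w * (2 * ((x - c) \<bullet> e))" by (simp add: power2_eq_square mult_ac)
        then have "norm w < 2 * ((x - c) \<bullet> e)" using False by simp
        then have "x \<bullet> e > s" by (simp add: s_def inner_diff_left)
        then have "reflect e s x \<in> A" using elim xA by blast
        then show "x - w \<in> A" using elim comp by simp
      qed
    qed
  qed simp
  then show ?thesis by blast
qed

section \<open>From inward translations to balls\<close>

lemma ball_measure_exists:
  fixes c :: "'a::euclidean_space"
  assumes "m > 0"
  shows "\<exists>\<rho>>0. measure lborel (ball c \<rho>) = m"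
proof -
  let ?V = "unit_ball_vol (real DIM('a))"
  define \<rho> where "\<rho> = root DIM('a) (m / ?V)"
  have "\<rho> > 0" unfolding \<rho>_def using assms by (simp add: real_root_gt_zero)
  moreover have "\<rho> ^ DIM('a) = m / ?V"
    unfolding \<rho>_def using assms by (intro real_root_pow_pos2) (auto intro!: divide_nonneg_nonneg less_imp_le)
  moreover have "?V > 0" by simp
  ultimately show ?thesis
    using content_ball[of \<rho> c] by (intro exI[of _ \<rho>]) (auto simp: measure_completion field_simps)
qed

text \<open>The comparison ball about c has the measure of A, so A - B and B - A have equal measure.
  Were both of positive measure, some x in A - B would be farther from c than every point of B - A,
  and inward translations would place almost all of B - A in A.\<close>

lemma AE_eq_ball:
  fixes A :: "'a::euclidean_space set"
  assumes A [measurable]: "A \<in> sets borel" and fin: "emeasure lborel A < \<infinity>" and pos: "measure lborel A > 0"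
    and tr: "\<And>w. AE x in lborel. norm (x - w - c) < norm (x - c) \<longrightarrow> x \<in> A \<longrightarrow> x - w \<in> A"
  shows "\<exists>\<rho>>0. AE x in lborel. x \<in> A \<longleftrightarrow> x \<in> ball c \<rho>"
proof -
  obtain \<rho> where \<rho>: "\<rho> > 0" "measure lborel (ball c \<rho>) = measure lborel A"
    using ball_measure_exists[OF pos] by blast
  let ?B = "ball c \<rho>"
  have Bm [measurable]: "?B \<in> sets borel" by simp
  \<comment> \<open>The exceptional null set of x depends on w; Fubini exchanges the two quantifiers
    so that x can be fixed first.\<close>
  have "AE x in lborel. AE w in lborel. norm (x - w - c) < norm (x - c) \<longrightarrow> x \<in> A \<longrightarrow> x - w \<in> A"
  proof (subst lborel_pair.AE_commute)
    show "AE w in lborel. AE x in lborel. norm (x - w - c) < norm (x - c) \<longrightarrow> x \<in> A \<longrightarrow> x - w \<in> A"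
      using tr by simp
  qed measurable
  then have main: "AE x in lborel. AE y in lborel. norm (y - c) < norm (x - c) \<longrightarrow> x \<in> A \<longrightarrow> y \<in> A"
    by eventually_elim (drule_tac x = x in AE_lborel_reflect_point, simp)
  have finB: "emeasure lborel ?B < \<infinity>" by (rule emeasure_lborel_ball_finite)
  have null_iff: "S \<in> null_sets lborel \<longleftrightarrow> measure lborel S = 0" if "S \<in> sets borel" "S \<subseteq> A \<or> S \<subseteq> ?B" for S
  proof -
    have "emeasure lborel S < \<infinity>"
      using that fin finB emeasure_mono[of S A lborel] emeasure_mono[of S ?B lborel] by (auto intro: order.strict_trans1)
    then show ?thesis using that by (auto simp: null_sets_def measure_def enn2real_eq_0_iff)
  qed
  have splitA: "measure lborel A = measure lborel (A \<inter> ?B) + measure lborel (A - ?B)"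
  proof -
    have "A = (A \<inter> ?B) \<union> (A - ?B)" by blast
    moreover have "emeasure lborel (A \<inter> ?B) \<noteq> \<infinity>" "emeasure lborel (A - ?B) \<noteq> \<infinity>"
      using fin emeasure_mono[of "A \<inter> ?B" A lborel] emeasure_mono[of "A - ?B" A lborel] by auto
    ultimately show ?thesis
      using measure_Union[of lborel "A \<inter> ?B" "A - ?B"] by auto
  qed
  have splitB: "measure lborel ?B = measure lborel (A \<inter> ?B) + measure lborel (?B - A)"
  proof -
    have "?B = (A \<inter> ?B) \<union> (?B - A)" by blast
    moreover have "emeasure lborel (A \<inter> ?B) \<noteq> \<infinity>" "emeasure lborel (?B - A) \<noteq> \<infinity>"
      using finB emeasure_mono[of "A \<inter> ?B" ?B lborel] emeasure_mono[of "?B - A" ?B lborel] by auto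
    ultimately show ?thesis
      using measure_Union[of lborel "A \<inter> ?B" "?B - A"] by auto
  qed
  have eqm: "measure lborel (A - ?B) = measure lborel (?B - A)" using splitA splitB \<rho> by linarith
  have "A - ?B \<in> null_sets lborel \<or> ?B - A \<in> null_sets lborel"
  proof (rule ccontr)
    assume no: "\<not> ?thesis"
    have "AE x in lborel. x \<notin> A - ?B"
      using main
    proof eventually_elim
      case (elim x)
      show ?case
      proof
        assume x: "x \<in> A - ?B"
        have "AE y in lborel. y \<notin> ?B - A"
          using elim by eventually_elim (use x in \<open>auto simp: dist_norm norm_minus_commute\<close>)
        then have "?B - A \<in> null_sets lborel" by (subst AE_iff_null_sets) auto
        then show False using no by simp
      qed
    qed
    then have "A - ?B \<in> null_sets lborel" by (subst AE_iff_null_sets) auto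
    then show False using no by simp
  qed
  then have N: "A - ?B \<in> null_sets lborel" "?B - A \<in> null_sets lborel"
    using eqm by (auto simp: null_iff)
  have "AE x in lborel. x \<notin> A - ?B" "AE x in lborel. x \<notin> ?B - A"
    by (rule AE_not_in[OF N(1)], rule AE_not_in[OF N(2)])
  then have "AE x in lborel. x \<in> A \<longleftrightarrow> x \<in> ?B" by eventually_elim auto
  then show ?thesis using \<rho> by blast
qed

section \<open>Dilations\<close>

lemma half_energy_scale:
  fixes u :: "'a::euclidean_space \<Rightarrow> real"
  assumes l: "\<mu> > 0" and u: "integrable12 u"
  shows "integrable12 (\<lambda>x. u ((1 / \<mu>) *\<^sub>R x))"
    and "(LINT x|lborel. u ((1 / \<mu>) *\<^sub>R x)) = \<mu> ^ DIM('a) * (LINT x|lborel. u x)"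
    and "half_energy (\<lambda>x. u ((1 / \<mu>) *\<^sub>R x)) = ennreal (\<mu> ^ (DIM('a) - 1)) * half_energy u"
proof -
  let ?w = "\<lambda>x. u ((1 / \<mu>) *\<^sub>R x)" and ?d = "DIM('a)"
  have [measurable]: "u \<in> borel_measurable borel" using u by auto
  have scale: "has_bochner_integral lborel (\<lambda>x. f ((1 / \<mu>) *\<^sub>R x)) (\<mu> ^ ?d *\<^sub>R (LINT x|lborel. f x))"
    if "integrable lborel f" for f :: "'a \<Rightarrow> 'b::{banach, second_countable_topology}"
    using has_bochner_integral_lborel_affine[of "1 / \<mu>" f _ 0, OF _ has_bochner_integral_integrable[OF that]] l
    by (simp add: power_one_over)
  have u1: "integrable lborel u" and u2: "integrable lborel (\<lambda>x. (u x)\<^sup>2)"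
    using u by (auto simp: integrable12_def)
  show "integrable12 ?w" "(LINT x|lborel. ?w x) = \<mu> ^ ?d * (LINT x|lborel. u x)"
    using scale[OF u1] scale[OF u2] by (auto simp: integrable12_def has_bochner_integral_iff)
  have F: "fourier_integral ?w \<xi> = \<mu> ^ ?d *\<^sub>R fourier_integral u (\<mu> *\<^sub>R \<xi>)" for \<xi>
  proof -
    have "has_bochner_integral lborel (\<lambda>x. cis (- (((1 / \<mu>) *\<^sub>R x) \<bullet> (\<mu> *\<^sub>R \<xi>))) * complex_of_real (?w x))
      (\<mu> ^ ?d *\<^sub>R fourier_integral u (\<mu> *\<^sub>R \<xi>))"
      unfolding fourier_integral_def by (rule scale[OF integrable_fourier_integral[OF u1]])
    then show ?thesis using l by (simp add: fourier_integral_def has_bochner_integral_iff)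
  qed
  \<comment> \<open>The squared transform brings \<mu>^(2 d), and |\<xi>| = |\<mu> \<xi>| / \<mu>
    takes one power away; the change of variables below removes d more, leaving \<mu>^(d -
    1).\<close>
  have dens: "energy_density ?w \<xi> = \<mu> ^ (2 * ?d - 1) * energy_density u (\<mu> *\<^sub>R \<xi>)" for \<xi>
  proof -
    have "\<mu> ^ (2 * ?d) = \<mu> ^ (2 * ?d - 1) * \<mu>"
      using DIM_positive[where 'a = 'a] by (simp flip: power_Suc2)
    then show ?thesis
      using l by (simp add: energy_density_def F power_mult_distrib power_mult[symmetric] mult_ac)
  qed
  have "half_energy ?w = ennreal (\<mu> ^ (2 * ?d - 1)) * (\<integral>\<^sup>+\<xi>. ennreal (energy_density u (\<mu> *\<^sub>R \<xi>)) \<partial>lborel)"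
    unfolding half_energy_def dens using l by (subst nn_integral_cmult[symmetric]) (auto simp: ennreal_mult')
  also have "\<mu> ^ (2 * ?d - 1) = \<mu> ^ (?d - 1) * \<mu> ^ ?d"
    using DIM_positive[where 'a = 'a] by (simp flip: power_add add: mult_2)
  also have "ennreal \<dots> * (\<integral>\<^sup>+\<xi>. ennreal (energy_density u (\<mu> *\<^sub>R \<xi>)) \<partial>lborel) =
    ennreal (\<mu> ^ (?d - 1)) * (ennreal (\<mu> ^ ?d) * (\<integral>\<^sup>+\<xi>. ennreal (energy_density u (\<mu> *\<^sub>R \<xi>)) \<partial>lborel))"
    using l by (simp add: ennreal_mult' mult.assoc)
  also have "ennreal (\<mu> ^ ?d) * (\<integral>\<^sup>+\<xi>. ennreal (energy_density u (\<mu> *\<^sub>R \<xi>)) \<partial>lborel) = half_energy u"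
    unfolding half_energy_def
    using l nn_integral_lborel_affine[of \<mu> "\<lambda>\<xi>. ennreal (energy_density u \<xi>)" 0] by simp
  finally show "half_energy ?w = ennreal (\<mu> ^ (?d - 1)) * half_energy u" .
qed

lemma AE_lborel_scale:
  fixes P :: "'a::euclidean_space \<Rightarrow> bool"
  assumes "c \<noteq> 0" "AE x in lborel. P x"
  shows "AE x in lborel. P (c *\<^sub>R x)"
proof -
  have "AE x in density (distr lborel borel (\<lambda>x. 0 + c *\<^sub>R x)) (\<lambda>_. ennreal (\<bar>c\<bar> ^ DIM('a))). P x"
    by (subst lborel_affine[OF assms(1), of 0, symmetric]) (rule assms(2))
  then have "AE x in distr lborel borel (\<lambda>x. 0 + c *\<^sub>R x). P x"
    using assms(1) by (subst (asm) AE_density) auto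
  then show ?thesis using AE_distrD[of "\<lambda>x. 0 + c *\<^sub>R x" lborel borel P] by simp
qed

text \<open>Dilation gives the value \<mu>^(d - 1) (1/2 \<open>half_form u\<close> - \<mu> ?I). A
  negative value at u forces ?I > 0, so the bracket is smaller than
  \<open>torsion_functional u\<close> and negative, and a factor of at least 1 cannot raise
  it.\<close>

lemma torsion_admissible_scale:
  fixes u :: "'a::euclidean_space \<Rightarrow> real"
  assumes l: "\<mu> > 1" and u: "u \<in> torsion_admissible (ball c \<rho>)" and neg: "torsion_functional u < 0"
  shows "\<exists>w\<in>torsion_admissible (ball (\<mu> *\<^sub>R c) (\<mu> * \<rho>)). torsion_functional w < torsion_functional u"
proof -
  let ?w = "\<lambda>x. u ((1 / \<mu>) *\<^sub>R x)" and ?d = "DIM('a)" and ?I = "LINT x|lborel. u x"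
  have u12: "integrable12 u" "half_energy u < top" and supp: "AE x in lborel. x \<notin> ball c \<rho> \<longrightarrow> u x = 0"
    using u by (auto simp: torsion_admissible_def)
  have l0: "\<mu> > 0" using l by simp
  note S = half_energy_scale[OF l0 u12(1)]
  have "AE x in lborel. (1 / \<mu>) *\<^sub>R x \<notin> ball c \<rho> \<longrightarrow> ?w x = 0"
    by (rule AE_lborel_scale[OF _ supp]) (use l in simp)
  moreover have "(1 / \<mu>) *\<^sub>R x \<notin> ball c \<rho>" if "x \<notin> ball (\<mu> *\<^sub>R c) (\<mu> * \<rho>)" for x
  proof -
    have "dist (\<mu> *\<^sub>R c) x = dist (\<mu> *\<^sub>R c) (\<mu> *\<^sub>R ((1 / \<mu>) *\<^sub>R x))" using l0 by simp
    also have "\<dots> = \<mu> * dist c ((1 / \<mu>) *\<^sub>R x)"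
      unfolding dist_norm scaleR_diff_right[symmetric] norm_scaleR using l0 by simp
    finally show ?thesis using that l0 by simp
  qed
  ultimately have ws: "AE x in lborel. x \<notin> ball (\<mu> *\<^sub>R c) (\<mu> * \<rho>) \<longrightarrow> ?w x = 0"
    by (auto elim!: eventually_mono)
  have "half_energy ?w < top" unfolding S(3) using u12(2) by (simp add: ennreal_mult_less_top)
  then have wA: "?w \<in> torsion_admissible (ball (\<mu> *\<^sub>R c) (\<mu> * \<rho>))"
    using S(1) ws by (simp add: torsion_admissible_def)
  have hf: "half_form ?w = \<mu> ^ (?d - 1) * half_form u"
    unfolding half_form_def S(3) using l0 by (simp add: enn2real_mult)
  have Ipos: "?I > 0" using neg half_form_nonneg[of u] unfolding torsion_functional_def by linarith
  have "\<mu> ^ ?d = \<mu> ^ (?d - 1) * \<mu>"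
    using DIM_positive[where 'a = 'a] by (simp flip: power_Suc2)
  then have "torsion_functional ?w = \<mu> ^ (?d - 1) * (1/2 * half_form u - \<mu> * ?I)"
    unfolding torsion_functional_def hf S(2) by (simp add: algebra_simps)
  also have "\<dots> \<le> 1 * (1/2 * half_form u - \<mu> * ?I)"
  proof (rule mult_right_mono_neg)
    show "1 \<le> \<mu> ^ (?d - 1)" using l by (intro one_le_power) simp
    have "1 * ?I \<le> \<mu> * ?I" using l Ipos by (intro mult_right_mono) auto
    then show "1/2 * half_form u - \<mu> * ?I \<le> 0" using neg unfolding torsion_functional_def by linarith
  qed
  also have "\<dots> < torsion_functional u"
    unfolding torsion_functional_def using mult_strict_right_mono[OF l Ipos] by simp
  finally show ?thesis using wA by blast
qed

section \<open>Removing the null set\<close>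

lemma open_AE_subset:
  fixes U :: "'a::euclidean_space set"
  assumes "open U" "closed C" "AE x in lborel. x \<in> U \<longrightarrow> x \<in> C"
  shows "U \<subseteq> C"
proof
  fix x assume "x \<in> U"
  moreover have "AE x \<in> U in lebesgue. x \<in> C" using assms(3) by (simp add: AE_completion_iff)
  ultimately show "x \<in> C" using mem_closed_if_AE_lebesgue_open[OF assms(1,2)] by blast
qed

text \<open>\<Omega> lies in the closed ball and, being open, in its interior. A point of the ball
  missing from \<Omega> still lies in the closure, hence on the frontier; but near a frontier point
  the side below the graph is a nonempty open set disjoint from \<Omega>, which an almost full
  \<Omega> does not allow. This excludes slits and punctures.\<close>

lemma smooth_boundary_AE_eq_ball:
  assumes o: "open \<Omega>" and sb: "smooth_boundary \<Omega>" and r: "\<rho> > 0"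
    and ae: "AE x in lborel. x \<in> \<Omega> \<longleftrightarrow> x \<in> ball c \<rho>"
  shows "\<Omega> = ball c \<rho>"
proof
  have "\<Omega> \<subseteq> cball c \<rho>"
    by (rule open_AE_subset[OF o]) (use ae in \<open>auto elim!: eventually_mono\<close>)
  then have "\<Omega> \<subseteq> interior (cball c \<rho>)" using o by (rule interior_maximal)
  then show "\<Omega> \<subseteq> ball c \<rho>" by simp
  have cl: "ball c \<rho> \<subseteq> closure \<Omega>"
  proof (rule open_AE_subset)
    show "AE x in lborel. x \<in> ball c \<rho> \<longrightarrow> x \<in> closure \<Omega>"
      using ae closure_subset[of \<Omega>] by (auto elim!: eventually_mono)
  qed auto
  show "ball c \<rho> \<subseteq> \<Omega>"
  proof (rule ccontr)
    assume "\<not> ?thesis"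
    then obtain p where p: "p \<in> ball c \<rho>" "p \<notin> \<Omega>" by blast
    then have "p \<in> frontier \<Omega>" using cl o by (auto simp: frontier_def interior_open)
    then obtain r e1 e2 \<gamma> where r: "r > 0" and e: "norm e1 = 1" "norm e2 = 1" "e1 \<bullet> e2 = 0"
      and \<gamma>: "\<forall>k t. (deriv ^^ k) \<gamma> differentiable (at t)"
      and eq: "\<Omega> \<inter> ball p r = {x \<in> ball p r. \<gamma> (x \<bullet> e1) < x \<bullet> e2}"
      using sb unfolding smooth_boundary_def by meson
    have "\<gamma> differentiable (at t)" for t using \<gamma>[rule_format, of 0 t] by simp
    then have cont: "continuous_on UNIV \<gamma>"
      by (intro continuous_at_imp_continuous_on ballI differentiable_imp_continuous_within)
    define U where "U = (ball p r \<inter> ball c \<rho>) \<inter> {x. x \<bullet> e2 < \<gamma> (x \<bullet> e1)}"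
    have "continuous_on UNIV (\<lambda>x. \<gamma> (x \<bullet> e1))"
      by (rule continuous_on_compose2[OF cont]) (auto intro!: continuous_intros)
    then have "open {x. x \<bullet> e2 < \<gamma> (x \<bullet> e1)}"
      by (intro open_Collect_less continuous_intros)
    then have oU: "open U" unfolding U_def by auto
    have "AE x in lborel. x \<in> U \<longrightarrow> x \<in> {}"
      using ae
    proof eventually_elim
      case (elim x)
      have "x \<notin> \<Omega>" if xU: "x \<in> U"
      proof
        assume "x \<in> \<Omega>"
        then have "x \<in> \<Omega> \<inter> ball p r" using xU by (simp add: U_def)
        then have "\<gamma> (x \<bullet> e1) < x \<bullet> e2" unfolding eq by simp
        then show False using xU by (simp add: U_def)
      qed
      then show ?case using elim by (auto simp: U_def)
    qed
    from open_AE_subset[OF oU closed_empty this] have U0: "U = {}" by simp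
    have "open (ball p r \<inter> ball c \<rho>)" "p \<in> ball p r \<inter> ball c \<rho>" using p r by auto
    then obtain d where d: "d > 0" "ball p d \<subseteq> ball p r \<inter> ball c \<rho>" by (metis open_contains_ball)
    \<comment> \<open>Since p is not in \<Omega>, it lies on or below the graph; a step against
      \<open>e2\<close> makes this strict, and d / 2 keeps the point in both balls.\<close>
    let ?q = "p - (d / 2) *\<^sub>R e2"
    have "?q \<in> ball p d" using d e by (simp add: dist_norm)
    then have "?q \<in> ball p r \<inter> ball c \<rho>" using d(2) by blast
    moreover have "\<not> \<gamma> (p \<bullet> e1) < p \<bullet> e2" using p(2) r eq by (metis (mono_tags, lifting) IntD1 centre_in_ball mem_Collect_eq)
    moreover have "?q \<bullet> e1 = p \<bullet> e1" "?q \<bullet> e2 = p \<bullet> e2 - d / 2"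
      using e by (simp_all add: inner_diff_left inner_commute[of e2] dot_square_norm)
    ultimately have "?q \<in> U" using d(1) unfolding U_def by (simp del: mem_ball)
    then show False using U0 by simp
  qed
qed

section \<open>The optimal domain is a disc\<close>

theorem corollary4:
  fixes \<Omega> :: "(real^2) set"
  assumes "bounded \<Omega>" and "connected \<Omega>" and "open \<Omega>" and "smooth_boundary \<Omega>"
    and "measure lborel \<Omega> = 1"
    and "energy \<Omega> = (INF \<Omega>' \<in> {\<Omega>'. open \<Omega>' \<and> measure lborel \<Omega>' = 1}. energy \<Omega>')"
  shows "\<exists>c r. r > 0 \<and> \<Omega> = ball c r"
proof -
  note bnd = assms(1) and o = assms(3) and m = assms(5)
  obtain u where uA: "u \<in> torsion_admissible \<Omega>" and u0: "\<And>x. u x \<ge> 0" and neg: "torsion_functional u < 0"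
    and umin: "\<And>v. v \<in> torsion_admissible \<Omega> \<Longrightarrow> torsion_functional u \<le> torsion_functional v"
    using exists_nonneg_torsion_minimizer[OF o m] by blast
  have u12: "integrable12 u" "half_energy u < top" and supp: "AE x in lborel. x \<notin> \<Omega> \<longrightarrow> u x = 0"
    using uA by (auto simp: torsion_admissible_def)
  have [measurable]: "u \<in> borel_measurable borel" using u12 by auto
  have ui: "integrable lborel u" using u12 by (simp add: integrable12_def)
  \<comment> \<open>Optimality of \<Omega> becomes a comparison of functions: u competes with every
    admissible function of every bounded open set of measure 1.\<close>
  have opt: "torsion_functional u \<le> torsion_functional v"
    if "open S" "bounded S" "measure lborel S = 1" "v \<in> torsion_admissible S" for S :: "(real^2) set" and v
  proof -
    have "ereal (torsion_functional u) \<le> energy \<Omega>"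
      unfolding energy_bounded[OF bnd] by (rule INF_greatest) (use umin in simp)
    also have "\<dots> \<le> energy S"
      unfolding assms(6) by (rule INF_lower) (use that in simp)
    also have "\<dots> \<le> ereal (torsion_functional v)"
      unfolding energy_bounded[OF that(2)] by (rule INF_lower) (use that in simp)
    finally show ?thesis by simp
  qed
  \<comment> \<open>Polarization preserves the measure of the domain and the integral of u, so
    \<open>opt\<close> compares only the quadratic parts and rules out a strict decrease.\<close>
  have ref: "(AE x in lborel. x \<bullet> e > s \<longrightarrow> u (reflect e s x) \<le> u x) \<or>
      (AE x in lborel. x \<bullet> e > s \<longrightarrow> u x \<le> u (reflect e s x))" if e: "norm e = 1" for e s
  proof -
    let ?w = "polarize e s u"
    have wA: "?w \<in> torsion_admissible (polarize_set e s \<Omega>)"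
      by (rule polarize_torsion_admissible(1)[OF e uA u0])
    have "measure lborel (polarize_set e s \<Omega>) = 1"
      using measure_polarize_set[OF e o bnd] m by simp
    from opt[OF open_polarize_set[OF o] bounded_polarize_set[OF e bnd] this wA]
    have "half_form u \<le> half_form ?w"
      using integrable12_polarize(2)[OF e u12(1), of s] by (simp add: torsion_functional_def)
    then have "half_energy u \<le> half_energy ?w"
      using u12(2) wA half_energy_eq[of u] half_energy_eq[of ?w]
      by (auto simp: torsion_admissible_def intro!: ennreal_leI)
    then show ?thesis by (rule polarize_torsion_admissible(3)[OF e uA u0])
  qed
  define A where "A = {x \<in> \<Omega>. u x > 0}"
  have Am [measurable]: "A \<in> sets borel" unfolding A_def using o by measurable
  have Asub: "A \<subseteq> \<Omega>" by (auto simp: A_def)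
  have aeA: "AE x in lborel. x \<in> A \<longleftrightarrow> u x > 0"
    using supp by eventually_elim (auto simp: A_def)
  have bA: "bounded A" by (rule bounded_subset[OF bnd Asub])
  have finA: "emeasure lborel A < \<infinity>" by (rule emeasure_bounded_finite[OF bA])
  \<comment> \<open>If u vanished almost everywhere, the functional would be nonnegative.\<close>
  have posA: "measure lborel A > 0"
  proof (rule ccontr)
    assume "\<not> ?thesis"
    then have "measure lborel A = 0" by (simp add: not_less order.antisym)
    then have "A \<in> null_sets lborel" using finA by (auto simp: null_sets_def measure_def enn2real_eq_0_iff)
    then have "AE x in lborel. x \<notin> A" by (rule AE_not_in)
    with aeA have "AE x in lborel. u x = 0"
      by eventually_elim (use u0 in \<open>auto simp: less_le\<close>)
    then have "(LINT x|lborel. u x) = 0" by (rule integral_eq_zero_AE)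
    then show False using neg half_form_nonneg[of u] by (simp add: torsion_functional_def)
  qed
  have dich: "(AE x in lborel. x \<bullet> e > s \<longrightarrow> reflect e s x \<in> A \<longrightarrow> x \<in> A) \<or>
      (AE x in lborel. x \<bullet> e > s \<longrightarrow> x \<in> A \<longrightarrow> reflect e s x \<in> A)" if e: "norm e = 1" for e s
    using ref[OF e, of s]
  proof
    assume "AE x in lborel. x \<bullet> e > s \<longrightarrow> u (reflect e s x) \<le> u x"
    with aeA AE_reflect[OF e aeA, of s]
    have "AE x in lborel. x \<bullet> e > s \<longrightarrow> reflect e s x \<in> A \<longrightarrow> x \<in> A" by eventually_elim auto
    then show ?thesis ..
  next
    assume "AE x in lborel. x \<bullet> e > s \<longrightarrow> u x \<le> u (reflect e s x)"
    with aeA AE_reflect[OF e aeA, of s]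
    have "AE x in lborel. x \<bullet> e > s \<longrightarrow> x \<in> A \<longrightarrow> reflect e s x \<in> A" by eventually_elim auto
    then show ?thesis ..
  qed
  obtain c where "\<And>w. AE x in lborel. norm (x - w - c) < norm (x - c) \<longrightarrow> x \<in> A \<longrightarrow> x - w \<in> A"
    using AE_translate_of_reflection_dichotomy[OF Am bA posA dich] by blast
  then obtain \<rho> where \<rho>: "\<rho> > 0" and ball: "AE x in lborel. x \<in> A \<longleftrightarrow> x \<in> ball c \<rho>"
    using AE_eq_ball[OF Am finA posA] by blast
  have mball: "measure lborel (ball c \<rho>) = measure lborel A"
    unfolding measure_def using ball by (intro arg_cong[of _ _ enn2real] emeasure_eq_AE) (auto elim!: eventually_mono)
  have fin\<Omega>: "emeasure lborel \<Omega> < \<infinity>" by (rule emeasure_bounded_finite[OF bnd])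
  have "measure lborel A \<le> measure lborel \<Omega>"
    using fin\<Omega> o Asub by (intro measure_mono_fmeasurable) (auto simp: fmeasurable_def)
  then have le1: "measure lborel A \<le> 1" using m by simp
  have "measure lborel A = 1"
  proof (rule ccontr)
    assume "measure lborel A \<noteq> 1"
    then have lt1: "measure lborel A < 1" using le1 by simp
    \<comment> \<open>Area scales with the square of \<mu>, so the dilated disc has measure exactly
      1 and is an allowed domain.\<close>
    define \<mu> where "\<mu> = sqrt (1 / measure lborel A)"
    have \<mu>: "\<mu> > 1" "\<mu>\<^sup>2 * measure lborel A = 1"
      using posA lt1 by (auto simp: \<mu>_def)
    have "AE x in lborel. x \<notin> ball c \<rho> \<longrightarrow> u x = 0"
      using ball aeA
    proof eventually_elim
      case (elim x)
      then show ?case using u0[of x] by auto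
    qed
    then have "u \<in> torsion_admissible (ball c \<rho>)" using u12 by (simp add: torsion_admissible_def)
    from torsion_admissible_scale[OF \<mu>(1) this neg]
    obtain w where w: "w \<in> torsion_admissible (ball (\<mu> *\<^sub>R c) (\<mu> * \<rho>))" "torsion_functional w < torsion_functional u"
      by blast
    have "measure lborel (ball (\<mu> *\<^sub>R c) (\<mu> * \<rho>)) = \<mu>\<^sup>2 * measure lborel (ball c \<rho>)"
      using content_ball[of "\<mu> * \<rho>" "\<mu> *\<^sub>R c"] content_ball[of \<rho> c] \<rho> \<mu>(1)
      by (simp add: measure_completion power_mult_distrib)
    then have "measure lborel (ball (\<mu> *\<^sub>R c) (\<mu> * \<rho>)) = 1" using \<mu>(2) mball by simp
    from opt[OF open_ball bounded_ball this w(1)] w(2) show False by simp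
  qed
  then have "measure lborel (\<Omega> - A) = 0"
    using m fin\<Omega> o Asub measure_Diff[of lborel \<Omega> A] by auto
  moreover have "emeasure lborel (\<Omega> - A) < \<infinity>"
    using fin\<Omega> o emeasure_mono[of "\<Omega> - A" \<Omega> lborel] by (auto intro: order.strict_trans1)
  ultimately have "\<Omega> - A \<in> null_sets lborel"
    using o by (auto simp: null_sets_def measure_def enn2real_eq_0_iff)
  then have "AE x in lborel. x \<notin> \<Omega> - A" by (rule AE_not_in)
  with ball have "AE x in lborel. x \<in> \<Omega> \<longleftrightarrow> x \<in> ball c \<rho>"
    by eventually_elim (use Asub in auto)
  then have "\<Omega> = ball c \<rho>"
    by (rule smooth_boundary_AE_eq_ball[OF o assms(4) \<rho>])
  then show ?thesis using \<rho> by blast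
qed

end
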